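(* Let $s>0$, $b>\max(\tfrac14,\tfrac12-\tfrac14 s)$ and let $\sigma$ be any permutation of $\{1,2,3\}$. Then there is a constant $C>0$ such that for all functions $u_1,u_2,u_3$ on $\mathbb{R}\times\mathbb{T}^2$ with $u_{\sigma(1)},u_{\sigma(2)}\in X^{s,b}$ and $u_{\sigma(3)}\in X^{0,b}$, $$\Vert u_1\,\overline{u_2}\,u_3\Vert_{X^{0,-b}}\le C\,\Vert u_{\sigma(1)}\Vert_{X^{s,b}}\Vert u_{\sigma(2)}\Vert_{X^{s,b}}\Vert u_{\sigma(3)}\Vert_{X^{0,b}} .$$
   Context: $\mathbb{T}^2=(\mathbb{R}/2\pi\mathbb{Z})^2$ and $\langle\cdot\rangle=(1+|\cdot|^2)^{1/2}$. For $u$ on $\mathbb{R}\times\mathbb{T}^2$ put $\tilde u(\sigma,k)=\int_{\mathbb{R}\times\mathbb{T}^2}u(t,x)e^{-i\sigma t-i\langle k,x\rangle}\,dx\,dt$, and $\Vert u\Vert_{X^{s,b}}=\Vert\langle k\rangle^s\langle\sigma+|k|^2\rangle^b\tilde u(\sigma,k)\Vert_{L^2_\sigma(\mathbb{R})\,l^2_k(\mathbb{Z}^2)}$. *)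

theory Defs
  imports "HOL-Probability.Sinc_Integral" "HOL-Combinatorics.Permutations"
begin

text \<open>
  Functions on \<open>\<real> \<times> T\<^sup>2\<close>, where \<open>T = \<real>/2\<pi>\<int>\<close>, are rendered as functions of \<open>(t, x)\<close>, with \<open>x\<close> in
  \<open>\<real>\<^sup>2\<close>, that are \<open>2\<pi>\<close>-periodic in both components of \<open>x\<close>.  Integration over \<open>\<real> \<times> T\<^sup>2\<close> is Lebesgue
  integration over \<open>\<real> \<times> [0, 2\<pi>)\<^sup>2\<close>.
\<close>

definition lat :: "int ^ 2 \<Rightarrow> real ^ 2" where
  "lat k = (\<chi> j. real_of_int (k $ j))"

definition periodic :: "(real \<times> (real ^ 2) \<Rightarrow> complex) \<Rightarrow> bool" where
  "periodic u \<longleftrightarrow> (\<forall>t x m. u (t, x + (2 * pi) *\<^sub>R lat m) = u (t, x))"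

definition RT2 :: "(real \<times> (real ^ 2)) measure" where
  "RT2 = lebesgue_on (UNIV \<times> {x. \<forall>j. 0 \<le> x $ j \<and> x $ j < 2 * pi})"

definition japanese :: "'a::real_normed_vector \<Rightarrow> real" where
  "japanese x = sqrt (1 + (norm x)\<^sup>2)"

text \<open>The space-time Fourier integral, meaningful for integrable \<open>u\<close>.\<close>

definition st_fourier_integral :: "(real \<times> (real ^ 2) \<Rightarrow> complex) \<Rightarrow> real \<Rightarrow> int ^ 2 \<Rightarrow> complex" where
  "st_fourier_integral u \<sigma> k = (LINT p|RT2. u p * cis (- \<sigma> * fst p - lat k \<bullet> snd p))"

text \<open>
  The elements of \<open>X\<^sup>s\<^sup>,\<^sup>b\<close> need not be integrable (for \<open>s, b \<ge> 0\<close> they are just square integrable), so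
  their Fourier transform is the one of tempered distributions.  By density of their span, it suffices
  to test against products of a Schwartz function of the time variable and a character of the torus.
\<close>

definition schwartz :: "(real \<Rightarrow> complex) \<Rightarrow> bool" where
  "schwartz \<phi> \<longleftrightarrow> (\<exists>D. D 0 = \<phi> \<and>
     (\<forall>n t. (D n has_vector_derivative D (Suc n) t) (at t)) \<and>
     (\<forall>n m. bounded (range (\<lambda>t. complex_of_real (t ^ m) * D n t))))"

definition fourier :: "(real \<Rightarrow> complex) \<Rightarrow> real \<Rightarrow> complex" where
  "fourier \<phi> t = (LINT \<sigma>|lborel. \<phi> \<sigma> * cis (- \<sigma> * t))"

text \<open>
  \<open>has_st_fourier u v\<close>: the function \<open>u\<close> is a tempered distribution, and its space-time Fourier transform
  is (represented by) the function \<open>v\<close>, which is then unique up to null sets in \<open>\<sigma>\<close>.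
\<close>

definition has_st_fourier ::
    "(real \<times> (real ^ 2) \<Rightarrow> complex) \<Rightarrow> (real \<Rightarrow> int ^ 2 \<Rightarrow> complex) \<Rightarrow> bool" where
  "has_st_fourier u v \<longleftrightarrow>
     u \<in> borel_measurable RT2 \<and>
     (\<forall>\<psi>. schwartz \<psi> \<longrightarrow> integrable RT2 (\<lambda>p. u p * \<psi> (fst p))) \<and>
     (\<forall>k. (\<lambda>\<sigma>. v \<sigma> k) \<in> borel_measurable lborel \<and>
       (\<forall>\<phi>. schwartz \<phi> \<longrightarrow>
         integrable lborel (\<lambda>\<sigma>. v \<sigma> k * \<phi> \<sigma>) \<and>
         (LINT p|RT2. u p * (fourier \<phi> (fst p) * cis (- (lat k \<bullet> snd p)))) =
         (LINT \<sigma>|lborel. v \<sigma> k * \<phi> \<sigma>)))"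

text \<open>For integrable functions, this is the Fourier integral.\<close>

lemma schwartz_bounded:
  assumes "schwartz \<phi>"
  shows "\<exists>C\<ge>0. \<forall>t. cmod (\<phi> t) \<le> C * inverse (1 + t\<^sup>2)"
proof -
  obtain D where "D 0 = \<phi> \<and>
     (\<forall>n t. (D n has_vector_derivative D (Suc n) t) (at t)) \<and>
     (\<forall>n m. bounded (range (\<lambda>t. complex_of_real (t ^ m) * D n t)))"
    using assms unfolding schwartz_def ..
  then have D: "D 0 = \<phi>"
    and B: "\<forall>n m. bounded (range (\<lambda>t. complex_of_real (t ^ m) * D n t))"
    by blast+
  obtain A0 where A0: "\<And>t. cmod (\<phi> t) \<le> A0"
    using B[rule_format, of 0 0] D by (auto simp: bounded_iff)
  obtain A2 where A2: "\<And>t. cmod (complex_of_real (t ^ 2) * \<phi> t) \<le> A2"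
  proof -
    have "bounded (range (\<lambda>t. complex_of_real (t ^ 2) * D 0 t))"
      using B by blast
    then show ?thesis
      using that unfolding D bounded_iff by blast
  qed
  have le: "cmod (\<phi> t) \<le> (A0 + A2) * inverse (1 + t\<^sup>2)" for t
  proof -
    have "cmod (\<phi> t) * (1 + t\<^sup>2) \<le> A0 + A2"
      using A0[of t] A2[of t] by (simp add: norm_mult norm_power algebra_simps)
    moreover have "1 + t\<^sup>2 > 0" by (simp add: add_pos_nonneg)
    ultimately show ?thesis
      by (simp add: pos_le_divide_eq divide_inverse[symmetric])
  qed
  have "A0 + A2 \<ge> 0"
    using order_trans[OF norm_ge_zero le[of 0]] by simp
  with le show ?thesis by blast
qed

lemma schwartz_measurable:
  assumes "schwartz \<phi>" shows "\<phi> \<in> borel_measurable borel"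
proof -
  obtain D where "D 0 = \<phi>" "\<forall>n t. (D n has_vector_derivative D (Suc n) t) (at t)"
    using assms unfolding schwartz_def by blast
  then have "\<And>t. isCont \<phi> t"
    by (metis has_vector_derivative_continuous)
  then show ?thesis
    by (intro borel_measurable_continuous_onI) (simp add: continuous_on_eq_continuous_at)
qed

lemma schwartz_integrable:
  assumes "schwartz \<phi>" shows "integrable lborel \<phi>"
proof -
  obtain C where C: "\<And>t. cmod (\<phi> t) \<le> C * inverse (1 + t\<^sup>2)" "C \<ge> 0"
    using schwartz_bounded[OF assms] by blast
  have "integrable lborel (\<lambda>t::real. inverse (1 + t\<^sup>2))"
    using integrable_inverse_1_plus_square by (simp add: set_integrable_def)
  then have "integrable lborel (\<lambda>t::real. C * inverse (1 + t\<^sup>2))"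
    by simp
  then show ?thesis
    by (rule Bochner_Integration.integrable_bound)
      (use schwartz_measurable[OF assms] C in \<open>auto simp: abs_mult\<close>)
qed

lemma borel_measurable_RT2:
  assumes "f \<in> borel_measurable borel" shows "f \<in> borel_measurable RT2"
  unfolding RT2_def using assms
  by (intro measurable_restrict_space1 measurable_completion) simp

lemma sigma_finite_RT2: "sigma_finite_measure RT2"
proof -
  have "{x :: real ^ 2. \<forall>j. 0 \<le> x $ j \<and> x $ j < 2 * pi} \<in> sets borel"
    by measurable
  then have "(UNIV :: real set) \<times> {x :: real ^ 2. \<forall>j. 0 \<le> x $ j \<and> x $ j < 2 * pi} \<in> sets borel"
    unfolding borel_prod[symmetric] by (intro pair_measureI) auto
  moreover have "sigma_finite_measure (lebesgue :: (real \<times> (real ^ 2)) measure)"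
  proof -
    obtain A :: "(real \<times> (real ^ 2)) set set" where A: "countable A" "A \<subseteq> sets lborel" "\<Union>A = UNIV"
      "\<forall>a\<in>A. emeasure lborel a \<noteq> \<infinity>"
      using lborel.sigma_finite_countable by auto
    then show ?thesis
      by (intro sigma_finite_measure.intro exI[of _ A]) (auto simp: sets_completionI_sets)
  qed
  ultimately show ?thesis
    unfolding RT2_def by (intro sigma_finite_measure_restrict_space) auto
qed

lemma has_st_fourier_st_fourier_integral:
  assumes u: "integrable RT2 u"
  shows "has_st_fourier u (st_fourier_integral u)"
proof -
  interpret R: sigma_finite_measure RT2 by (rule sigma_finite_RT2)
  interpret P: pair_sigma_finite lborel RT2 ..
  have um[measurable]: "u \<in> borel_measurable RT2" using u by simp
  have fm[measurable]: "fst \<in> borel_measurable RT2"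
    by (intro borel_measurable_RT2 borel_measurable_continuous_onI continuous_intros)
  have sm[measurable]: "snd \<in> borel_measurable RT2"
    by (intro borel_measurable_RT2 borel_measurable_continuous_onI continuous_intros)
  have cism[measurable]: "cis \<in> borel_measurable borel"
    by (intro borel_measurable_continuous_onI continuous_intros)
  have 1: "integrable RT2 (\<lambda>p. u p * \<psi> (fst p))" if S: "schwartz \<psi>" for \<psi>
  proof -
    obtain C where C: "\<And>t. cmod (\<psi> t) \<le> C * inverse (1 + t\<^sup>2)" "C \<ge> 0"
      using schwartz_bounded[OF S] by blast
    have C': "cmod (\<psi> t) \<le> C" for t
    proof -
      have "inverse (1 + t\<^sup>2) \<le> 1"
        by (intro inverse_le_1_iff[THEN iffD2]) simp
      with C show ?thesis by (meson mult_left_le order_trans)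
    qed
    have [measurable]: "\<psi> \<in> borel_measurable borel" by (rule schwartz_measurable[OF S])
    have "integrable RT2 (\<lambda>p. C * norm (u p))" using u by simp
    then show ?thesis
      by (rule Bochner_Integration.integrable_bound)
        (use \<open>C \<ge> 0\<close> in \<open>auto simp: norm_mult mult.commute[of C] intro!: mult_left_mono C'\<close>)
  qed
  have 2: "(\<lambda>\<sigma>. st_fourier_integral u \<sigma> k) \<in> borel_measurable lborel" for k
    unfolding st_fourier_integral_def by measurable
  have 3: "integrable lborel (\<lambda>\<sigma>. st_fourier_integral u \<sigma> k * \<phi> \<sigma>) \<and>
         (LINT p|RT2. u p * (fourier \<phi> (fst p) * cis (- (lat k \<bullet> snd p)))) =
         (LINT \<sigma>|lborel. st_fourier_integral u \<sigma> k * \<phi> \<sigma>)"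
    if S: "schwartz \<phi>" for \<phi> k
  proof -
    have [measurable]: "\<phi> \<in> borel_measurable borel" by (rule schwartz_measurable[OF S])
    define F where "F = (\<lambda>\<sigma> p. u p * cis (- \<sigma> * fst p - lat k \<bullet> snd p) * \<phi> \<sigma>)"
    have nF: "norm (F \<sigma> p) = norm (u p) * norm (\<phi> \<sigma>)" for \<sigma> p
      by (simp add: F_def norm_mult)
    have mF: "case_prod F \<in> borel_measurable (lborel \<Otimes>\<^sub>M RT2)"
      unfolding F_def by measurable
    have "integrable (lborel \<Otimes>\<^sub>M RT2) (case_prod F)"
    proof (rule P.Fubini_integrable[OF mF])
      show "integrable lborel (\<lambda>\<sigma>. LINT p|RT2. norm (case (\<sigma>, p) of (x, y) \<Rightarrow> F x y))"
        using schwartz_integrable[OF S] u by (simp add: nF)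
      have "integrable RT2 (F \<sigma>)" for \<sigma>
      proof -
        have "integrable RT2 (\<lambda>p. norm (u p) * norm (\<phi> \<sigma>))" using u by simp
        then show ?thesis
          by (rule Bochner_Integration.integrable_bound) (auto simp: nF F_def norm_mult)
      qed
      then show "AE \<sigma> in lborel. integrable RT2 (\<lambda>p. case (\<sigma>, p) of (x, y) \<Rightarrow> F x y)"
        by simp
    qed
    note I = this
    have a: "(LINT p|RT2. F \<sigma> p) = st_fourier_integral u \<sigma> k * \<phi> \<sigma>" for \<sigma>
      unfolding F_def st_fourier_integral_def by simp
    have b: "(LINT \<sigma>|lborel. F \<sigma> p) = u p * (fourier \<phi> (fst p) * cis (- (lat k \<bullet> snd p)))" for p
    proof -
      have "F \<sigma> p = (u p * cis (- (lat k \<bullet> snd p))) * (\<phi> \<sigma> * cis (- \<sigma> * fst p))" for \<sigma>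
        unfolding F_def by (simp add: cis_mult algebra_simps)
      then show ?thesis
        unfolding fourier_def by (simp only: integral_mult_right_zero) (simp add: mult_ac)
    qed
    show ?thesis
      using P.integrable_fst'[OF I] P.Fubini_integral[OF I] by (simp add: a b)
  qed
  show ?thesis
    unfolding has_st_fourier_def using um 1 2 3 by blast
qed

text \<open>The squared weighted norm in \<open>L\<^sup>2\<^sub>\<sigma> l\<^sup>2\<^sub>k\<close>.\<close>

definition weighted_sq :: "real \<Rightarrow> real \<Rightarrow> (real \<Rightarrow> int ^ 2 \<Rightarrow> complex) \<Rightarrow> ennreal" where
  "weighted_sq s b v =
     (\<integral>\<^sup>+ k. (\<integral>\<^sup>+ \<sigma>. ennreal ((japanese (lat k) powr s *
          japanese (\<sigma> + (norm (lat k))\<^sup>2) powr b * cmod (v \<sigma> k))\<^sup>2) \<partial>lborel) \<partial>count_space UNIV)"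

text \<open>
  For negative exponents \<open>X\<^sup>s\<^sup>,\<^sup>b\<close> also contains distributions that are not functions; \<open>Xspace s b\<close>
  consists of the functions in it that act on test functions by an absolutely convergent integral.
\<close>

definition Xspace :: "real \<Rightarrow> real \<Rightarrow> (real \<times> (real ^ 2) \<Rightarrow> complex) set" where
  "Xspace s b = {u. periodic u \<and> (\<exists>v. has_st_fourier u v \<and> weighted_sq s b v < \<infinity>)}"

text \<open>
  Meaningful on \<open>Xspace s b\<close> only.  The transform is unique up to null sets, so the choice does not matter.
\<close>

definition Xnorm :: "real \<Rightarrow> real \<Rightarrow> (real \<times> (real ^ 2) \<Rightarrow> complex) \<Rightarrow> real" where
  "Xnorm s b u = sqrt (enn2real (weighted_sq s b (SOME v. has_st_fourier u v)))"

end

theory Submission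
  imports Defs "HOL-Probability.Characteristic_Functions"
begin

text \<open>
  By duality it suffices to bound \<open>\<integral> u\<^sub>1 \<cdot> cnj u\<^sub>2 \<cdot> u\<^sub>3 \<cdot> cnj g\<close> for \<open>g \<in> X\<^sup>0\<^sup>,\<^sup>b\<close>.  Only the absolute values of the four
  factors matter, so Cauchy-Schwarz reduces this to the bilinear estimate
  \<open>\<parallel>u g\<parallel>\<^bsub>L\<^sup>2\<^esub> \<le> C \<parallel>u\<parallel>\<^bsub>X\<^sup>s\<^sup>,\<^sup>b\<^esub> \<parallel>g\<parallel>\<^bsub>X\<^sup>0\<^sup>,\<^sup>b\<^esub>\<close>, applied to two pairs each containing one factor from \<open>X\<^sup>s\<^sup>,\<^sup>b\<close>.
  By Plancherel and Cauchy-Schwarz in the convolution, the bilinear estimate follows from a uniform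
  bound, for some \<open>\<theta>\<close> with \<open>1 - s < \<theta> < 4b - 1\<close>, on the sum over \<open>l \<in> \<int>\<^sup>2\<close> of
  \<open>\<langle>l\<rangle>\<^sup>-\<^sup>2\<^sup>s \<langle>t + |l|\<^sup>2 + |k - l|\<^sup>2\<rangle>\<^sup>-\<^sup>\<theta>\<close>.  Here \<open>|l|\<^sup>2 + |k - l|\<^sup>2\<close> is constant on circles around \<open>k/2\<close>, and the
  divisor bound shows that lattice points on a circle, weighted by a small negative power of \<open>\<langle>l\<rangle>\<close>,
  have uniformly bounded total mass.
\<close>

section \<open>Lattice points on circles\<close>

text \<open>Of the two pairs, one consists of the factor from \<open>Xspace 0 b\<close> and one
  factor from \<open>Xspace s b\<close>, the other of the remaining factor and the dual function.
  The lower limit 1 - s for theta comes from interpolating the lattice sum between theta = 0, where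
  s > 1 is required, and theta slightly above 1, where the circle bound leaves any s > 0. The upper
  limit 4 b - 1 is what remains after integrating a product of two weights <.>^(-2b). The hypotheses
  on s and b say that this window is not empty. An element of \<open>Xspace s b\<close> is given
  only through its distributional transform, so its Fourier integrals cannot be manipulated
  directly. The estimates are therefore made for finite sums over k of integrable transforms and
  carried over by Fatou, for which almost everywhere convergence of truncated inversions is enough.
  Identifying their limit with u rests on uniqueness of the transform on the line times the torus,
  obtained from Stone-Weierstrass by wrapping time around a circle.\<close>

lemma card_divisors_mult_le:
  fixes m n :: nat
  assumes "m > 0" "n > 0"
  shows "card {d. d dvd m * n} \<le> card {d. d dvd m} * card {d. d dvd n}"
proof -
  have "{d. d dvd m * n} \<subseteq> (\<lambda>(a, b). a * b) ` ({d. d dvd m} \<times> {d. d dvd n})"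
  proof
    fix d assume "d \<in> {d. d dvd m * n}"
    then obtain a b where "d = a * b" "a dvd m" "b dvd n"
      using division_decomp[of d m n] by auto
    then show "d \<in> (\<lambda>(a, b). a * b) ` ({d. d dvd m} \<times> {d. d dvd n})" by auto
  qed
  then have "card {d. d dvd m * n} \<le> card ({d. d dvd m} \<times> {d. d dvd n})"
    using assms by (intro surj_card_le) auto
  then show ?thesis by (simp add: card_cartesian_product)
qed

lemma card_divisors_prime_power_le:
  fixes p :: nat
  assumes "prime p"
  shows "card {d. d dvd p ^ a} \<le> a + 1"
proof -
  have "{d. d dvd p ^ a} = (\<lambda>i. p ^ i) ` {..a}"
    using divides_primepow_nat[OF assms] by auto
  then show ?thesis using card_image_le[of "{..a}" "\<lambda>i. p ^ i"] by simp
qed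

text \<open>The number of divisors is multiplicative over prime powers, and p^a contributes a + 1.
  For large p this is at most (p^a)^e; each of the boundedly many small primes costs at most one
  further factor \<open>K\<close>. The induction strips off one full prime power at a time.\<close>

lemma divisor_bound:
  fixes e :: real
  assumes "e > 0"
  shows "\<exists>C>0. \<forall>n::nat. n > 0 \<longrightarrow> real (card {d. d dvd n}) \<le> C * real n powr e"
proof -
  \<comment> \<open>Primes beyond \<open>L\<close> satisfy p^e >= 2, hence (p^a)^e >= 2^a >= a + 1
    with no constant in front.\<close>
  define L where "L = nat \<lceil>2 powr (1 / e)\<rceil>"
  \<comment> \<open>Chosen so that K (1 + x) = K + x + a for x = a e ln 2, which is at least a + 1;
    then 1 + x <= exp x = (2^a)^e covers every p >= 2.\<close>
  define K where "K = 1 + 1 / (e * ln 2)"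
  have K1: "K \<ge> 1" using assms by (simp add: K_def)
  have K: "real (a + 1) \<le> K * (real p ^ a) powr e" if "p \<ge> 2" for a p :: nat
  proof -
    have "1 + real a * e * ln 2 \<le> exp (real a * e * ln 2)"
      by (metis exp_ge_add_one_self)
    also have "\<dots> = (2 ^ a) powr e"
      by (simp add: powr_def ln_realpow mult_ac)
    also have "\<dots> \<le> (real p ^ a) powr e"
      using that assms by (intro powr_mono2 power_mono) auto
    finally have "K * (1 + real a * e * ln 2) \<le> K * (real p ^ a) powr e"
      using K1 by (intro mult_left_mono) auto
    moreover have "K * (1 + real a * e * ln 2) = K + real a * e * ln 2 + real a"
      using assms by (simp add: K_def field_simps)
    moreover have "real a * e * ln 2 \<ge> 0" using assms by simp
    ultimately show ?thesis using K1 by simp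
  qed
  have L: "real (a + 1) \<le> (real p ^ a) powr e" if "p > L" for a p :: nat
  proof -
    have "2 powr (1 / e) \<le> real p" using that unfolding L_def by linarith
    then have "(2 powr (1 / e)) powr e \<le> real p powr e"
      using assms by (intro powr_mono2) auto
    then have "2 \<le> real p powr e" using assms by (simp add: powr_powr)
    then have "2 ^ a \<le> (real p powr e) ^ a" by (intro power_mono) auto
    also have "\<dots> = (real p ^ a) powr e"
    proof -
      have "p > 0" using that by simp
      then show ?thesis by (simp add: powr_realpow[symmetric] powr_powr mult.commute)
    qed
    finally have "2 ^ a \<le> (real p ^ a) powr e" .
    moreover have "real (a + 1) \<le> 2 ^ a"
      using less_exp[of a] by (metis Suc_eq_plus1 Suc_leI of_nat_le_iff of_nat_numeral of_nat_power)
    ultimately show ?thesis by linarith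
  qed
  define S where "S n = {p::nat. prime p \<and> p dvd n \<and> p \<le> L}" for n
  have finS: "finite (S n)" for n
    by (rule finite_subset[of _ "{..L}"]) (auto simp: S_def)
  \<comment> \<open>The exponent of \<open>K\<close> counts only prime divisors up to
    \<open>L\<close>, so it is at most L + 1 uniformly in n.\<close>
  have main: "real (card {d. d dvd n}) \<le> K ^ card (S n) * real n powr e" if "n > 0" for n
    using that
  proof (induction n rule: less_induct)
    case (less n)
    show ?case
    proof (cases "n = 1")
      case True
      then show ?thesis using K1 by simp
    next
      case False
      then obtain p where p: "prime p" "p dvd n" using prime_factor_nat by blast
      obtain m where m: "n = p ^ multiplicity p n * m" "\<not> p dvd m"
        using multiplicity_decompose'[of n p] less.prems p
        by (metis not_prime_unit less_irrefl)
      define a where "a = multiplicity p n"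
      have a: "n = p ^ a * m" using m by (simp add: a_def)
      have a0: "a > 0" using a m p by (cases a) auto
      have m0: "m > 0" using less.prems a by (cases m) auto
      have p2: "p \<ge> 2" using p by (simp add: prime_ge_2_nat)
      have "p ^ a > 1" using a0 p2 by (intro one_less_power) auto
      then have mn: "m < n" using a m0 by simp
      have IH: "real (card {d. d dvd m}) \<le> K ^ card (S m) * real m powr e"
        using less.IH[OF mn m0] .
      have "card {d. d dvd n} \<le> card {d. d dvd p ^ a} * card {d. d dvd m}"
        unfolding a using p2 m0 by (intro card_divisors_mult_le) auto
      also have "\<dots> \<le> (a + 1) * card {d. d dvd m}"
        using card_divisors_prime_power_le[OF p(1)] by (rule mult_right_mono) simp
      finally have 1: "real (card {d. d dvd n}) \<le> real (a + 1) * real (card {d. d dvd m})"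
        by (metis of_nat_le_iff of_nat_mult)
      have ne: "real n powr e = (real p ^ a) powr e * real m powr e"
        unfolding a by (simp add: powr_mult)
      have sub: "S m \<subseteq> S n" unfolding S_def a by auto
      show ?thesis
      proof (cases "p \<le> L")
        case True
        have "insert p (S m) \<subseteq> S n" using sub True p by (auto simp: S_def)
        moreover have "p \<notin> S m" using m by (auto simp: S_def)
        ultimately have "Suc (card (S m)) \<le> card (S n)"
          by (metis card_insert_disjoint card_mono finS)
        then have KK: "K ^ Suc (card (S m)) \<le> K ^ card (S n)" using K1 by (intro power_increasing)
        have "real (a + 1) * real (card {d. d dvd m})
            \<le> (K * (real p ^ a) powr e) * (K ^ card (S m) * real m powr e)"
          using K[OF p2] IH K1 by (intro mult_mono) auto
        also have "\<dots> = K ^ Suc (card (S m)) * real n powr e" unfolding ne by simp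
        also have "\<dots> \<le> K ^ card (S n) * real n powr e" using KK by (intro mult_right_mono) auto
        finally show ?thesis using 1 by linarith
      next
        case False
        have KK: "K ^ card (S m) \<le> K ^ card (S n)"
          using K1 sub by (intro power_increasing card_mono finS)
        have "real (a + 1) * real (card {d. d dvd m})
            \<le> ((real p ^ a) powr e) * (K ^ card (S m) * real m powr e)"
          using L[of p a] False IH K1 by (intro mult_mono) auto
        also have "\<dots> = K ^ (card (S m)) * real n powr e" unfolding ne by simp
        also have "\<dots> \<le> K ^ card (S n) * real n powr e" using KK by (intro mult_right_mono) auto
        finally show ?thesis using 1 by linarith
      qed
    qed
  qed
  have "real (card {d. d dvd n}) \<le> K ^ (L + 1) * real n powr e" if "n > 0" for n
  proof -
    have "card (S n) \<le> card {..L}" by (intro card_mono) (auto simp: S_def)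
    then have "K ^ card (S n) \<le> K ^ (L + 1)" using K1 by (intro power_increasing) auto
    then have "K ^ card (S n) * real n powr e \<le> K ^ (L + 1) * real n powr e"
      by (intro mult_right_mono) auto
    with main[OF that] show ?thesis by linarith
  qed
  moreover have "K ^ (L + 1) > 0" using K1 by simp
  ultimately show ?thesis by blast
qed

section \<open>Representations of an integer as a sum of two squares\<close>

text \<open>Both vectors are proportional to (x0, y0) modulo g, so their determinant vanishes modulo
  g. Since neither x0 nor y0 has to be invertible modulo g, the determinant is multiplied by each of
  them, and Bezout recombines the two results.\<close>

lemma dvd_cross_of_proportional:
  fixes x y x' y' x0 y0 g :: int
  assumes "g dvd x * y0 - x0 * y" "g dvd x' * y0 - x0 * y'" "coprime x0 y0"
  shows "g dvd x * y' - x' * y"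
proof -
  have "y0 * (x * y' - x' * y) = (x * y0 - x0 * y) * y' - (x' * y0 - x0 * y') * y"
    by (simp add: algebra_simps)
  then have 1: "g dvd y0 * (x * y' - x' * y)" using assms by auto
  have "x0 * (x * y' - x' * y) = (x * y0 - x0 * y) * x' - (x' * y0 - x0 * y') * x"
    by (simp add: algebra_simps)
  then have 2: "g dvd x0 * (x * y' - x' * y)" using assms by auto
  obtain u v where uv: "u * x0 + v * y0 = 1"
    using assms(3) by (metis bezout_int coprime_iff_gcd_eq_1)
  have "x * y' - x' * y = (u * x0 + v * y0) * (x * y' - x' * y)" using uv by simp
  also have "\<dots> = u * (x0 * (x * y' - x' * y)) + v * (y0 * (x * y' - x' * y))"
    by (simp add: algebra_simps)
  finally show ?thesis using 1 2 by (metis dvd_add dvd_mult)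
qed

lemma coprime_sum_squares:
  fixes x y :: int
  assumes "coprime x y"
  shows "coprime (x\<^sup>2 + y\<^sup>2) x"
proof -
  have "coprime (y * y) x" using assms by (simp add: coprime_commute)
  then have "gcd (y * y) x = 1" by (simp add: coprime_iff_gcd_eq_1)
  then have "gcd (x * x + y * y) x = 1" by (metis gcd.commute gcd_add_mult)
  then show ?thesis by (simp add: coprime_iff_gcd_eq_1 power2_eq_square)
qed

text \<open>
  Modulo \<open>m\<close>, the ratios \<open>x/y\<close> and \<open>x\<^sub>0/y\<^sub>0\<close> are both square roots of \<open>-1\<close>: they agree modulo
  \<open>g\<close> and are opposite modulo \<open>m/g\<close>.  So \<open>g\<close> determines \<open>x/y\<close> up to a factor \<open>2\<close> in the modulus.
\<close>

lemma primitive_representations_same_gcd: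
  fixes x y x' y' x0 y0 m :: int
  assumes m: "m > 0" "x\<^sup>2 + y\<^sup>2 = m" "x'\<^sup>2 + y'\<^sup>2 = m" "x0\<^sup>2 + y0\<^sup>2 = m"
    and co: "coprime x y" "coprime x' y'" "coprime x0 y0"
    and g: "gcd (x * y0 - x0 * y) m = g" "gcd (x' * y0 - x0 * y') m = g"
  shows "m dvd 2 * (x * y' - x' * y)"
proof -
  have gm: "g dvd m" using g by auto
  have g0: "g > 0" using g m by (metis gcd_pos_int less_irrefl)
  define h where "h = m div g"
  have h: "m = g * h" using gm by (simp add: h_def)
  \<comment> \<open>The two cross terms have product m (x^2 - x0^2). The first is g times a cofactor
    prime to h, so h = m / g must divide the second.\<close>
  have plus: "h dvd x * y0 + x0 * y"
    if "x\<^sup>2 + y\<^sup>2 = m" "gcd (x * y0 - x0 * y) m = g" for x y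
  proof -
    have "g dvd x * y0 - x0 * y" unfolding that(2)[symmetric] by simp
    then obtain B where B: "x * y0 - x0 * y = g * B" by (rule dvdE)
    have "gcd (g * B) (g * h) = g" using that(2) unfolding B by (simp add: h[symmetric])
    then have "g * gcd B h = g" using g0 by (simp add: gcd_mult_left)
    then have cop: "coprime h B" using g0 by (simp add: coprime_iff_gcd_eq_1 gcd.commute)
    have "(x * y0 - x0 * y) * (x * y0 + x0 * y) = x\<^sup>2 * y0\<^sup>2 - x0\<^sup>2 * y\<^sup>2"
      by (simp add: algebra_simps power2_eq_square)
    also have "\<dots> = x\<^sup>2 * (m - x0\<^sup>2) - x0\<^sup>2 * (m - x\<^sup>2)" 
    proof -
      have "m - x0\<^sup>2 = y0\<^sup>2" "m - x\<^sup>2 = y\<^sup>2" using m(4) that(1) by linarith+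
      then show ?thesis by simp
    qed
    also have "\<dots> = m * (x\<^sup>2 - x0\<^sup>2)" by (simp add: algebra_simps)
    finally have "g * (B * (x * y0 + x0 * y)) = g * (h * (x\<^sup>2 - x0\<^sup>2))"
      using B h by (simp add: mult.assoc)
    then have "B * (x * y0 + x0 * y) = h * (x\<^sup>2 - x0\<^sup>2)" using g0 by simp
    then have "h dvd B * (x * y0 + x0 * y)" by simp
    then show ?thesis using cop by (simp add: coprime_dvd_mult_right_iff)
  qed
  let ?X = "x * y' - x' * y"
  have gX: "g dvd ?X"
  proof (rule dvd_cross_of_proportional[of g x y0 x0 y x' y'])
    show "g dvd x * y0 - x0 * y" unfolding g(1)[symmetric] by simp
    show "g dvd x' * y0 - x0 * y'" unfolding g(2)[symmetric] by simp
    show "coprime x0 y0" by (rule co)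
  qed
  have hX: "h dvd ?X"
  proof (rule dvd_cross_of_proportional[of h x y0 "- x0" y x' y'])
    show "h dvd x * y0 - - x0 * y" using plus[OF m(2) g(1)] by simp
    show "h dvd x' * y0 - - x0 * y'" using plus[OF m(3) g(2)] by simp
    show "coprime (- x0) y0" using co by simp
  qed
  \<comment> \<open>The moduli g and h may share a factor. A common divisor divides both cross
    terms, hence their sum 2 x y0, while x and y0 are prime to m; so it divides 2. This is the
    origin of the 2 in the conclusion.\<close>
  define c where "c = gcd g h"
  have c2: "c dvd 2"
  proof -
    have cm: "c dvd m" using h by (simp add: c_def)
    have "c dvd x * y0 - x0 * y" 
    proof -
      have "c dvd g" by (simp add: c_def)
      moreover have "g dvd x * y0 - x0 * y" unfolding g(1)[symmetric] by simp
      ultimately show ?thesis by (rule dvd_trans)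
    qed
    moreover have "c dvd x * y0 + x0 * y" 
    proof -
      have "c dvd h" by (simp add: c_def)
      then show ?thesis using plus[OF m(2) g(1)] by (rule dvd_trans)
    qed
    ultimately have "c dvd (x * y0 - x0 * y) + (x * y0 + x0 * y)" by (rule dvd_add)
    then have 2: "c dvd 2 * (x * y0)" by simp
    have "coprime m x" unfolding m(2)[symmetric] using co(1)
      by (rule coprime_sum_squares)
    moreover have "coprime m y0"
      using coprime_sum_squares[of y0 x0] co(3) m(4) by (simp add: coprime_commute add.commute)
    ultimately have "coprime m (x * y0)" by simp
    then have "coprime c (x * y0)" using cm by (meson coprime_divisors dvd_refl)
    then show ?thesis using 2 by (simp add: coprime_dvd_mult_left_iff)
  qed
  have "lcm g h dvd ?X" using gX hX by simp
  moreover have "lcm g h * c = m"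
    using lcm_mult_gcd[of g h] h m(1) by (simp add: c_def abs_mult[symmetric] normalize_mult[symmetric])
  ultimately have "m dvd c * ?X" using mult_dvd_mono[of "lcm g h" ?X c c] by (simp add: mult.commute)
  then show ?thesis using mult_dvd_mono[OF c2 dvd_refl[of ?X]] by (rule dvd_trans)
qed

lemma abs_le_square_int: "\<bar>a\<bar> \<le> (a::int)\<^sup>2"
proof (cases "a = 0")
  case False
  then have "\<bar>a\<bar> * 1 \<le> \<bar>a\<bar> * \<bar>a\<bar>" by (intro mult_left_mono) auto
  then show ?thesis by (simp add: power2_eq_square)
qed simp

lemma finite_sum_two_squares: "finite {(x :: int, y :: int). x\<^sup>2 + y\<^sup>2 = n}"
proof (rule finite_subset)
  show "{(x :: int, y :: int). x\<^sup>2 + y\<^sup>2 = n} \<subseteq> {-n..n} \<times> {-n..n}"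
  proof
    fix z assume "z \<in> {(x :: int, y :: int). x\<^sup>2 + y\<^sup>2 = n}"
    then obtain x y where z: "z = (x, y)" "x\<^sup>2 + y\<^sup>2 = n" by auto
    have "x\<^sup>2 \<ge> 0" "y\<^sup>2 \<ge> 0" by simp_all
    then have "\<bar>x\<bar> \<le> n" "\<bar>y\<bar> \<le> n" using abs_le_square_int[of x] abs_le_square_int[of y] z(2) by linarith+
    then show "z \<in> {-n..n} \<times> {-n..n}" using z by auto
  qed
qed simp

text \<open>With (x, y) fixed in the class, any member is determined by its determinant X and its
  inner product with (x, y), the two coordinates of a product of Gaussian integers. X is a multiple
  of m/2 in [-m, m], so 2 X / m takes five values; as the squares of X and of the inner product add
  up to m^2, only the sign of the latter is left. Hence 10 = 5 * 2.\<close>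

lemma card_primitive_same_gcd_le:
  fixes m x0 y0 g :: int
  assumes "m > 0" "x0\<^sup>2 + y0\<^sup>2 = m" "coprime x0 y0"
  shows "card {(x, y). coprime x y \<and> x\<^sup>2 + y\<^sup>2 = m \<and> gcd (x * y0 - x0 * y) m = g} \<le> 10"
    (is "card ?F \<le> 10")
proof (cases "?F = {}")
  case True
  then show ?thesis by (simp only: card.empty)
next
  case False
  then obtain x y where P: "coprime x y" "x\<^sup>2 + y\<^sup>2 = m" "gcd (x * y0 - x0 * y) m = g" by auto
  define f where "f = (\<lambda>(x', y'). (2 * (x * y' - x' * y) div m, x * x' + y * y' \<ge> 0))"
  have id: "(x * y' - x' * y)\<^sup>2 + (x * x' + y * y')\<^sup>2 = (x\<^sup>2 + y\<^sup>2) * (x'\<^sup>2 + y'\<^sup>2)" for x' y'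
    by (simp add: power2_eq_square algebra_simps)
  have dv: "m dvd 2 * (x * y' - x' * y)" if "(x', y') \<in> ?F" for x' y'
    using primitive_representations_same_gcd[OF assms(1) P(2) _ assms(2) P(1) _ assms(3) P(3)] that by auto
  \<comment> \<open>Multiplying back by (x, y) recovers m (x', y') from the two invariants.\<close>
  have rot: "x * (x * x' + y * y') - y * (x * y' - x' * y) = m * x'"
    "y * (x * x' + y * y') + x * (x * y' - x' * y) = m * y'" for x' y'
    unfolding P(2)[symmetric] by (simp_all add: power2_eq_square algebra_simps)
  have "inj_on f ?F"
  proof (rule inj_onI)
    fix P Q assume PQ: "P \<in> ?F" "Q \<in> ?F" "f P = f Q"
    obtain a b c d where PQ': "P = (a, b)" "Q = (c, d)" by fastforce
    have 1: "f (a, b) = f (c, d)" and F: "(a, b) \<in> ?F" "(c, d) \<in> ?F"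
      using PQ unfolding PQ' by blast+
    have "2 * (x * b - a * y) div m * m = 2 * (x * b - a * y)"
      "2 * (x * d - c * y) div m * m = 2 * (x * d - c * y)"
      using dv[OF F(1)] dv[OF F(2)] by simp_all
    moreover have "2 * (x * b - a * y) div m = 2 * (x * d - c * y) div m" using 1 by (simp add: f_def)
    ultimately have "2 * (x * b - a * y) = 2 * (x * d - c * y)" by metis
    then have X: "x * b - a * y = x * d - c * y" by simp
    have "(x * b - a * y)\<^sup>2 + (x * a + y * b)\<^sup>2 = (x * d - c * y)\<^sup>2 + (x * c + y * d)\<^sup>2"
      unfolding id using F by simp
    then have "(x * a + y * b)\<^sup>2 = (x * c + y * d)\<^sup>2" using X by simp
    then have "x * a + y * b = x * c + y * d \<or> x * a + y * b = - (x * c + y * d)"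
      by (rule power2_eq_iff[THEN iffD1])
    moreover have "x * a + y * b \<ge> 0 \<longleftrightarrow> x * c + y * d \<ge> 0" using 1 by (simp add: f_def)
    ultimately have Y: "x * a + y * b = x * c + y * d" by linarith
    have "m * a = x * (x * c + y * d) - y * (x * d - c * y)"
      using rot(1)[where x' = a and y' = b] unfolding X Y by (rule sym)
    also have "\<dots> = m * c" by (rule rot)
    finally have 2: "a = c" using assms(1) by simp
    have "m * b = y * (x * c + y * d) + x * (x * d - c * y)"
      using rot(2)[where x' = a and y' = b] unfolding X Y by (rule sym)
    also have "\<dots> = m * d" by (rule rot)
    finally show "P = Q" using 2 assms(1) PQ' by simp
  qed
  moreover have "f ` ?F \<subseteq> {-2..2} \<times> UNIV"
  proof
    fix z assume "z \<in> f ` ?F"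
    then obtain a b where ab: "(a, b) \<in> ?F" "z = f (a, b)" by auto
    define X where "X = x * b - a * y"
    have "X\<^sup>2 + (x * a + y * b)\<^sup>2 = m\<^sup>2"
      unfolding X_def id using ab(1) P(2) by (simp add: power2_eq_square)
    then have "X\<^sup>2 \<le> m\<^sup>2" using zero_le_power2[of "x * a + y * b"] by linarith
    then have Xm: "\<bar>X\<bar> \<le> m" using assms(1) by (metis abs_le_square_iff abs_of_pos)
    obtain q where q: "2 * X = m * q" using dv[OF ab(1)] unfolding X_def by (rule dvdE)
    have "m * \<bar>q\<bar> = 2 * \<bar>X\<bar>" using q assms(1) by (metis abs_mult abs_numeral abs_of_pos)
    then have "m * \<bar>q\<bar> \<le> m * 2" using Xm by linarith
    then have "\<bar>q\<bar> \<le> 2" using assms(1) by simp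
    moreover have "fst z = q" using ab(2) q assms(1) by (simp add: f_def X_def)
    ultimately show "z \<in> {-2..2} \<times> UNIV" by (cases z) auto
  qed
  moreover have "card ({-2..2::int} \<times> (UNIV :: bool set)) = 10"
    by (simp add: card_cartesian_product card_UNIV_bool)
  moreover have "finite ({-2..2::int} \<times> (UNIV :: bool set))" by simp
  ultimately show ?thesis using card_inj_on_le[of f ?F "{-2..2} \<times> UNIV"] by linarith
qed

text \<open>The gcd of m with the determinant against one fixed primitive representation is a
  divisor of m, and each value is shared by at most ten representations.\<close>

lemma card_primitive_sum_two_squares_le:
  fixes m :: nat
  assumes "m > 0"
  shows "card {(x :: int, y :: int). coprime x y \<and> x\<^sup>2 + y\<^sup>2 = int m} \<le> 10 * card {d. d dvd m}"
    (is "card ?S \<le> _")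
proof (cases "?S = {}")
  case True
  then show ?thesis by (simp only: card.empty)
next
  case False
  then obtain x0 y0 where P: "coprime x0 y0" "x0\<^sup>2 + y0\<^sup>2 = int m" by auto
  define F where "F d = {(x, y). coprime x y \<and> x\<^sup>2 + y\<^sup>2 = int m \<and> gcd (x * y0 - x0 * y) (int m) = int d}" for d
  have "?S \<subseteq> (\<Union>d\<in>{d. d dvd m}. F d)"
  proof clarify
    fix x y :: int assume xy: "coprime x y" "x\<^sup>2 + y\<^sup>2 = int m"
    define d where "d = nat (gcd (x * y0 - x0 * y) (int m))"
    have d: "int d = gcd (x * y0 - x0 * y) (int m)" by (simp add: d_def)
    then have "int d dvd int m" by simp
    then have "d \<in> {d. d dvd m}" by simp
    moreover have "(x, y) \<in> F d" using xy d by (simp add: F_def)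
    ultimately show "(x, y) \<in> (\<Union>d\<in>{d. d dvd m}. F d)" by blast
  qed
  moreover have "finite (\<Union>d\<in>{d. d dvd m}. F d)"
    by (rule finite_subset[OF _ finite_sum_two_squares[of "int m"]]) (auto simp: F_def)
  ultimately have "card ?S \<le> card (\<Union>d\<in>{d. d dvd m}. F d)" by (rule card_mono[rotated])
  also have "\<dots> \<le> (\<Sum>d\<in>{d. d dvd m}. card (F d))"
    using assms by (intro card_UN_le) auto
  also have "\<dots> \<le> (\<Sum>d\<in>{d. d dvd m}. 10)"
    unfolding F_def using assms P by (intro sum_mono card_primitive_same_gcd_le) auto
  finally show ?thesis by simp
qed

text \<open>Dividing by e = gcd(x, y) leaves a primitive representation of m / e^2. The possible e
  are divisors of m, and so are the divisors of m / e^2, whence the square.\<close>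

lemma card_sum_two_squares_le:
  fixes m :: nat
  assumes "m > 0"
  shows "card {(x :: int, y :: int). x\<^sup>2 + y\<^sup>2 = int m} \<le> 10 * (card {d. d dvd m})\<^sup>2"
    (is "card ?S \<le> _")
proof -
  define Pr where "Pr n = {(x :: int, y :: int). coprime x y \<and> x\<^sup>2 + y\<^sup>2 = int n}" for n
  define F where "F e = (\<lambda>(x, y). (int e * x, int e * y)) ` Pr (m div e\<^sup>2)" for e
  define E where "E = {e. e\<^sup>2 dvd m}"
  have ED: "E \<subseteq> {d. d dvd m}" unfolding E_def by (auto simp: power2_eq_square dest: dvd_mult_left)
  have finD: "finite {d. d dvd m}" using assms by simp
  have finE: "finite E" using ED finD by (rule finite_subset)
  have finPr: "finite (Pr n)" for n
    by (rule finite_subset[OF _ finite_sum_two_squares[of "int n"]]) (auto simp: Pr_def)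
  have "?S \<subseteq> (\<Union>e\<in>E. F e)"
  proof clarify
    fix x y :: int assume xy: "x\<^sup>2 + y\<^sup>2 = int m"
    define e where "e = nat (gcd x y)"
    have e: "int e = gcd x y" by (simp add: e_def)
    have nz: "x \<noteq> 0 \<or> y \<noteq> 0" using xy assms by auto
    have e0: "e > 0" using e nz by (metis gcd_eq_0_iff gr0I of_nat_0)
    obtain x' y' where x': "x = int e * x'" "y = int e * y'"
      using e by (metis dvdE gcd_dvd1 gcd_dvd2)
    have "gcd (int e * x') (int e * y') = int e" using e x' by simp
    then have "int e * gcd x' y' = int e" by (simp add: gcd_mult_left)
    then have co: "coprime x' y'" using e0 by (simp add: coprime_iff_gcd_eq_1)
    have m: "int m = int (e\<^sup>2) * (x'\<^sup>2 + y'\<^sup>2)"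
      unfolding xy[symmetric] x' by (simp add: power_mult_distrib algebra_simps)
    then have "int (e\<^sup>2) dvd int m" by simp
    then have eE: "e\<^sup>2 dvd m" by (simp only: int_dvd_int_iff)
    have "int (m div e\<^sup>2) = int m div int (e\<^sup>2)" by (rule zdiv_int)
    also have "\<dots> = x'\<^sup>2 + y'\<^sup>2" unfolding m using e0 by simp
    finally have "(x', y') \<in> Pr (m div e\<^sup>2)" using co by (simp add: Pr_def)
    then have "(x, y) \<in> F e" unfolding F_def x' by force
    then show "(x, y) \<in> (\<Union>e\<in>E. F e)" using eE by (auto simp: E_def)
  qed
  moreover have "finite (\<Union>e\<in>E. F e)" using finE finPr by (auto simp: F_def)
  ultimately have "card ?S \<le> card (\<Union>e\<in>E. F e)" by (rule card_mono[rotated])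
  also have "\<dots> \<le> (\<Sum>e\<in>E. card (F e))" using finE by (rule card_UN_le)
  also have "\<dots> \<le> (\<Sum>e\<in>E. 10 * card {d. d dvd m})"
  proof (rule sum_mono)
    fix e assume "e \<in> E"
    then have e: "e\<^sup>2 dvd m" by (simp add: E_def)
    then have pos: "m div e\<^sup>2 > 0" using assms by (metis dvd_div_eq_0_iff gr0I less_irrefl)
    have "card (F e) \<le> card (Pr (m div e\<^sup>2))" unfolding F_def by (rule card_image_le[OF finPr])
    also have "\<dots> \<le> 10 * card {d. d dvd m div e\<^sup>2}"
      unfolding Pr_def by (rule card_primitive_sum_two_squares_le[OF pos])
    also have "{d. d dvd m div e\<^sup>2} \<subseteq> {d. d dvd m}"
      using e by (metis (mono_tags) Collect_mono dvd_div_mult_self dvd_mult2)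
    then have "10 * card {d. d dvd m div e\<^sup>2} \<le> 10 * card {d. d dvd m}"
      using finD by (simp add: card_mono)
    finally show "card (F e) \<le> 10 * card {d. d dvd m}" .
  qed
  also have "\<dots> = card E * (10 * card {d. d dvd m})" by simp
  also have "\<dots> \<le> card {d. d dvd m} * (10 * card {d. d dvd m})"
    using card_mono[OF finD ED] by (rule mult_right_mono) simp
  finally show ?thesis by (simp add: power2_eq_square)
qed

lemma sum_two_squares_bound:
  fixes e :: real
  assumes "e > 0"
  shows "\<exists>C>0. \<forall>n::nat. n > 0 \<longrightarrow>
    real (card {(x :: int, y :: int). x\<^sup>2 + y\<^sup>2 = int n}) \<le> C * real n powr e"
proof -
  obtain C where C: "C > 0" "\<And>n::nat. n > 0 \<Longrightarrow> real (card {d. d dvd n}) \<le> C * real n powr (e / 2)"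
    using divisor_bound[of "e / 2"] assms by auto
  have "real (card {(x :: int, y :: int). x\<^sup>2 + y\<^sup>2 = int n}) \<le> (10 * C\<^sup>2) * real n powr e"
    if n: "n > 0" for n :: nat
  proof -
    have "real (card {(x :: int, y :: int). x\<^sup>2 + y\<^sup>2 = int n}) \<le> real (10 * (card {d. d dvd n})\<^sup>2)"
      using card_sum_two_squares_le[OF n] by (rule of_nat_mono)
    also have "\<dots> = 10 * (real (card {d. d dvd n}))\<^sup>2" by simp
    also have "\<dots> \<le> 10 * (C * real n powr (e / 2))\<^sup>2"
      using C(2)[OF n] by (intro mult_left_mono power_mono) auto
    also have "\<dots> = 10 * C\<^sup>2 * (real n powr (e / 2) * real n powr (e / 2))"
      by (simp add: power2_eq_square)
    also have "real n powr (e / 2) * real n powr (e / 2) = real n powr e"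
      by (simp add: powr_add[symmetric])
    finally show ?thesis .
  qed
  moreover have "10 * C\<^sup>2 > 0" using C by simp
  ultimately show ?thesis by blast
qed

section \<open>Lattice points on a circle with arbitrary centre\<close>

text \<open>The last two hypotheses place u and w on the circle that has the segment from 0 to e as
  a diameter. A line through 0 meets it in at most one further point, so two distinct chords from 0
  are not parallel.\<close>

lemma chords_independent:
  fixes u1 u2 w1 w2 e1 e2 :: int
  assumes "(u1, u2) \<noteq> (0, 0)" "(w1, w2) \<noteq> (0, 0)" "(u1, u2) \<noteq> (w1, w2)"
    and u: "e1 * u1 + e2 * u2 = u1\<^sup>2 + u2\<^sup>2" and w: "e1 * w1 + e2 * w2 = w1\<^sup>2 + w2\<^sup>2"
  shows "u1 * w2 - u2 * w1 \<noteq> 0"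
proof
  assume D: "u1 * w2 - u2 * w1 = 0"
  define p q where "p = u1\<^sup>2 + u2\<^sup>2" and "q = w1\<^sup>2 + w2\<^sup>2"
  have p: "p > 0" and q: "q > 0"
    using assms(1,2) by (auto simp: p_def q_def sum_power2_gt_zero_iff)
  have "(e1 * u1 + e2 * u2) * w1 - (e1 * w1 + e2 * w2) * u1 = - e2 * (u1 * w2 - u2 * w1)"
    "(e1 * u1 + e2 * u2) * w2 - (e1 * w1 + e2 * w2) * u2 = e1 * (u1 * w2 - u2 * w1)"
    by (simp_all add: algebra_simps)
  then have pw: "p * w1 = q * u1" "p * w2 = q * u2"
    unfolding u w D p_def[symmetric] q_def[symmetric] by simp_all
  have "p * p * q = (p * w1)\<^sup>2 + (p * w2)\<^sup>2"
    by (simp add: q_def power2_eq_square algebra_simps)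
  also have "\<dots> = q * q * p" unfolding pw by (simp add: p_def power2_eq_square algebra_simps)
  finally have "p = q" using p q by simp
  then have "u1 = w1" "u2 = w2" using pw q by simp_all
  then show False using assms(3) by simp
qed

text \<open>Cramer's rule for the perpendicular bisectors: the determinant is a nonzero integer.\<close>

lemma circle_centre_bound:
  fixes a1 a2 b1 b2 x1 x2 k1 k2 N q :: int
  assumes circ: "(2 * a1 - k1)\<^sup>2 + (2 * a2 - k2)\<^sup>2 = N" "(2 * b1 - k1)\<^sup>2 + (2 * b2 - k2)\<^sup>2 = N"
      "(2 * x1 - k1)\<^sup>2 + (2 * x2 - k2)\<^sup>2 = N"
    and ne: "(a1, a2) \<noteq> (b1, b2)" "(a1, a2) \<noteq> (x1, x2)" "(b1, b2) \<noteq> (x1, x2)"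
    and q: "a1\<^sup>2 + a2\<^sup>2 \<le> q" "b1\<^sup>2 + b2\<^sup>2 \<le> q" "x1\<^sup>2 + x2\<^sup>2 \<le> q"
  shows "\<bar>k1\<bar> \<le> 4 * q\<^sup>2" "\<bar>k2\<bar> \<le> 4 * q\<^sup>2"
proof -
  define D where "D = (b1 - a1) * (x2 - a2) - (b2 - a2) * (x1 - a1)"
  define U where "U = b1\<^sup>2 + b2\<^sup>2 - (a1\<^sup>2 + a2\<^sup>2)"
  define W where "W = x1\<^sup>2 + x2\<^sup>2 - (a1\<^sup>2 + a2\<^sup>2)"
  \<comment> \<open>Subtracting two circle equations cancels |k|^2 and leaves a linear equation for
    k.\<close>
  have 1: "k1 * (b1 - a1) + k2 * (b2 - a2) = U"
    using circ unfolding U_def by (simp add: power2_eq_square algebra_simps)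
  have 2: "k1 * (x1 - a1) + k2 * (x2 - a2) = W"
    using circ unfolding W_def by (simp add: power2_eq_square algebra_simps)
  \<comment> \<open>Translated by -a, the circle passes through 0 and its diameter from there is k -
    2 a; b - a and x - a are two chords.\<close>
  have "D \<noteq> 0" unfolding D_def
  proof (rule chords_independent)
    show "(k1 - 2 * a1) * (b1 - a1) + (k2 - 2 * a2) * (b2 - a2) = (b1 - a1)\<^sup>2 + (b2 - a2)\<^sup>2"
      using 1 unfolding U_def by (simp add: power2_eq_square algebra_simps)
    show "(k1 - 2 * a1) * (x1 - a1) + (k2 - 2 * a2) * (x2 - a2) = (x1 - a1)\<^sup>2 + (x2 - a2)\<^sup>2"
      using 2 unfolding W_def by (simp add: power2_eq_square algebra_simps)
  qed (use ne in auto)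
  then have D1: "\<bar>D\<bar> \<ge> 1" by linarith
  have sq: "a1\<^sup>2 \<ge> 0" "a2\<^sup>2 \<ge> 0" "b1\<^sup>2 \<ge> 0" "b2\<^sup>2 \<ge> 0" "x1\<^sup>2 \<ge> 0" "x2\<^sup>2 \<ge> 0" by simp_all
  have q0: "q \<ge> 0" using q sq by linarith
  have UW: "\<bar>U\<bar> \<le> q" "\<bar>W\<bar> \<le> q" using q sq unfolding U_def W_def by linarith+
  have c: "\<bar>a1\<bar> \<le> q" "\<bar>a2\<bar> \<le> q" "\<bar>b1\<bar> \<le> q" "\<bar>b2\<bar> \<le> q" "\<bar>x1\<bar> \<le> q" "\<bar>x2\<bar> \<le> q"
    using q sq abs_le_square_int[of a1] abs_le_square_int[of a2] abs_le_square_int[of b1]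
      abs_le_square_int[of b2] abs_le_square_int[of x1] abs_le_square_int[of x2] by linarith+
  have prod: "\<bar>U * s - W * t\<bar> \<le> 4 * q\<^sup>2" if "\<bar>s\<bar> \<le> 2 * q" "\<bar>t\<bar> \<le> 2 * q" for s t
  proof -
    have "\<bar>U * s\<bar> \<le> q * (2 * q)" "\<bar>W * t\<bar> \<le> q * (2 * q)"
      unfolding abs_mult using UW that q0 by (intro mult_mono; simp)+
    then show ?thesis by (simp add: power2_eq_square)
  qed
  have k1: "k1 * D = U * (x2 - a2) - W * (b2 - a2)"
    unfolding 1[symmetric] 2[symmetric] D_def by (simp add: algebra_simps)
  have k2: "k2 * D = W * (b1 - a1) - U * (x1 - a1)"
    unfolding 1[symmetric] 2[symmetric] D_def by (simp add: algebra_simps)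
  have le: "\<bar>k\<bar> \<le> \<bar>k * D\<bar>" for k
    using mult_left_mono[OF D1, of "\<bar>k\<bar>"] by (simp add: abs_mult)
  show "\<bar>k1\<bar> \<le> 4 * q\<^sup>2"
  proof -
    have "\<bar>x2 - a2\<bar> \<le> 2 * q" "\<bar>b2 - a2\<bar> \<le> 2 * q" using c by linarith+
    then show ?thesis using le[of k1] prod unfolding k1 by (meson order_trans)
  qed
  have "\<bar>k2 * D\<bar> = \<bar>U * (x1 - a1) - W * (b1 - a1)\<bar>" unfolding k2 by (rule abs_minus_commute)
  moreover have "\<bar>x1 - a1\<bar> \<le> 2 * q" "\<bar>b1 - a1\<bar> \<le> 2 * q" using c by linarith+
  ultimately show "\<bar>k2\<bar> \<le> 4 * q\<^sup>2"
    using le[of k2] prod[of "x1 - a1" "b1 - a1"] by (metis order_trans)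
qed

text \<open>
  A third lattice point of modulus at most \<open>|x|\<close> on the circle bounds its radius by a power of \<open>|x|\<close>;
  then the divisor bound limits the number of all lattice points on the circle.
\<close>

lemma sum_circle_bound:
  fixes d :: real
  assumes "d > 0"
  shows "\<exists>C>0. \<forall>S k1 k2 N. finite S \<longrightarrow> (\<forall>(x :: int, y :: int)\<in>S. (2 * x - k1)\<^sup>2 + (2 * y - k2)\<^sup>2 = N) \<longrightarrow>
    (\<Sum>(x, y)\<in>S. (1 + real_of_int (x\<^sup>2 + y\<^sup>2)) powr - d) \<le> C"
proof -
  \<comment> \<open>The squared radius will be at most a constant times the fourth power of
    \<open>w z\<close>, so the count N^e turns into (w z)^d.\<close>
  define e where "e = d / 4"
  have e: "e > 0" using assms by (simp add: e_def)
  obtain C where C: "C > 0" "\<And>n::nat. n > 0 \<Longrightarrow>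
      real (card {(x :: int, y :: int). x\<^sup>2 + y\<^sup>2 = int n}) \<le> C * real n powr e"
    using sum_two_squares_bound[OF e] by blast
  define C' where "C' = C * 72 powr e"
  have C': "C' > 0" using C by (simp add: C'_def)
  define w where "w = (\<lambda>z::int \<times> int. 1 + real_of_int ((fst z)\<^sup>2 + (snd z)\<^sup>2))"
  have w1: "w z \<ge> 1" for z by (simp add: w_def)
  have wle: "w z powr - d \<le> 1" for z
    using powr_mono[of "- d" 0 "w z"] w1[of z] assms by simp
  have "(\<Sum>z\<in>S. w z powr - d) \<le> 2 + C'"
    if fin: "finite S" and circ: "\<And>z. z \<in> S \<Longrightarrow> (2 * fst z - k1)\<^sup>2 + (2 * snd z - k2)\<^sup>2 = N" for S k1 k2 N
  proof (cases "card S \<le> 2")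
    case True
    have "(\<Sum>z\<in>S. w z powr - d) \<le> (\<Sum>z\<in>S. 1)" by (intro sum_mono wle)
    then show ?thesis using True C' by simp
  next
    case False
    then have "S \<noteq> {}" by auto
    \<comment> \<open>The two points \<open>a\<close> and \<open>b\<close> of least modulus
      contribute at most 1 each. Any other point z has these two within its own modulus, so the
      radius bound applies and its term is at most C' / card S; summed over S this gives at most
      C'.\<close>
    then obtain a where a: "a \<in> S" "\<And>z. z \<in> S \<Longrightarrow> w a \<le> w z"
      using fin by (metis arg_min_if_finite(1) arg_min_least)
    have "card (S - {a}) \<noteq> 0" using False a fin by simp
    then have "S - {a} \<noteq> {}" by fastforce
    then obtain b where b: "b \<in> S - {a}" "\<And>z. z \<in> S - {a} \<Longrightarrow> w b \<le> w z"
      using fin by (metis arg_min_if_finite(1) arg_min_least finite_Diff)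
    have cardS: "real (card S) \<le> C' * w z powr d" if z: "z \<in> S - {a, b}" for z
    proof -
      define q where "q = (fst z)\<^sup>2 + (snd z)\<^sup>2"
      have q0: "q \<ge> 0" by (simp add: q_def)
      have qa: "(fst a)\<^sup>2 + (snd a)\<^sup>2 \<le> q" "(fst b)\<^sup>2 + (snd b)\<^sup>2 \<le> q"
        using a(2)[of z] b(2)[of z] z unfolding w_def q_def by (auto simp del: of_int_add of_int_power)
      have qne: "q \<noteq> 0"
      proof
        assume "q = 0"
        then have "(fst a)\<^sup>2 + (snd a)\<^sup>2 = 0" using qa by (metis order_antisym sum_power2_ge_zero)
        moreover have "(fst z)\<^sup>2 + (snd z)\<^sup>2 = 0" using \<open>q = 0\<close> by (simp add: q_def)
        ultimately have "z = a" by (simp add: prod_eq_iff)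
        then show False using z by simp
      qed
      then have q1: "q \<ge> 1" using q0 by linarith
      have "\<bar>k1\<bar> \<le> 4 * q\<^sup>2 \<and> \<bar>k2\<bar> \<le> 4 * q\<^sup>2"
        using circle_centre_bound[of "fst a" k1 "snd a" k2 N "fst b" "snd b" "fst z" "snd z" q]
          circ[of a] circ[of b] circ[of z] a(1) b(1) z qa by (auto simp: q_def prod_eq_iff)
      then have k: "\<bar>k1\<bar> \<le> 4 * q\<^sup>2" "\<bar>k2\<bar> \<le> 4 * q\<^sup>2" by auto
      have zq: "\<bar>fst z\<bar> \<le> q" "\<bar>snd z\<bar> \<le> q"
        using abs_le_square_int[of "fst z"] abs_le_square_int[of "snd z"]
          zero_le_power2[of "fst z"] zero_le_power2[of "snd z"] unfolding q_def by linarith+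
      have qq: "q \<le> q\<^sup>2" using abs_le_square_int[of q] q0 by simp
      have "\<bar>2 * fst z - k1\<bar> \<le> 6 * q\<^sup>2" "\<bar>2 * snd z - k2\<bar> \<le> 6 * q\<^sup>2"
        using k zq qq by linarith+
      then have "(2 * fst z - k1)\<^sup>2 \<le> (6 * q\<^sup>2)\<^sup>2" "(2 * snd z - k2)\<^sup>2 \<le> (6 * q\<^sup>2)\<^sup>2"
        by (metis abs_le_square_iff abs_of_nonneg zero_le_mult_iff zero_le_numeral zero_le_power2)+
      \<comment> \<open>Each coordinate of 2 z - k is at most 2 q + 4 q^2 <= 6 q^2 in modulus, and
        72 = 2 * 36.\<close>
      then have N72: "N \<le> 72 * q ^ 4" using circ[of z] z
        by (auto simp: power_mult_distrib)
      have N0: "N \<ge> 0" using circ[of z] z by (metis DiffD1 sum_power2_ge_zero)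
      have "N \<noteq> 0"
      proof
        assume "N = 0"
        then have "2 * fst z - k1 = 0" "2 * snd z - k2 = 0" "2 * fst a - k1 = 0" "2 * snd a - k2 = 0"
          using circ[of z] circ[of a] z a by auto
        then have "z = a" by (simp add: prod_eq_iff)
        then show False using z by simp
      qed
      then have N1: "nat N > 0" using N0 by simp
      have "inj_on (\<lambda>z. (2 * fst z - k1, 2 * snd z - k2)) S" by (auto simp: inj_on_def prod_eq_iff)
      moreover have "(\<lambda>z. (2 * fst z - k1, 2 * snd z - k2)) ` S \<subseteq> {(x, y). x\<^sup>2 + y\<^sup>2 = int (nat N)}"
        using circ N0 by auto
      ultimately have "card S \<le> card {(x, y). x\<^sup>2 + y\<^sup>2 = int (nat N)}"
        by (rule card_inj_on_le[OF _ _ finite_sum_two_squares])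
      then have "real (card S) \<le> C * real (nat N) powr e" using C(2)[OF N1] by linarith
      also have "real (nat N) powr e \<le> (72 * (w z) ^ 4) powr e"
      proof (rule powr_mono2)
        have "real (nat N) = real_of_int N" using N0 by simp
        also have "\<dots> \<le> real_of_int (72 * q ^ 4)" using N72 by (simp only: of_int_le_iff)
        also have "\<dots> \<le> 72 * (w z) ^ 4" unfolding w_def q_def[symmetric] using q0 by (simp add: power_mono)
        finally show "real (nat N) \<le> 72 * (w z) ^ 4" .
      qed (use e in auto)
      also have "(72 * (w z) ^ 4) powr e = 72 powr e * w z powr d"
      proof -
        have "w z > 0" using w1[of z] by simp
        then have "(w z ^ 4) powr e = (w z powr real 4) powr e" by (subst powr_realpow) auto
        also have "\<dots> = w z powr d" unfolding powr_powr by (simp add: e_def)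
        finally show ?thesis by (simp add: powr_mult)
      qed
      finally show ?thesis using C by (simp add: C'_def mult.assoc)
    qed
    have ab: "{a, b} \<subseteq> S" "a \<noteq> b" using a b by auto
    have "(\<Sum>z\<in>S. w z powr - d) = (\<Sum>z\<in>S - {a, b}. w z powr - d) + (\<Sum>z\<in>{a, b}. w z powr - d)"
      by (rule sum.subset_diff[OF ab(1) fin])
    also have "(\<Sum>z\<in>{a, b}. w z powr - d) \<le> 2"
      using ab(2) wle[of a] wle[of b] by simp
    also have "(\<Sum>z\<in>S - {a, b}. w z powr - d) \<le> (\<Sum>z\<in>S - {a, b}. C' / real (card S))"
    proof (rule sum_mono)
      fix z assume z: "z \<in> S - {a, b}"
      have "w z > 0" using w1[of z] by simp
      then have "w z powr d > 0" by simp
      moreover have "real (card S) > 0" using False by simp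
      ultimately show "w z powr - d \<le> C' / real (card S)"
        using cardS[OF z] by (simp add: powr_minus field_simps)
    qed
    also have "\<dots> \<le> C'"
    proof -
      have "card (S - {a, b}) \<le> card S" using fin by (intro card_mono) auto
      then have "real (card (S - {a, b})) * C' \<le> real (card S) * C'" using C' by (intro mult_right_mono) auto
      then show ?thesis using False C' by (simp add: field_simps)
    qed
    finally show ?thesis by simp
  qed
  note main = this
  have "\<forall>S k1 k2 N. finite S \<longrightarrow> (\<forall>(x :: int, y :: int)\<in>S. (2 * x - k1)\<^sup>2 + (2 * y - k2)\<^sup>2 = N) \<longrightarrow>
    (\<Sum>(x, y)\<in>S. (1 + real_of_int (x\<^sup>2 + y\<^sup>2)) powr - d) \<le> 2 + C'"
  proof (intro allI impI)
    fix S k1 k2 N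
    assume "finite S" and S: "\<forall>(x :: int, y :: int)\<in>S. (2 * x - k1)\<^sup>2 + (2 * y - k2)\<^sup>2 = N"
    then have "(\<Sum>z\<in>S. w z powr - d) \<le> 2 + C'"
      by (intro main[of S k1 k2 N]) auto
    then show "(\<Sum>(x, y)\<in>S. (1 + real_of_int (x\<^sup>2 + y\<^sup>2)) powr - d) \<le> 2 + C'"
      by (simp add: w_def case_prod_unfold)
  qed
  moreover have "2 + C' > 0" using C' by simp
  ultimately show ?thesis by blast
qed

section \<open>Convergent sums over Z and over the plane lattice\<close>

text \<open>For uniformity in t, write t as an integer plus a fraction in [0, 1): dropping the
  fraction costs at most a factor 4 in 1 + m^2, and the integer is absorbed by reindexing.\<close>

lemma sum_int_shift_bound:
  fixes q :: real
  assumes "q > 1 / 2"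
  shows "\<exists>C>0. \<forall>S (t :: real). finite S \<longrightarrow> (\<Sum>n\<in>S. (1 + (t + real_of_int n)\<^sup>2) powr - q) \<le> C"
proof -
  define f where "f = (\<lambda>n::nat. (1 + (real n)\<^sup>2) powr - q)"
  have sf: "summable f"
  proof (rule summable_comparison_test)
    show "summable (\<lambda>n::nat. real n powr (- 2 * q))"
      using assms by (subst summable_real_powr_iff) simp
    have "norm (f n) \<le> real n powr (- 2 * q)" if "n \<ge> 1" for n
    proof -
      have "f n \<le> ((real n)\<^sup>2) powr - q"
        unfolding f_def using assms that by (intro powr_mono2') auto
      also have "\<dots> = (real n powr 2) powr - q" using that by (subst powr_realpow[symmetric]) auto
      also have "\<dots> = real n powr (- 2 * q)" unfolding powr_powr by simp
      finally show ?thesis by (simp add: f_def)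
    qed
    then show "\<exists>N. \<forall>n\<ge>N. norm (f n) \<le> real n powr (- 2 * q)" by blast
  qed
  have f0: "f n \<ge> 0" for n by (simp add: f_def)
  have half: "(\<Sum>n\<in>S. f (nat \<bar>n\<bar>)) \<le> suminf f" if "finite S" "inj_on (\<lambda>n. nat \<bar>n\<bar>) S" for S
  proof -
    have "(\<Sum>n\<in>S. f (nat \<bar>n\<bar>)) = (\<Sum>n\<in>(\<lambda>n. nat \<bar>n\<bar>) ` S. f n)"
      using that by (simp add: sum.reindex)
    also have "\<dots> \<le> suminf f" using that f0 sf by (intro sum_le_suminf) auto
    finally show ?thesis .
  qed
  have full: "(\<Sum>n\<in>S. f (nat \<bar>n\<bar>)) \<le> 2 * suminf f" if "finite S" for S :: "int set"
  proof -
    have "(\<Sum>n\<in>S. f (nat \<bar>n\<bar>)) = (\<Sum>n\<in>{n\<in>S. n \<ge> 0}. f (nat \<bar>n\<bar>)) + (\<Sum>n\<in>{n\<in>S. n < 0}. f (nat \<bar>n\<bar>))"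
      using that by (subst sum.union_disjoint[symmetric]) (auto intro!: sum.cong)
    also have "\<dots> \<le> suminf f + suminf f"
      using that by (intro add_mono half) (auto simp: inj_on_def)
    finally show ?thesis by simp
  qed
  have "(\<Sum>n\<in>S. (1 + (t + real_of_int n)\<^sup>2) powr - q) \<le> 4 powr q * (2 * suminf f)"
    if "finite S" for S and t :: real
  proof -
    define j where "j = \<lfloor>t\<rfloor>"
    have "(\<Sum>n\<in>S. (1 + (t + real_of_int n)\<^sup>2) powr - q) \<le> (\<Sum>n\<in>S. 4 powr q * f (nat \<bar>n + j\<bar>))"
    proof (rule sum_mono)
      fix n
      define r where "r = frac t"
      define m where "m = real_of_int (n + j)"
      have r: "0 \<le> r" "r \<le> 1" using frac_lt_1[of t] by (auto simp: r_def)
      have t: "t + real_of_int n = m + r" by (simp add: m_def r_def j_def frac_def)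
      have r1: "r\<^sup>2 \<le> 1" using r by (simp add: abs_square_le_1)
      \<comment> \<open>Completing the square in m; the remainder is nonnegative because r^2 <=
        1.\<close>
      have "4 * (1 + (m + r)\<^sup>2) - (1 + m\<^sup>2) = ((3 * m + 4 * r)\<^sup>2 + (9 - 4 * r\<^sup>2)) / 3"
        by (simp add: power2_eq_square field_simps)
      also have "\<dots> \<ge> 0"
        by (intro divide_nonneg_nonneg add_nonneg_nonneg) (use r1 in auto)
      finally have "1 + m\<^sup>2 \<le> 4 * (1 + (m + r)\<^sup>2)" by (rule diff_ge_0_iff_ge[THEN iffD1])
      then have le: "(4 * (1 + (m + r)\<^sup>2)) powr - q \<le> (1 + m\<^sup>2) powr - q"
        using assms by (intro powr_mono2') (auto intro: add_pos_nonneg)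
      have "(1 + (m + r)\<^sup>2) powr - q = 4 powr q * (4 * (1 + (m + r)\<^sup>2)) powr - q"
        by (subst powr_mult) (simp add: powr_minus)
      also have "\<dots> \<le> 4 powr q * (1 + m\<^sup>2) powr - q"
        using le by (rule mult_left_mono) simp
      finally have "(1 + (m + r)\<^sup>2) powr - q \<le> 4 powr q * (1 + m\<^sup>2) powr - q" .
      moreover have "f (nat \<bar>n + j\<bar>) = (1 + m\<^sup>2) powr - q"
        by (simp add: f_def m_def)
      ultimately show "(1 + (t + real_of_int n)\<^sup>2) powr - q \<le> 4 powr q * f (nat \<bar>n + j\<bar>)"
        unfolding t by simp
    qed
    also have "\<dots> = 4 powr q * (\<Sum>n\<in>(\<lambda>n. n + j) ` S. f (nat \<bar>n\<bar>))"
      by (subst sum.reindex) (auto simp: inj_on_def sum_distrib_left)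
    also have "\<dots> \<le> 4 powr q * (2 * suminf f)"
      using that by (intro mult_left_mono full) auto
    finally show ?thesis .
  qed
  moreover have "suminf f > 0"
    using sf f0 by (intro suminf_pos2[of _ 0]) (auto simp: f_def)
  then have "4 powr q * (2 * suminf f) > 0" by simp
  ultimately show ?thesis by blast
qed

text \<open>1 + x^2 + y^2 dominates both 1 + x^2 and 1 + y^2, so half of the exponent goes to each
  coordinate; q > 1 gives q/2 > 1/2 in both.\<close>

lemma sum_lattice_bound:
  fixes q :: real
  assumes "q > 1"
  shows "\<exists>C>0. \<forall>S. finite S \<longrightarrow> (\<Sum>(x :: int, y :: int)\<in>S. (1 + real_of_int (x\<^sup>2 + y\<^sup>2)) powr - q) \<le> C"
proof -
  obtain C where C: "C > 0" "\<And>S (t :: real). finite S \<Longrightarrow> (\<Sum>n\<in>S. (1 + (t + real_of_int n)\<^sup>2) powr - (q / 2)) \<le> C"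
    using sum_int_shift_bound[of "q / 2"] assms by auto
  define f where "f = (\<lambda>n::int. (1 + (real_of_int n)\<^sup>2) powr - (q / 2))"
  have f0: "f n \<ge> 0" for n by (simp add: f_def)
  have "(\<Sum>(x :: int, y :: int)\<in>S. (1 + real_of_int (x\<^sup>2 + y\<^sup>2)) powr - q) \<le> C * C" if "finite S" for S
  proof -
    have "(\<Sum>(x :: int, y :: int)\<in>S. (1 + real_of_int (x\<^sup>2 + y\<^sup>2)) powr - q) \<le> (\<Sum>(x, y)\<in>S. f x * f y)"
    proof (rule sum_mono, clarify)
      fix x y :: int
      let ?w = "1 + real_of_int (x\<^sup>2 + y\<^sup>2)"
      have "?w powr - q = ?w powr - (q / 2) * ?w powr - (q / 2)"
        by (simp add: powr_add[symmetric])
      also have "\<dots> \<le> f x * f y"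
        unfolding f_def using assms by (intro mult_mono powr_mono2') (auto intro: add_pos_nonneg)
      finally show "?w powr - q \<le> f x * f y" .
    qed
    also have "\<dots> \<le> (\<Sum>(x, y)\<in>fst ` S \<times> snd ` S. f x * f y)"
      using that f0 by (intro sum_mono2) force+
    also have "\<dots> = (\<Sum>x\<in>fst ` S. f x) * (\<Sum>y\<in>snd ` S. f y)"
      by (simp add: sum_product sum.cartesian_product)
    also have "\<dots> \<le> C * C"
      using C(2)[of "fst ` S" 0] C(2)[of "snd ` S" 0] C(1) that f0
      by (intro mult_mono sum_nonneg) (auto simp: f_def)
    finally show ?thesis .
  qed
  moreover have "C * C > 0" using C by simp
  ultimately show ?thesis by blast
qed

section \<open>Kernel bounds\<close>

lemma japanese_ge_1: "japanese x \<ge> 1"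
  by (simp add: japanese_def)

lemma japanese_pos [simp]: "japanese x > 0"
  using japanese_ge_1[of x] by linarith

lemma japanese_neq_0 [simp]: "japanese x \<noteq> 0"
  using japanese_pos[of x] by linarith

lemma japanese_powr: "japanese x powr p = (1 + (norm x)\<^sup>2) powr (p / 2)"
proof -
  have "0 < 1 + (norm x)\<^sup>2" by (rule add_pos_nonneg) auto
  then show ?thesis by (simp add: japanese_def powr_half_sqrt[symmetric] powr_powr)
qed

lemma borel_measurable_japanese [measurable]: "japanese \<in> borel_measurable borel"
  unfolding japanese_def by measurable

lemma norm_lat_sq: "(norm (lat k))\<^sup>2 = real_of_int ((k $ 1)\<^sup>2 + (k $ 2)\<^sup>2)"
proof -
  have "(norm (lat k))\<^sup>2 = lat k \<bullet> lat k" by (simp add: power2_norm_eq_inner)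
  also have "\<dots> = real_of_int ((k $ 1)\<^sup>2 + (k $ 2)\<^sup>2)"
    by (simp add: inner_vec_def lat_def sum_2 power2_eq_square)
  finally show ?thesis .
qed

lemma powr_geometric_mean_le:
  fixes A B :: real
  assumes "A > 0" "B > 0" "0 \<le> l" "l \<le> 1"
  shows "A powr (1 - l) * B powr l \<le> A + B"
proof -
  have "A powr (1 - l) * B powr l \<le> (A + B) powr (1 - l) * (A + B) powr l"
    using assms by (intro mult_mono powr_mono2) auto
  also have "\<dots> = A + B" using assms by (simp add: powr_add[symmetric])
  finally show ?thesis .
qed

text \<open>Interpolation between two extremes. Without the second weight, <l>^(-2 - d) is summable
  over the lattice. With the second weight to the power -(1 + d), group the l by the value n of
  |l|^2 + |k - l|^2: each group lies on a circle and has bounded mass already with <l>^(-d), and the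
  remaining sum over n converges.\<close>

lemma kernel_sum_bound:
  fixes s \<theta> :: real
  assumes \<theta>: "0 < \<theta>" "\<theta> < 1" and s: "s > 1 - \<theta>"
  shows "\<exists>C>0. \<forall>K t k. finite K \<longrightarrow>
    (\<Sum>l\<in>K. japanese (lat l) powr (- 2 * s) *
       japanese (t + (norm (lat l))\<^sup>2 + (norm (lat (k - l)))\<^sup>2) powr - \<theta>) \<le> C"
proof -
  define d where "d = (s - (1 - \<theta>)) / 2"
  have d: "d > 0" using s by (simp add: d_def)
  have sd: "s = 1 - \<theta> + 2 * d" by (simp add: d_def field_simps)
  \<comment> \<open>The share of the second extreme, fixed by theta = (1 + d) l. The exponent of
    \<open>X\<close> then required is 1 - l + d / 2, which the slack 2 d in \<open>sd\<close>
    covers.\<close>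
  define l where "l = \<theta> / (1 + d)"
  have l: "0 \<le> l" "l \<le> 1" using \<theta> d by (auto simp: l_def field_simps)
  have "\<theta> - l = d * l" using d by (simp add: l_def field_simps)
  moreover have "d * l \<le> d" using d l by (simp add: mult_left_le)
  ultimately have ls: "1 - l + d / 2 \<le> s" using sd d by linarith
  obtain C1 where C1: "C1 > 0" "\<forall>S k1 k2 N. finite S \<longrightarrow>
      (\<forall>(x :: int, y :: int)\<in>S. (2 * x - k1)\<^sup>2 + (2 * y - k2)\<^sup>2 = N) \<longrightarrow>
      (\<Sum>(x, y)\<in>S. (1 + real_of_int (x\<^sup>2 + y\<^sup>2)) powr - (d / 2)) \<le> C1"
    using sum_circle_bound[OF half_gt_zero[OF d]] by blast
  obtain C2 where C2: "C2 > 0" "\<And>S (t :: real). finite S \<Longrightarrow>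
      (\<Sum>n\<in>S. (1 + (t + real_of_int n)\<^sup>2) powr - ((1 + d) / 2)) \<le> C2"
    using sum_int_shift_bound[of "(1 + d) / 2"] d by auto
  obtain C3 where C3: "C3 > 0" "\<And>S. finite S \<Longrightarrow>
      (\<Sum>(x :: int, y :: int)\<in>S. (1 + real_of_int (x\<^sup>2 + y\<^sup>2)) powr - (1 + d / 2)) \<le> C3"
    using sum_lattice_bound[of "1 + d / 2"] d by auto
  have inj: "inj_on (\<lambda>k::int^2. (k $ 1, k $ 2)) K" for K
    by (auto simp: inj_on_def vec_eq_iff forall_2)
  have pair: "(\<Sum>j\<in>K. (1 + (norm (lat j))\<^sup>2) powr p) =
      (\<Sum>(x, y)\<in>(\<lambda>k. (k $ 1, k $ 2)) ` K. (1 + real_of_int (x\<^sup>2 + y\<^sup>2)) powr p)" for K p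
    by (subst sum.reindex[OF inj]) (simp add: norm_lat_sq)
  have "(\<Sum>j\<in>K. japanese (lat j) powr (- 2 * s) *
       japanese (t + (norm (lat j))\<^sup>2 + (norm (lat (k - j)))\<^sup>2) powr - \<theta>) \<le> C3 + C2 * C1"
    if K: "finite K" for K t k
  proof -
    define M where "M j = (j $ 1)\<^sup>2 + (j $ 2)\<^sup>2 + ((k - j) $ 1)\<^sup>2 + ((k - j) $ 2)\<^sup>2" for j :: "int^2"
    have M: "t + (norm (lat j))\<^sup>2 + (norm (lat (k - j)))\<^sup>2 = t + real_of_int (M j)" for j
      by (simp add: norm_lat_sq M_def)
    define X where "X j = 1 + (norm (lat j))\<^sup>2" for j
    define Y where "Y n = 1 + (t + real_of_int n)\<^sup>2" for n
    have X1: "X j \<ge> 1" for j by (simp add: X_def)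
    have Y0: "Y n > 0" for n by (simp add: Y_def add_pos_nonneg)
    \<comment> \<open>The left side is bounded by a weighted geometric mean of the two extremes,
      hence by their sum.\<close>
    have pt: "japanese (lat j) powr (- 2 * s) *
        japanese (t + (norm (lat j))\<^sup>2 + (norm (lat (k - j)))\<^sup>2) powr - \<theta>
        \<le> X j powr - (1 + d / 2) + X j powr - (d / 2) * Y (M j) powr - ((1 + d) / 2)" for j
    proof -
      have X0: "X j > 0" using X1[of j] by linarith
      have "japanese (lat j) powr (- 2 * s) = X j powr - s"
        by (simp add: japanese_powr X_def)
      also have "\<dots> \<le> X j powr (- (1 - l) - d / 2)"
        using X1[of j] ls by (intro powr_mono) auto
      also have "- (1 - l) - d / 2 = - (1 + d / 2) * (1 - l) + - (d / 2) * l"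
        by (simp add: field_simps)
      finally have 1: "japanese (lat j) powr (- 2 * s) \<le>
          (X j powr - (1 + d / 2)) powr (1 - l) * (X j powr - (d / 2)) powr l"
        by (simp only: powr_powr powr_add)
      have "\<theta> = (1 + d) * l" using d by (simp add: l_def)
      then have "- (\<theta> / 2) = - ((1 + d) / 2) * l" by simp
      then have 2: "japanese (t + real_of_int (M j)) powr - \<theta> = (Y (M j) powr - ((1 + d) / 2)) powr l"
        by (simp add: japanese_powr Y_def powr_powr)
      have "japanese (lat j) powr (- 2 * s) * japanese (t + real_of_int (M j)) powr - \<theta>
          \<le> ((X j powr - (1 + d / 2)) powr (1 - l) * (X j powr - (d / 2)) powr l) *
             (Y (M j) powr - ((1 + d) / 2)) powr l"
        unfolding 2 using 1 by (rule mult_right_mono) simp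
      also have "\<dots> = (X j powr - (1 + d / 2)) powr (1 - l) * (X j powr - (d / 2) * Y (M j) powr - ((1 + d) / 2)) powr l"
        by (simp add: powr_mult)
      also have "\<dots> \<le> X j powr - (1 + d / 2) + X j powr - (d / 2) * Y (M j) powr - ((1 + d) / 2)"
        using X0 Y0[of "M j"] l by (intro powr_geometric_mean_le) auto
      finally show ?thesis unfolding M .
    qed
    have S1: "(\<Sum>j\<in>K. X j powr - (1 + d / 2)) \<le> C3"
      unfolding X_def pair using K by (intro C3) auto
    \<comment> \<open>By the parallelogram law, |j|^2 + |k - j|^2 = n means |2 j - k|^2 = 2 n -
      |k|^2.\<close>
    have fib: "(\<Sum>j | j \<in> K \<and> M j = n. X j powr - (d / 2)) \<le> C1" for n
      unfolding X_def pair
    proof (rule C1(2)[THEN spec, THEN spec, THEN spec, THEN spec, THEN mp, THEN mp,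
          of _ "k $ 1" "k $ 2" "2 * n - (k $ 1)\<^sup>2 - (k $ 2)\<^sup>2"])
      show "\<forall>(x, y)\<in>(\<lambda>k. (k $ 1, k $ 2)) ` {j \<in> K. M j = n}.
         (2 * x - k $ 1)\<^sup>2 + (2 * y - k $ 2)\<^sup>2 = 2 * n - (k $ 1)\<^sup>2 - (k $ 2)\<^sup>2"
        by (auto simp: M_def power2_eq_square algebra_simps)
    qed (use K in auto)
    have "(\<Sum>j\<in>K. X j powr - (d / 2) * Y (M j) powr - ((1 + d) / 2)) =
        (\<Sum>n\<in>M ` K. \<Sum>j | j \<in> K \<and> M j = n. X j powr - (d / 2) * Y (M j) powr - ((1 + d) / 2))"
      by (rule sum.image_gen[OF K])
    also have "\<dots> = (\<Sum>n\<in>M ` K. Y n powr - ((1 + d) / 2) * (\<Sum>j | j \<in> K \<and> M j = n. X j powr - (d / 2)))"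
      by (intro sum.cong refl) (simp add: sum_distrib_left mult.commute)
    also have "\<dots> \<le> (\<Sum>n\<in>M ` K. Y n powr - ((1 + d) / 2) * C1)"
      by (intro sum_mono mult_left_mono fib) auto
    also have "\<dots> = (\<Sum>n\<in>M ` K. Y n powr - ((1 + d) / 2)) * C1"
      by (rule sum_distrib_right[symmetric])
    also have "\<dots> \<le> C2 * C1"
      unfolding Y_def using K C1(1) by (intro mult_right_mono C2) auto
    finally have S2: "(\<Sum>j\<in>K. X j powr - (d / 2) * Y (M j) powr - ((1 + d) / 2)) \<le> C2 * C1" .
    have "(\<Sum>j\<in>K. japanese (lat j) powr (- 2 * s) *
       japanese (t + (norm (lat j))\<^sup>2 + (norm (lat (k - j)))\<^sup>2) powr - \<theta>)
       \<le> (\<Sum>j\<in>K. X j powr - (1 + d / 2) + X j powr - (d / 2) * Y (M j) powr - ((1 + d) / 2))"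
      by (rule sum_mono) (rule pt)
    also have "\<dots> \<le> C3 + C2 * C1" unfolding sum.distrib using S1 S2 by (rule add_mono)
    finally show ?thesis .
  qed
  moreover have "C3 + C2 * C1 > 0" using C1(1) C2(1) C3(1) by (simp add: add_pos_pos)
  ultimately show ?thesis by blast
qed

section \<open>Integrals and convolutions of the modulation weight\<close>

lemma nn_integral_japanese_powr:
  fixes p :: real
  assumes "p > 1"
  shows "(\<integral>\<^sup>+x. ennreal (japanese (x :: real) powr - p) \<partial>lborel) < \<infinity>"
proof -
  define h where "h = (\<lambda>y::real. ennreal (y powr - p) * indicator {1..} y)"
  have hm [measurable]: "h \<in> borel_measurable borel" unfolding h_def by measurable
  have "(\<integral>\<^sup>+y. h y \<partial>lborel) = ennreal (- (1 powr (- p + 1)) / (- p + 1))"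
    unfolding h_def using assms
    by (intro nn_integral_has_integral_lebesgue' has_integral_powr_to_inf) auto
  then have h: "(\<integral>\<^sup>+y. h y \<partial>lborel) < \<infinity>" by simp
  have "(\<integral>\<^sup>+x. ennreal (japanese (x :: real) powr - p) \<partial>lborel)
      \<le> (\<integral>\<^sup>+x. ennreal (2 powr (p / 2)) * (h (1 + 1 * x) + h (1 + (- 1) * x)) \<partial>lborel)"
  proof (rule nn_integral_mono)
    fix x :: real
    have "(1 + \<bar>x\<bar>)\<^sup>2 \<le> 2 * (1 + x\<^sup>2)"
      using zero_le_power2[of "1 - \<bar>x\<bar>"] by (simp add: power2_eq_square algebra_simps)
    then have "(2 * (1 + x\<^sup>2)) powr - (p / 2) \<le> ((1 + \<bar>x\<bar>)\<^sup>2) powr - (p / 2)"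
      using assms by (intro powr_mono2') auto
    also have "\<dots> = (1 + \<bar>x\<bar>) powr - p"
    proof -
      have "(1 + \<bar>x\<bar>)\<^sup>2 = (1 + \<bar>x\<bar>) powr 2" by (subst powr_realpow[symmetric]) auto
      then have "((1 + \<bar>x\<bar>)\<^sup>2) powr - (p / 2) = ((1 + \<bar>x\<bar>) powr 2) powr - (p / 2)" by (rule arg_cong)
      also have "\<dots> = (1 + \<bar>x\<bar>) powr - p" by (subst powr_powr) simp
      finally show ?thesis .
    qed
    finally have 1: "(2 * (1 + x\<^sup>2)) powr - (p / 2) \<le> (1 + \<bar>x\<bar>) powr - p" .
    have "japanese x powr - p = 2 powr (p / 2) * (2 * (1 + x\<^sup>2)) powr - (p / 2)"
      unfolding japanese_powr by (subst powr_mult) (simp add: powr_minus)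
    also have "\<dots> \<le> 2 powr (p / 2) * (1 + \<bar>x\<bar>) powr - p"
      using 1 by (rule mult_left_mono) simp
    finally have "ennreal (japanese x powr - p) \<le> ennreal (2 powr (p / 2)) * ennreal ((1 + \<bar>x\<bar>) powr - p)"
      by (simp add: ennreal_mult'[symmetric] ennreal_leI)
    also have "ennreal ((1 + \<bar>x\<bar>) powr - p) \<le> h (1 + 1 * x) + h (1 + (- 1) * x)"
      by (cases "x \<ge> 0") (simp_all add: h_def)
    finally show "ennreal (japanese x powr - p) \<le> ennreal (2 powr (p / 2)) * (h (1 + 1 * x) + h (1 + (- 1) * x))"
      by (simp add: mult_left_mono)
  qed
  also have "\<dots> = ennreal (2 powr (p / 2)) * ((\<integral>\<^sup>+x. h (1 + 1 * x) \<partial>lborel) + (\<integral>\<^sup>+x. h (1 + (- 1) * x) \<partial>lborel))"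
    by (simp add: nn_integral_cmult nn_integral_add)
  also have "\<dots> < \<infinity>"
    using h nn_integral_real_affine[OF hm, of 1 1] nn_integral_real_affine[OF hm, of "-1" 1]
    by (simp add: ennreal_mult_less_top)
  finally show ?thesis .
qed

text \<open>The larger variable satisfies <x + y> <= 2 <y>. An amount theta of its decay is spent on
  <x + y>, and the remaining 2 b - theta is handed over to the smaller variable x.\<close>

lemma japanese_convolution_pointwise:
  fixes x y b \<theta> :: real
  assumes "0 \<le> \<theta>" "\<theta> \<le> 2 * b" "\<bar>x\<bar> \<le> \<bar>y\<bar>"
  shows "japanese x powr (- 2 * b) * japanese y powr (- 2 * b)
    \<le> 2 powr \<theta> * japanese (x + y) powr - \<theta> * japanese x powr - (4 * b - \<theta>)"
proof -
  have xy: "japanese x \<le> japanese y"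
    using assms(3) by (simp add: japanese_def abs_le_square_iff)
  have "(x + y)\<^sup>2 \<le> (2 * y)\<^sup>2"
    using assms(3) by (intro abs_le_square_iff[THEN iffD1]) auto
  then have "1 + (x + y)\<^sup>2 \<le> 2\<^sup>2 * (1 + y\<^sup>2)" by (simp add: power_mult_distrib)
  then have "sqrt (1 + (x + y)\<^sup>2) \<le> sqrt (2\<^sup>2 * (1 + y\<^sup>2))" by (rule real_sqrt_le_mono)
  also have "\<dots> = 2 * sqrt (1 + y\<^sup>2)" unfolding real_sqrt_mult by simp
  finally have s2: "japanese (x + y) \<le> 2 * japanese y"
    unfolding japanese_def real_norm_def power2_abs .
  have "japanese y powr (- 2 * b) = japanese y powr - \<theta> * japanese y powr - (2 * b - \<theta>)"
    by (simp add: powr_add[symmetric])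
  also have "\<dots> \<le> (2 powr \<theta> * japanese (x + y) powr - \<theta>) * japanese x powr - (2 * b - \<theta>)"
  proof (intro mult_mono)
    have "japanese y powr - \<theta> = 2 powr \<theta> * (2 * japanese y) powr - \<theta>"
      by (subst powr_mult) (simp add: powr_minus)
    also have "\<dots> \<le> 2 powr \<theta> * japanese (x + y) powr - \<theta>"
      using s2 assms by (intro mult_left_mono powr_mono2') auto
    finally show "japanese y powr - \<theta> \<le> 2 powr \<theta> * japanese (x + y) powr - \<theta>" .
    show "japanese y powr - (2 * b - \<theta>) \<le> japanese x powr - (2 * b - \<theta>)"
      using xy assms by (intro powr_mono2') auto
  qed auto
  finally have "japanese x powr (- 2 * b) * japanese y powr (- 2 * b) \<le>
      japanese x powr (- 2 * b) * (2 powr \<theta> * japanese (x + y) powr - \<theta> * japanese x powr - (2 * b - \<theta>))"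
    by (intro mult_left_mono) auto
  also have "\<dots> = 2 powr \<theta> * japanese (x + y) powr - \<theta> *
      (japanese x powr (- 2 * b) * japanese x powr - (2 * b - \<theta>))" by simp
  also have "japanese x powr (- 2 * b) * japanese x powr - (2 * b - \<theta>) = japanese x powr - (4 * b - \<theta>)"
    by (simp add: powr_add[symmetric])
  finally show ?thesis .
qed

lemma japanese_convolution:
  fixes b \<theta> :: real
  assumes "0 \<le> \<theta>" "\<theta> \<le> 2 * b" "\<theta> < 4 * b - 1"
  shows "\<exists>C>0. \<forall>A. (\<integral>\<^sup>+x. ennreal (japanese x powr (- 2 * b) * japanese (A - x) powr (- 2 * b)) \<partial>lborel)
    \<le> ennreal (C * japanese (A :: real) powr - \<theta>)"
proof -
  define I where "I = (\<integral>\<^sup>+x. ennreal (japanese (x :: real) powr - (4 * b - \<theta>)) \<partial>lborel)"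
  have I: "I < \<infinity>" unfolding I_def using assms by (intro nn_integral_japanese_powr) auto
  \<comment> \<open>One copy of \<open>I\<close> for each of the regions where x or A - x is the
    smaller variable; the summand 1 makes C > 0 evident.\<close>
  define C where "C = 2 * 2 powr \<theta> * enn2real I + 1"
  have C: "C > 0" by (simp add: C_def add_nonneg_pos)
  have "(\<integral>\<^sup>+x. ennreal (japanese x powr (- 2 * b) * japanese (A - x) powr (- 2 * b)) \<partial>lborel)
    \<le> ennreal (C * japanese A powr - \<theta>)" for A :: real
  proof -
    have "(\<integral>\<^sup>+x. ennreal (japanese x powr (- 2 * b) * japanese (A - x) powr (- 2 * b)) \<partial>lborel)
      \<le> (\<integral>\<^sup>+x. ennreal (2 powr \<theta> * japanese A powr - \<theta>) *
          (ennreal (japanese x powr - (4 * b - \<theta>)) + ennreal (japanese (A + (- 1) * x) powr - (4 * b - \<theta>))) \<partial>lborel)"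
    proof (rule nn_integral_mono)
      fix x :: real
      let ?r = "2 powr \<theta> * japanese A powr - \<theta> *
          (japanese x powr - (4 * b - \<theta>) + japanese (A - x) powr - (4 * b - \<theta>))"
      have "japanese x powr (- 2 * b) * japanese (A - x) powr (- 2 * b) \<le> ?r"
      proof (cases "\<bar>x\<bar> \<le> \<bar>A - x\<bar>")
        case True
        have "japanese x powr (- 2 * b) * japanese (A - x) powr (- 2 * b)
            \<le> 2 powr \<theta> * japanese A powr - \<theta> * japanese x powr - (4 * b - \<theta>)"
          using japanese_convolution_pointwise[OF assms(1,2) True] by simp
        also have "\<dots> \<le> ?r" by (intro mult_left_mono) auto
        finally show ?thesis .
      next
        case False
        then have "\<bar>A - x\<bar> \<le> \<bar>x\<bar>" by simp
        from japanese_convolution_pointwise[OF assms(1,2) this]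
        have "japanese x powr (- 2 * b) * japanese (A - x) powr (- 2 * b)
            \<le> 2 powr \<theta> * japanese A powr - \<theta> * japanese (A - x) powr - (4 * b - \<theta>)"
          by (simp add: mult.commute)
        also have "\<dots> \<le> ?r" by (intro mult_left_mono) auto
        finally show ?thesis .
      qed
      then show "ennreal (japanese x powr (- 2 * b) * japanese (A - x) powr (- 2 * b)) \<le>
          ennreal (2 powr \<theta> * japanese A powr - \<theta>) *
          (ennreal (japanese x powr - (4 * b - \<theta>)) + ennreal (japanese (A + (- 1) * x) powr - (4 * b - \<theta>)))"
        by (simp add: ennreal_plus[symmetric] ennreal_mult[symmetric] ennreal_leI del: ennreal_plus)
    qed
    also have "\<dots> = ennreal (2 powr \<theta> * japanese A powr - \<theta>) *
        (I + (\<integral>\<^sup>+x. ennreal (japanese (A + (- 1) * x) powr - (4 * b - \<theta>)) \<partial>lborel))"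
      unfolding I_def by (subst nn_integral_cmult) (auto simp: nn_integral_add)
    also have "(\<integral>\<^sup>+x. ennreal (japanese (A + (- 1) * x) powr - (4 * b - \<theta>)) \<partial>lborel) = I"
      unfolding I_def by (subst (2) nn_integral_real_affine[of _ "- 1" A]) auto
    also have "ennreal (2 powr \<theta> * japanese A powr - \<theta>) * (I + I) = ennreal (2 * 2 powr \<theta> * enn2real I * japanese A powr - \<theta>)"
    proof -
      have "I = ennreal (enn2real I)" using I by simp
      then have "I + I = ennreal (2 * enn2real I)" by (metis ennreal_plus enn2real_nonneg mult_2)
      then show ?thesis by (simp add: ennreal_mult[symmetric] mult_ac)
    qed
    also have "\<dots> \<le> ennreal (C * japanese A powr - \<theta>)"
      by (intro ennreal_leI mult_right_mono) (auto simp: C_def)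
    finally show ?thesis .
  qed
  then show ?thesis using C by blast
qed

section \<open>Fourier analysis on the product of the line and the torus\<close>

lemma borel_measurable_cis [measurable]: "cis \<in> borel_measurable borel"
  by (intro borel_measurable_continuous_onI continuous_intros)

section \<open>Integration over the torus cell\<close>

definition cell :: "(real ^ 2) set" where
  "cell = {x. \<forall>j. 0 \<le> x $ j \<and> x $ j < 2 * pi}"

lemma cell_borel [measurable]: "cell \<in> sets borel"
  unfolding cell_def by measurable

lemma RT2_domain_borel: "UNIV \<times> cell \<in> sets (borel :: (real \<times> (real ^ 2)) measure)"
  unfolding borel_prod[symmetric] by (intro pair_measureI) auto

lemma RT2_eq: "RT2 = lebesgue_on (UNIV \<times> cell)"
  by (simp add: RT2_def cell_def)

lemma borel_measurable_RT2_fst [measurable]: "fst \<in> borel_measurable RT2"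
  by (intro borel_measurable_RT2 borel_measurable_continuous_onI continuous_intros)

lemma borel_measurable_RT2_snd [measurable]: "snd \<in> borel_measurable RT2"
  by (intro borel_measurable_RT2 borel_measurable_continuous_onI continuous_intros)

lemma nn_integral_RT2:
  fixes f :: "real \<times> (real ^ 2) \<Rightarrow> ennreal"
  assumes [measurable]: "f \<in> borel_measurable borel"
  shows "(\<integral>\<^sup>+p. f p \<partial>RT2) = (\<integral>\<^sup>+t. (\<integral>\<^sup>+x. f (t, x) * indicator cell x \<partial>lborel) \<partial>lborel)"
proof -
  have [measurable]: "f \<in> borel_measurable (borel \<Otimes>\<^sub>M borel)" by (simp add: borel_prod)
  have [measurable]: "UNIV \<times> cell \<in> sets (borel \<Otimes>\<^sub>M borel)"
    using RT2_domain_borel by (simp add: borel_prod)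
  have "(\<integral>\<^sup>+p. f p \<partial>RT2) = (\<integral>\<^sup>+p. f p * indicator (UNIV \<times> cell) p \<partial>lebesgue)"
    unfolding RT2_eq using RT2_domain_borel by (intro nn_integral_restrict_space) auto
  also have "\<dots> = (\<integral>\<^sup>+p. f p * indicator (UNIV \<times> cell) p \<partial>lborel)"
    by (rule nn_integral_completion)
  also have "\<dots> = (\<integral>\<^sup>+p. f p * indicator (UNIV \<times> cell) p \<partial>(lborel \<Otimes>\<^sub>M lborel))"
    by (simp add: lborel_prod)
  also have "\<dots> = (\<integral>\<^sup>+t. (\<integral>\<^sup>+x. f (t, x) * indicator (UNIV \<times> cell) (t, x) \<partial>lborel) \<partial>lborel)"
    by (subst lborel.nn_integral_fst[symmetric]) auto
  finally show ?thesis by (simp add: indicator_times)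
qed

lemma integral_cis_period:
  fixes n :: int
  shows "(LINT t|lborel. indicator {0..<2 * pi} t * cis (of_int n * t)) = (if n = 0 then of_real (2 * pi) else 0)"
proof -
  have "(LINT t|lborel. indicator {0..<2 * pi} t * cis (of_int n * t)) =
      (LINT t|lborel. indicator {0..2 * pi} t *\<^sub>R cis (of_int n * t))"
  proof (rule integral_cong_AE)
    have "AE t in lborel. t \<noteq> 2 * pi" by (rule AE_lborel_singleton)
    then show "AE t in lborel. indicator {0..<2 * pi} t * cis (of_int n * t) =
        indicator {0..2 * pi} t *\<^sub>R cis (of_int n * t)"
      by eventually_elim (auto simp: indicator_def)
  qed auto
  also have "\<dots> = (if n = 0 then of_real (2 * pi) else 0)"
  proof (cases "n = 0")
    case True
    have "(LINT t|lborel. indicator {0..2 * pi} t *\<^sub>R cis (of_int n * t)) =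
        complex_of_real (2 * pi) - complex_of_real 0"
      unfolding True by (rule integral_FTC_atLeastAtMost) (auto intro!: derivative_eq_intros continuous_intros)
    then show ?thesis using True by simp
  next
    case False
    let ?F = "\<lambda>t::real. cis (of_int n * t) / (\<i> * of_int n)"
    have "(LINT t|lborel. indicator {0..2 * pi} t *\<^sub>R cis (of_int n * t)) = ?F (2 * pi) - ?F 0"
    proof (rule integral_FTC_atLeastAtMost)
      fix t :: real
      have "(cis has_vector_derivative \<i> * cis x) (at x)" for x
      proof -
        have "((\<lambda>x. exp (\<i> * complex_of_real x)) has_vector_derivative exp (\<i> * complex_of_real x) * \<i>) (at x)"
          by (rule has_vector_derivative_real_field) (auto intro!: derivative_eq_intros)
        moreover have "cis = (\<lambda>x. exp (\<i> * complex_of_real x))" by (simp add: fun_eq_iff cis_conv_exp)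
        ultimately show ?thesis by (metis mult.commute)
      qed
      then have "((cis \<circ> (\<lambda>t. of_int n * t)) has_vector_derivative of_int n *\<^sub>R (\<i> * cis (of_int n * t))) (at t)"
        by (intro vector_diff_chain_at) (auto intro!: derivative_eq_intros simp: has_real_derivative_iff_has_vector_derivative[symmetric])
      then have "((\<lambda>t. cis (of_int n * t) / (\<i> * of_int n)) has_vector_derivative
          (of_int n *\<^sub>R (\<i> * cis (of_int n * t))) / (\<i> * of_int n)) (at t)"
        by (intro has_vector_derivative_divide) (simp add: o_def)
      then show "(?F has_vector_derivative cis (of_int n * t)) (at t within {0..2 * pi})"
        using False by (auto intro: has_vector_derivative_at_within simp: scaleR_conv_of_real)
    qed (auto intro!: continuous_intros)
    also have "cis (of_int n * (2 * pi)) = 1"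
      using cis_multiple_2pi[of "of_int n"] by (simp add: mult_ac)
    finally show ?thesis using False by simp
  qed
  finally show ?thesis .
qed

lemma emeasure_cell_finite: "emeasure lborel cell < \<infinity>"
proof -
  have "cell \<subseteq> cbox 0 (\<chi> j. 2 * pi)"
    by (auto simp: cell_def mem_box_cart less_imp_le)
  then have "emeasure lborel cell \<le> emeasure lborel (cbox 0 (\<chi> j. 2 * pi) :: (real ^ 2) set)"
    by (intro emeasure_mono) auto
  also have "\<dots> < \<infinity>" by (rule emeasure_lborel_cbox_finite)
  finally show ?thesis .
qed

lemma integrable_cell_bounded:
  fixes f :: "real ^ 2 \<Rightarrow> complex"
  assumes [measurable]: "f \<in> borel_measurable borel" and B: "\<And>x. norm (f x) \<le> B"
  shows "integrable lborel (\<lambda>x. indicator cell x * f x)"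
proof (rule Bochner_Integration.integrable_bound)
  show "integrable lborel (\<lambda>x. B * indicator cell x :: real)"
    using emeasure_cell_finite by (intro integrable_mult_right) (auto intro!: integrable_real_indicator)
  show "AE x in lborel. norm (indicator cell x * f x) \<le> norm (B * indicator cell x :: real)"
  proof (rule AE_I2)
    fix x
    have "norm (f x) \<le> \<bar>B\<bar>" using B[of x] by linarith
    then show "norm (indicator cell x * f x) \<le> norm (B * indicator cell x :: real)"
      by (simp add: norm_mult indicator_def)
  qed
qed auto

lemma integral_cell_character:
  "(LINT x|lborel. indicator cell x * cis (lat k \<bullet> x)) = (if k = 0 then (2 * of_real pi)\<^sup>2 else 0)"
proof -
  interpret product_sigma_finite "\<lambda>b::real^2. lborel :: real measure" ..
  define g where "g b t = indicator {0..<2 * pi} t * cis ((lat k \<bullet> b) * t)" for b :: "real^2" and t :: real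
  have lat_b: "lat k \<bullet> axis i 1 = of_int (k $ i)" for i by (simp add: inner_axis lat_def)
  have gm [measurable]: "g b \<in> borel_measurable borel" for b unfolding g_def by measurable
  have ig: "integrable lborel (g b)" for b
  proof (rule Bochner_Integration.integrable_bound)
    show "integrable lborel (indicator {0..<2 * pi} :: real \<Rightarrow> real)"
      by (intro integrable_real_indicator) auto
  qed (simp_all add: gm, simp add: g_def norm_mult indicator_def)
  have BA: "(Basis :: (real^2) set) = (\<lambda>i. axis i 1) ` UNIV" by (auto simp: Basis_vec_def)
  have inj: "inj_on (\<lambda>i. axis i 1 :: real^2) UNIV" by (auto simp: inj_on_def axis_eq_axis)
  have comp: "(\<Sum>b\<in>Basis. f b *\<^sub>R b) $ i = f (axis i 1)" for f :: "real^2 \<Rightarrow> real" and i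
  proof -
    have "(\<Sum>b\<in>Basis. f b *\<^sub>R b) $ i = (\<Sum>b\<in>Basis. f b *\<^sub>R b) \<bullet> axis i 1" by (simp add: inner_axis)
    also have "\<dots> = f (axis i 1)" by (intro inner_sum_left_Basis) (simp add: axis_in_Basis_iff)
    finally show ?thesis .
  qed
  have gp: "indicator cell (\<Sum>b\<in>Basis. f b *\<^sub>R b) * cis (lat k \<bullet> (\<Sum>b\<in>Basis. f b *\<^sub>R b)) = (\<Prod>b\<in>Basis. g b (f b))" for f
  proof -
    have "lat k \<bullet> (\<Sum>b\<in>Basis. f b *\<^sub>R b) = of_int (k $ 1) * f (axis 1 1) + of_int (k $ 2) * f (axis 2 1)"
      unfolding inner_vec_def comp by (simp add: sum_2 lat_def)
    moreover have "(\<Prod>b\<in>Basis. g b (f b)) = g (axis 1 1) (f (axis 1 1)) * g (axis 2 1) (f (axis 2 1))"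
      unfolding BA prod.reindex[OF inj] by (simp add: UNIV_2)
    moreover have "(\<Sum>b\<in>Basis. f b *\<^sub>R b) \<in> cell \<longleftrightarrow> f (axis 1 1) \<in> {0..<2 * pi} \<and> f (axis 2 1) \<in> {0..<2 * pi}"
      unfolding cell_def mem_Collect_eq comp by (auto simp: forall_2)
    ultimately show ?thesis by (auto simp: g_def lat_b indicator_def cis_mult)
  qed
  \<comment> \<open>\<open>lborel\<close> on a Euclidean space is the image of a product of line
    measures under the coordinate map, which reduces the integral to one period in each
    coordinate.\<close>
  have "(LINT x|lborel. indicator cell x * cis (lat k \<bullet> x)) =
      (LINT f|(\<Pi>\<^sub>M b\<in>Basis. lborel). indicator cell (\<Sum>b\<in>Basis. f b *\<^sub>R b) * cis (lat k \<bullet> (\<Sum>b\<in>Basis. f b *\<^sub>R b)))"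
    by (subst lborel_eq, subst integral_distr) auto
  also have "\<dots> = (\<Prod>b\<in>Basis. integral\<^sup>L lborel (g b))"
    unfolding gp by (rule product_integral_prod) (auto intro: ig)
  also have "\<dots> = integral\<^sup>L lborel (g (axis 1 1)) * integral\<^sup>L lborel (g (axis 2 1))"
    unfolding BA prod.reindex[OF inj] by (simp add: UNIV_2)
  also have "\<dots> = (if k $ 1 = 0 then of_real (2 * pi) else 0) * (if k $ 2 = 0 then of_real (2 * pi) else 0)"
    unfolding g_def lat_b by (simp only: integral_cis_period)
  also have "\<dots> = (if k = 0 then (2 * of_real pi)\<^sup>2 else 0)"
    by (auto simp: vec_eq_iff forall_2 power2_eq_square)
  finally show ?thesis .
qed

lemma lat_diff: "lat (k - l) = lat k - lat l"
  by (simp add: lat_def vec_eq_iff)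

lemma lat_add: "lat (k + l) = lat k + lat l"
  by (simp add: lat_def vec_eq_iff)

lemma lat_minus: "lat (- k) = - lat k"
  by (simp add: lat_def vec_eq_iff)

lemma lat_zero: "lat 0 = 0"
  by (simp add: lat_def vec_eq_iff)

lemma cell_parseval:
  assumes K: "finite K"
  shows "(\<integral>\<^sup>+x. ennreal ((cmod (\<Sum>k\<in>K. a k * cis (lat k \<bullet> x)))\<^sup>2) * indicator cell x \<partial>lborel) =
    ennreal ((2 * pi)\<^sup>2) * (\<Sum>k\<in>K. ennreal ((cmod (a k))\<^sup>2))"
proof -
  define S where "S x = (\<Sum>k\<in>K. a k * cis (lat k \<bullet> x))" for x
  have Sm [measurable]: "S \<in> borel_measurable borel" unfolding S_def by measurable
  have exp: "complex_of_real (indicator cell x * (cmod (S x))\<^sup>2) =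
      (\<Sum>k\<in>K. \<Sum>l\<in>K. a k * cnj (a l) * (indicator cell x * cis (lat (k - l) \<bullet> x)))" for x
  proof -
    have "complex_of_real ((cmod (S x))\<^sup>2) = S x * cnj (S x)" by (rule complex_norm_square)
    also have "\<dots> = (\<Sum>k\<in>K. \<Sum>l\<in>K. (a k * cis (lat k \<bullet> x)) * (cnj (a l) * cis (- (lat l \<bullet> x))))"
      by (simp add: S_def sum_product cis_cnj)
    also have "\<dots> = (\<Sum>k\<in>K. \<Sum>l\<in>K. a k * cnj (a l) * cis (lat (k - l) \<bullet> x))"
    proof (intro sum.cong refl)
      fix k l
      have "cis (lat k \<bullet> x) * cis (- (lat l \<bullet> x)) = cis (lat (k - l) \<bullet> x)"
        by (simp add: cis_mult lat_diff inner_diff_left)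
      then show "a k * cis (lat k \<bullet> x) * (cnj (a l) * cis (- (lat l \<bullet> x))) = a k * cnj (a l) * cis (lat (k - l) \<bullet> x)"
        by (metis mult.assoc mult.left_commute)
    qed
    finally show ?thesis by (simp add: sum_distrib_left indicator_def)
  qed
  have int: "integrable lborel (\<lambda>x. indicator cell x * cis (lat m \<bullet> x))" for m
    by (rule integrable_cell_bounded[of _ 1]) auto
  have intS: "integrable lborel (\<lambda>x. indicator cell x * (cmod (S x))\<^sup>2)"
  proof -
    have "integrable lborel (\<lambda>x. complex_of_real (indicator cell x * (cmod (S x))\<^sup>2))"
      unfolding exp by (intro Bochner_Integration.integrable_sum integrable_mult_right int)
    then show ?thesis by (rule complex_of_real_integrable_eq[THEN iffD1])
  qed
  have "complex_of_real (LINT x|lborel. indicator cell x * (cmod (S x))\<^sup>2) =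
      (LINT x|lborel. complex_of_real (indicator cell x * (cmod (S x))\<^sup>2))"
    by (rule integral_complex_of_real[symmetric])
  also have "\<dots> = (\<Sum>k\<in>K. \<Sum>l\<in>K. a k * cnj (a l) * (LINT x|lborel. indicator cell x * cis (lat (k - l) \<bullet> x)))"
    unfolding exp
    by (subst Bochner_Integration.integral_sum; intro Bochner_Integration.integrable_sum integrable_mult_right int sum.cong refl)
       (subst Bochner_Integration.integral_sum; intro integrable_mult_right int sum.cong refl; simp)
  also have "\<dots> = (\<Sum>k\<in>K. \<Sum>l\<in>K. if l = k then a k * cnj (a k) * (2 * of_real pi)\<^sup>2 else 0)"
    by (intro sum.cong refl) (simp add: integral_cell_character)
  also have "\<dots> = (\<Sum>k\<in>K. a k * cnj (a k) * (2 * of_real pi)\<^sup>2)"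
    using K by (intro sum.cong refl) (simp add: sum.delta)
  also have "\<dots> = complex_of_real ((2 * pi)\<^sup>2 * (\<Sum>k\<in>K. (cmod (a k))\<^sup>2))"
    unfolding complex_norm_square[symmetric] by (simp add: sum_distrib_left mult.commute)
  finally have eq: "(LINT x|lborel. indicator cell x * (cmod (S x))\<^sup>2) = (2 * pi)\<^sup>2 * (\<Sum>k\<in>K. (cmod (a k))\<^sup>2)"
    by (simp only: of_real_eq_iff)
  have "(\<integral>\<^sup>+x. ennreal ((cmod (S x))\<^sup>2) * indicator cell x \<partial>lborel) =
      (\<integral>\<^sup>+x. ennreal (indicator cell x * (cmod (S x))\<^sup>2) \<partial>lborel)"
    by (intro nn_integral_cong) (auto simp: indicator_def)
  also have "\<dots> = ennreal (LINT x|lborel. indicator cell x * (cmod (S x))\<^sup>2)"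
    by (rule nn_integral_eq_integral[OF intS]) auto
  also have "\<dots> = ennreal ((2 * pi)\<^sup>2) * (\<Sum>k\<in>K. ennreal ((cmod (a k))\<^sup>2))"
    unfolding eq by (simp add: ennreal_mult' sum_ennreal sum_nonneg)
  finally show ?thesis unfolding S_def .
qed

section \<open>Plancherel's inequality on the line\<close>

text \<open>Fubini moves the transform from f to h. The measure and the phase are kept general
  because both the time line and \<open>RT2\<close>, with the time coordinate up to sign as phase,
  occur later.\<close>

lemma fourier_multiplication_formula:
  fixes f :: "real \<Rightarrow> complex" and h :: "'a \<Rightarrow> complex" and p :: "'a \<Rightarrow> real"
  assumes M: "sigma_finite_measure M" and f: "integrable lborel f" and h: "integrable M h"
    and p [measurable]: "p \<in> borel_measurable M"
  shows "(LINT m|M. (LINT \<sigma>|lborel. f \<sigma> * cis (\<sigma> * p m)) * h m) =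
    (LINT \<sigma>|lborel. f \<sigma> * (LINT m|M. h m * cis (\<sigma> * p m)))"
proof -
  interpret M: sigma_finite_measure M by (rule M)
  interpret P: pair_sigma_finite lborel M ..
  have [measurable]: "f \<in> borel_measurable borel" "h \<in> borel_measurable M" using f h by auto
  define F where "F = (\<lambda>\<sigma> m. f \<sigma> * (h m * cis (\<sigma> * p m)))"
  have nF: "norm (F \<sigma> m) = norm (f \<sigma>) * norm (h m)" for \<sigma> m by (simp add: F_def norm_mult)
  have I: "integrable (lborel \<Otimes>\<^sub>M M) (case_prod F)"
  proof (rule P.Fubini_integrable)
    show "case_prod F \<in> borel_measurable (lborel \<Otimes>\<^sub>M M)" unfolding F_def by measurable
    show "integrable lborel (\<lambda>\<sigma>. LINT m|M. norm (case (\<sigma>, m) of (x, y) \<Rightarrow> F x y))"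
      using f h by (simp add: nF)
    have "integrable M (F \<sigma>)" for \<sigma>
    proof -
      have "integrable M (\<lambda>m. norm (f \<sigma>) * norm (h m))" using h by simp
      then show ?thesis
        by (rule Bochner_Integration.integrable_bound) (auto simp: nF F_def norm_mult)
    qed
    then show "AE \<sigma> in lborel. integrable M (\<lambda>m. case (\<sigma>, m) of (x, y) \<Rightarrow> F x y)" by simp
  qed
  have "(LINT \<sigma>|lborel. F \<sigma> m) = (LINT \<sigma>|lborel. f \<sigma> * cis (\<sigma> * p m)) * h m" for m
    unfolding F_def by (simp add: mult_ac integral_mult_right_zero[symmetric] del: integral_mult_right_zero integral_mult_left_zero)
  moreover have "(LINT m|M. F \<sigma> m) = f \<sigma> * (LINT m|M. h m * cis (\<sigma> * p m))" for \<sigma>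
    unfolding F_def by (rule integral_mult_right_zero)
  ultimately show ?thesis using P.Fubini_integral[OF I] by simp
qed

text \<open>Holds for every f because the Bochner integral of a nonintegrable function is 0 by
  convention.\<close>

lemma ennreal_norm_integral_le:
  fixes f :: "'a \<Rightarrow> 'b :: {banach, second_countable_topology}"
  shows "ennreal (norm (integral\<^sup>L M f)) \<le> (\<integral>\<^sup>+x. ennreal (norm (f x)) \<partial>M)"
proof (cases "integrable M f")
  case True
  then show ?thesis by (rule integral_norm_bound_ennreal)
next
  case False
  then show ?thesis by (simp add: not_integrable_integral_eq)
qed

text \<open>Fatou's lemma, in the form that carries upper bounds of integrals to the limit.\<close>

lemma nn_integral_le_of_tendsto:
  fixes f :: "nat \<Rightarrow> 'a \<Rightarrow> ennreal"
  assumes f: "\<And>n. f n \<in> borel_measurable M" "\<And>n. (\<integral>\<^sup>+x. f n x \<partial>M) \<le> c"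
    and lim: "AE x in M. (\<lambda>n. f n x) \<longlonglongrightarrow> F x"
  shows "(\<integral>\<^sup>+x. F x \<partial>M) \<le> c"
proof -
  have "(\<integral>\<^sup>+x. F x \<partial>M) = (\<integral>\<^sup>+x. liminf (\<lambda>n. f n x) \<partial>M)"
    by (rule nn_integral_cong_AE, use lim in eventually_elim)
       (simp add: lim_imp_Liminf)
  also have "\<dots> \<le> liminf (\<lambda>n. \<integral>\<^sup>+x. f n x \<partial>M)"
    using f(1) by (rule nn_integral_liminf)
  also have "\<dots> \<le> liminf (\<lambda>n. c)"
    using f(2) by (intro Liminf_mono) auto
  finally show ?thesis by (simp add: Liminf_const)
qed

lemma borel_measurable_cnj [measurable]: "cnj \<in> borel_measurable borel"
  by (intro borel_measurable_continuous_onI continuous_intros)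

lemma integrable_gaussian:
  assumes "d > 0"
  shows "integrable lborel (\<lambda>t. exp (- (d * t)\<^sup>2 / 2))"
    and "(\<integral>\<^sup>+t. ennreal (exp (- (d * t)\<^sup>2 / 2)) \<partial>lborel) = ennreal (sqrt (2 * pi) / d)"
proof -
  have eq: "exp (- (d * t)\<^sup>2 / 2) = (sqrt (2 * pi) / d) * normal_density 0 (1 / d) t" for t
    using assms by (simp add: normal_density_def field_simps real_sqrt_mult power_mult_distrib real_sqrt_divide)
  show i: "integrable lborel (\<lambda>t. exp (- (d * t)\<^sup>2 / 2))"
    unfolding eq by (intro integrable_mult_right integrable_normal_density) (use assms in simp)
  have "integral\<^sup>L lborel (normal_density 0 (1 / d)) = 1"
    by (rule integral_normal_density) (use assms in simp)
  then have "(LINT t|lborel. exp (- (d * t)\<^sup>2 / 2)) = sqrt (2 * pi) / d"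
    unfolding eq by (simp only: integral_mult_right_zero mult_1_right)
  then show "(\<integral>\<^sup>+t. ennreal (exp (- (d * t)\<^sup>2 / 2)) \<partial>lborel) = ennreal (sqrt (2 * pi) / d)"
    by (subst nn_integral_eq_integral[OF i]) auto
qed

lemma integrable_gaussian_complex:
  assumes "d > 0" and [measurable]: "p \<in> borel_measurable borel"
  shows "integrable lborel (\<lambda>t. complex_of_real (exp (- (d * t)\<^sup>2 / 2)) * cis (p t))"
  by (rule Bochner_Integration.integrable_bound[OF integrable_gaussian(1)[OF assms(1)]])
     (auto simp: norm_mult)

text \<open>The characteristic function of the standard normal law, rescaled by d.\<close>

lemma fourier_gaussian:
  assumes d: "d > 0"
  shows "(LINT t|lborel. complex_of_real (exp (- (d * t)\<^sup>2 / 2)) * cis (a * t)) =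
    of_real (sqrt (2 * pi) / d * exp (- (a / d)\<^sup>2 / 2))"
proof -
  have "char std_normal_distribution (a / d) = (LINT x|lborel. std_normal_density x *\<^sub>R iexp (a / d * x))"
    unfolding char_def by (subst integral_density) auto
  also have "\<dots> = (LINT x|lborel. of_real (1 / sqrt (2 * pi)) * (complex_of_real (exp (- x\<^sup>2 / 2)) * cis (a / d * x)))"
    by (intro Bochner_Integration.integral_cong refl)
       (simp add: std_normal_density_def cis_conv_exp scaleR_conv_of_real)
  also have "\<dots> = of_real (1 / sqrt (2 * pi)) * (LINT x|lborel. complex_of_real (exp (- x\<^sup>2 / 2)) * cis (a / d * x))"
    by (rule integral_mult_right_zero)
  finally have 1: "(LINT x|lborel. complex_of_real (exp (- x\<^sup>2 / 2)) * cis (a / d * x)) =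
      of_real (sqrt (2 * pi)) * of_real (exp (- (a / d)\<^sup>2 / 2))"
    unfolding char_std_normal_distribution by (simp add: field_simps)
  have "(LINT x|lborel. complex_of_real (exp (- x\<^sup>2 / 2)) * cis (a / d * x)) =
      \<bar>d\<bar> *\<^sub>R (LINT t|lborel. complex_of_real (exp (- (0 + d * t)\<^sup>2 / 2)) * cis (a / d * (0 + d * t)))"
    using d by (intro lborel_integral_real_affine) auto
  also have "\<dots> = d *\<^sub>R (LINT t|lborel. complex_of_real (exp (- (d * t)\<^sup>2 / 2)) * cis (a * t))"
    using d by simp
  finally show ?thesis using 1 d by (simp add: scaleR_conv_of_real field_simps)
qed

text \<open>
  The Gaussian factor makes the triple integral absolutely convergent; its transform has integral
  \<open>2\<pi>\<close>, whatever the width, so the Schur test is sharp.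
\<close>

lemma plancherel_gaussian_le:
  fixes V :: "real \<Rightarrow> complex"
  assumes V: "integrable lborel V" and d: "d > 0"
  shows "(\<integral>\<^sup>+t. ennreal ((cmod (LINT \<sigma>|lborel. V \<sigma> * cis (\<sigma> * t)))\<^sup>2 * exp (- (d * t)\<^sup>2 / 2)) \<partial>lborel)
    \<le> ennreal (2 * pi) * (\<integral>\<^sup>+\<sigma>. ennreal ((cmod (V \<sigma>))\<^sup>2) \<partial>lborel)"
proof -
  have Vm [measurable]: "V \<in> borel_measurable borel" using V by auto
  define g where "g t = (LINT \<sigma>|lborel. V \<sigma> * cis (\<sigma> * t))" for t
  define w where "w t = exp (- (d * t)\<^sup>2 / 2)" for t
  define W where "W a = sqrt (2 * pi) / d * exp (- (a / d)\<^sup>2 / 2)" for a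
  have W0: "W a \<ge> 0" for a using d by (simp add: W_def)
  have [measurable]: "w \<in> borel_measurable borel" "W \<in> borel_measurable borel"
    unfolding w_def W_def by measurable
  have gm [measurable]: "g \<in> borel_measurable borel" unfolding g_def by measurable
  define B where "B = (LINT \<sigma>|lborel. cmod (V \<sigma>))"
  have gB: "cmod (g t) \<le> B" for t
  proof -
    have "cmod (g t) \<le> (LINT \<sigma>|lborel. norm (V \<sigma> * cis (\<sigma> * t)))"
      unfolding g_def by (rule integral_norm_bound)
    then show ?thesis by (simp add: B_def norm_mult)
  qed
  have B0: "B \<ge> 0" by (simp add: B_def)
  have hI: "integrable lborel (\<lambda>t. cnj (g t) * complex_of_real (w t))"
  proof (rule Bochner_Integration.integrable_bound)
    show "integrable lborel (\<lambda>t. B * w t)"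
      unfolding w_def using integrable_gaussian(1)[OF d] by simp
    show "AE t in lborel. norm (cnj (g t) * complex_of_real (w t)) \<le> norm (B * w t)"
      using gB B0 by (auto simp: norm_mult w_def intro!: mult_right_mono)
  qed auto
  have wI: "integrable lborel (\<lambda>t. complex_of_real (w t) * cis (\<sigma> * t))" for \<sigma>
    unfolding w_def by (rule integrable_gaussian_complex[OF d]) auto
  \<comment> \<open>Integrating out t first turns the Gaussian weight into its transform
    \<open>W\<close>, evaluated at the difference of the frequencies.\<close>
  have inner: "(LINT t|lborel. cnj (g t) * complex_of_real (w t) * cis (\<sigma> * t)) =
      (LINT \<tau>|lborel. cnj (V \<tau>) * of_real (W (\<sigma> - \<tau>)))" for \<sigma>
  proof -
    have cg: "cnj (g t) = (LINT \<tau>|lborel. cnj (V \<tau>) * cis (\<tau> * (- t)))" for t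
      unfolding g_def complex_cnj_mult[symmetric] by (simp add: Bochner_Integration.integral_cnj[symmetric] cis_cnj)
    have cV: "integrable lborel (\<lambda>\<tau>. cnj (V \<tau>))" using V by (simp add: integrable_cnj)
    have "(LINT t|lborel. cnj (g t) * complex_of_real (w t) * cis (\<sigma> * t)) =
        (LINT t|lborel. (LINT \<tau>|lborel. cnj (V \<tau>) * cis (\<tau> * (- t))) * (complex_of_real (w t) * cis (\<sigma> * t)))"
      unfolding cg by (simp add: mult.assoc)
    also have "\<dots> = (LINT \<tau>|lborel. cnj (V \<tau>) * (LINT t|lborel. complex_of_real (w t) * cis (\<sigma> * t) * cis (\<tau> * (- t))))"
      by (rule fourier_multiplication_formula[OF lborel.sigma_finite_measure_axioms cV wI]) auto
    also have "\<dots> = (LINT \<tau>|lborel. cnj (V \<tau>) * of_real (W (\<sigma> - \<tau>)))"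
    proof (intro Bochner_Integration.integral_cong refl arg_cong2[where f="(*)"])
      fix \<tau>
      have eq: "complex_of_real (w t) * cis (\<sigma> * t) * cis (\<tau> * (- t)) = complex_of_real (w t) * cis ((\<sigma> - \<tau>) * t)" for t
        by (simp add: mult.assoc cis_mult algebra_simps)
      show "(LINT t|lborel. complex_of_real (w t) * cis (\<sigma> * t) * cis (\<tau> * (- t))) = of_real (W (\<sigma> - \<tau>))"
        unfolding eq unfolding w_def W_def by (rule fourier_gaussian[OF d])
    qed
    finally show ?thesis .
  qed
  have I: "integrable lborel (\<lambda>t. (cmod (g t))\<^sup>2 * w t)"
  proof (rule Bochner_Integration.integrable_bound)
    show "integrable lborel (\<lambda>t. B\<^sup>2 * w t)"
      unfolding w_def using integrable_gaussian(1)[OF d] by simp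
    show "AE t in lborel. norm ((cmod (g t))\<^sup>2 * w t) \<le> norm (B\<^sup>2 * w t)"
      using gB by (auto simp: norm_mult w_def intro!: mult_right_mono power_mono)
  qed auto
  have "complex_of_real (LINT t|lborel. (cmod (g t))\<^sup>2 * w t) = (LINT t|lborel. complex_of_real ((cmod (g t))\<^sup>2 * w t))"
    by (rule integral_complex_of_real[symmetric])
  also have "\<dots> = (LINT t|lborel. g t * (cnj (g t) * complex_of_real (w t)))"
    by (intro Bochner_Integration.integral_cong refl) (simp only: of_real_mult complex_norm_square mult.assoc)
  also have "\<dots> = (LINT \<sigma>|lborel. V \<sigma> * (LINT t|lborel. cnj (g t) * complex_of_real (w t) * cis (\<sigma> * t)))"
    unfolding g_def[of "_"]
    using lborel.sigma_finite_measure_axioms V hI[unfolded g_def]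
    by (rule fourier_multiplication_formula) auto
  finally have eq: "complex_of_real (LINT t|lborel. (cmod (g t))\<^sup>2 * w t) =
      (LINT \<sigma>|lborel. V \<sigma> * (LINT \<tau>|lborel. cnj (V \<tau>) * of_real (W (\<sigma> - \<tau>))))"
    by (simp only: inner)
  \<comment> \<open>The Schur test bounds |V(sigma) V(tau)| by half the sum of the squares. Each
    half, with \<open>W\<close> integrated out in the other variable, contributes 2 pi H, and 2 H is
    the squared norm of \<open>V\<close>.\<close>
  define H where "H = (\<integral>\<^sup>+\<sigma>. ennreal ((cmod (V \<sigma>))\<^sup>2 / 2) \<partial>lborel)"
  have HH: "H + H = (\<integral>\<^sup>+\<sigma>. ennreal ((cmod (V \<sigma>))\<^sup>2) \<partial>lborel)"
    unfolding H_def by (subst nn_integral_add[symmetric]) (auto simp: ennreal_plus[symmetric] simp del: ennreal_plus)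
  have WI: "(\<integral>\<^sup>+a. ennreal (W a) \<partial>lborel) = ennreal (2 * pi)"
  proof -
    have "(\<integral>\<^sup>+a. ennreal (W a) \<partial>lborel) = ennreal (sqrt (2 * pi) / d) * (\<integral>\<^sup>+a. ennreal (exp (- ((1 / d) * a)\<^sup>2 / 2)) \<partial>lborel)"
    proof -
      have eqW: "ennreal (W a) = ennreal (sqrt (2 * pi) / d) * ennreal (exp (- ((1 / d) * a)\<^sup>2 / 2))" for a
        unfolding W_def using d by (subst ennreal_mult'[symmetric]) auto
      show ?thesis unfolding eqW by (rule nn_integral_cmult) measurable
    qed
    also have "\<dots> = ennreal (sqrt (2 * pi) / d) * ennreal (sqrt (2 * pi) / (1 / d))"
      using d by (subst integrable_gaussian(2)) auto
    also have "\<dots> = ennreal (2 * pi)" using d by (simp add: ennreal_mult'[symmetric])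
    finally show ?thesis .
  qed
  have WS: "(\<integral>\<^sup>+\<tau>. ennreal (W (\<sigma> - \<tau>)) \<partial>lborel) = ennreal (2 * pi)" for \<sigma>
    unfolding WI[symmetric] by (subst (2) nn_integral_real_affine[of _ "- 1" \<sigma>]) auto
  have WS': "(\<integral>\<^sup>+\<sigma>. ennreal (W (\<sigma> - \<tau>)) \<partial>lborel) = ennreal (2 * pi)" for \<tau>
    unfolding WI[symmetric] by (subst (2) nn_integral_real_affine[of _ 1 "- \<tau>"]) auto
  have "(\<integral>\<^sup>+t. ennreal ((cmod (g t))\<^sup>2 * w t) \<partial>lborel) = ennreal (LINT t|lborel. (cmod (g t))\<^sup>2 * w t)"
    by (rule nn_integral_eq_integral[OF I]) (auto simp: w_def)
  also have "\<dots> \<le> ennreal (norm (complex_of_real (LINT t|lborel. (cmod (g t))\<^sup>2 * w t)))"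
    by (intro ennreal_leI) simp
  also have "\<dots> \<le> (\<integral>\<^sup>+\<sigma>. ennreal (norm (V \<sigma> * (LINT \<tau>|lborel. cnj (V \<tau>) * of_real (W (\<sigma> - \<tau>))))) \<partial>lborel)"
    unfolding eq by (rule ennreal_norm_integral_le)
  also have "\<dots> \<le> (\<integral>\<^sup>+\<sigma>. (\<integral>\<^sup>+\<tau>. ennreal ((cmod (V \<sigma>))\<^sup>2 / 2) * ennreal (W (\<sigma> - \<tau>)) +
      ennreal ((cmod (V \<tau>))\<^sup>2 / 2) * ennreal (W (\<sigma> - \<tau>)) \<partial>lborel) \<partial>lborel)"
  proof (intro nn_integral_mono)
    fix \<sigma>
    have "ennreal (norm (V \<sigma> * (LINT \<tau>|lborel. cnj (V \<tau>) * of_real (W (\<sigma> - \<tau>))))) \<le>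
        ennreal (cmod (V \<sigma>)) * (\<integral>\<^sup>+\<tau>. ennreal (norm (cnj (V \<tau>) * of_real (W (\<sigma> - \<tau>)))) \<partial>lborel)"
      unfolding norm_mult[of "V \<sigma>"] by (subst ennreal_mult') (auto intro!: mult_left_mono ennreal_norm_integral_le)
    also have "\<dots> = (\<integral>\<^sup>+\<tau>. ennreal (cmod (V \<sigma>)) * ennreal (norm (cnj (V \<tau>) * of_real (W (\<sigma> - \<tau>)))) \<partial>lborel)"
      by (rule nn_integral_cmult[symmetric]) simp
    also have "\<dots> \<le> (\<integral>\<^sup>+\<tau>. ennreal ((cmod (V \<sigma>))\<^sup>2 / 2) * ennreal (W (\<sigma> - \<tau>)) +
      ennreal ((cmod (V \<tau>))\<^sup>2 / 2) * ennreal (W (\<sigma> - \<tau>)) \<partial>lborel)"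
    proof (intro nn_integral_mono)
      fix \<tau>
      have "cmod (V \<sigma>) * cmod (V \<tau>) \<le> (cmod (V \<sigma>))\<^sup>2 / 2 + (cmod (V \<tau>))\<^sup>2 / 2"
        using sum_squares_bound[of "cmod (V \<sigma>)" "cmod (V \<tau>)"] by (simp add: field_simps)
      then have "cmod (V \<sigma>) * cmod (V \<tau>) * W (\<sigma> - \<tau>) \<le> ((cmod (V \<sigma>))\<^sup>2 / 2 + (cmod (V \<tau>))\<^sup>2 / 2) * W (\<sigma> - \<tau>)"
        using W0 by (rule mult_right_mono)
      then show "ennreal (cmod (V \<sigma>)) * ennreal (norm (cnj (V \<tau>) * of_real (W (\<sigma> - \<tau>)))) \<le>
          ennreal ((cmod (V \<sigma>))\<^sup>2 / 2) * ennreal (W (\<sigma> - \<tau>)) + ennreal ((cmod (V \<tau>))\<^sup>2 / 2) * ennreal (W (\<sigma> - \<tau>))"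
        using W0[of "\<sigma> - \<tau>"]
        by (simp add: norm_mult ennreal_mult'[symmetric] ennreal_mult''[symmetric] ennreal_plus[symmetric] algebra_simps ennreal_leI del: ennreal_plus)
    qed
    finally show "ennreal (norm (V \<sigma> * (LINT \<tau>|lborel. cnj (V \<tau>) * of_real (W (\<sigma> - \<tau>))))) \<le>
        (\<integral>\<^sup>+\<tau>. ennreal ((cmod (V \<sigma>))\<^sup>2 / 2) * ennreal (W (\<sigma> - \<tau>)) +
      ennreal ((cmod (V \<tau>))\<^sup>2 / 2) * ennreal (W (\<sigma> - \<tau>)) \<partial>lborel)" .
  qed
  also have "\<dots> = (\<integral>\<^sup>+\<sigma>. ennreal ((cmod (V \<sigma>))\<^sup>2 / 2) * ennreal (2 * pi) +
      (\<integral>\<^sup>+\<tau>. ennreal ((cmod (V \<tau>))\<^sup>2 / 2) * ennreal (W (\<sigma> - \<tau>)) \<partial>lborel) \<partial>lborel)"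
    by (intro nn_integral_cong) (simp add: nn_integral_add nn_integral_cmult WS)
  also have "\<dots> = H * ennreal (2 * pi) + (\<integral>\<^sup>+\<sigma>. (\<integral>\<^sup>+\<tau>. ennreal ((cmod (V \<tau>))\<^sup>2 / 2) * ennreal (W (\<sigma> - \<tau>)) \<partial>lborel) \<partial>lborel)"
    unfolding H_def by (subst nn_integral_add) (auto simp: nn_integral_multc)
  also have "(\<integral>\<^sup>+\<sigma>. (\<integral>\<^sup>+\<tau>. ennreal ((cmod (V \<tau>))\<^sup>2 / 2) * ennreal (W (\<sigma> - \<tau>)) \<partial>lborel) \<partial>lborel) =
      (\<integral>\<^sup>+\<tau>. (\<integral>\<^sup>+\<sigma>. ennreal ((cmod (V \<tau>))\<^sup>2 / 2) * ennreal (W (\<sigma> - \<tau>)) \<partial>lborel) \<partial>lborel)"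
    by (rule lborel_pair.Fubini') auto
  also have "\<dots> = H * ennreal (2 * pi)"
    unfolding H_def by (simp add: nn_integral_cmult WS' nn_integral_multc)
  also have "H * ennreal (2 * pi) + H * ennreal (2 * pi) = ennreal (2 * pi) * (\<integral>\<^sup>+\<sigma>. ennreal ((cmod (V \<sigma>))\<^sup>2) \<partial>lborel)"
    unfolding HH[symmetric] by (simp only: distrib_right mult.commute)
  finally show ?thesis unfolding g_def w_def .
qed

text \<open>As the parameter 1 / (n + 1) tends to 0, the Gaussian weight tends to 1 while the bound
  does not depend on it.\<close>

lemma plancherel_le:
  fixes V :: "real \<Rightarrow> complex"
  assumes V: "integrable lborel V"
  shows "(\<integral>\<^sup>+t. ennreal ((cmod (LINT \<sigma>|lborel. V \<sigma> * cis (\<sigma> * t)))\<^sup>2) \<partial>lborel)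
    \<le> ennreal (2 * pi) * (\<integral>\<^sup>+\<sigma>. ennreal ((cmod (V \<sigma>))\<^sup>2) \<partial>lborel)"
proof (rule nn_integral_le_of_tendsto)
  have [measurable]: "V \<in> borel_measurable borel" using V by auto
  let ?f = "\<lambda>n t. ennreal ((cmod (LINT \<sigma>|lborel. V \<sigma> * cis (\<sigma> * t)))\<^sup>2 * exp (- (1 / real (Suc n) * t)\<^sup>2 / 2))"
  show "?f n \<in> borel_measurable lborel" for n by measurable
  show "(\<integral>\<^sup>+t. ?f n t \<partial>lborel) \<le> ennreal (2 * pi) * (\<integral>\<^sup>+\<sigma>. ennreal ((cmod (V \<sigma>))\<^sup>2) \<partial>lborel)" for n
    using V by (rule plancherel_gaussian_le) simp
  have L: "(\<lambda>n. 1 / real (Suc n)) \<longlonglongrightarrow> 0" by (rule LIMSEQ_Suc) (rule lim_1_over_n)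
  have "(\<lambda>n. c * exp (- (1 / real (Suc n) * t)\<^sup>2 / 2)) \<longlonglongrightarrow> c * exp (- (0 * t)\<^sup>2 / 2)" for c t :: real
    by (intro tendsto_intros L) auto
  then have "(\<lambda>n. ?f n t) \<longlonglongrightarrow> ennreal ((cmod (LINT \<sigma>|lborel. V \<sigma> * cis (\<sigma> * t)))\<^sup>2)" for t
    by (intro tendsto_ennrealI) simp
  then show "AE t in lborel. (\<lambda>n. ?f n t) \<longlonglongrightarrow> ennreal ((cmod (LINT \<sigma>|lborel. V \<sigma> * cis (\<sigma> * t)))\<^sup>2)" by simp
qed

text \<open>The inverse transform of a finite family of integrable functions, without the factor \<open>(2\<pi>)\<^sup>-\<^sup>3\<close>.\<close>

definition synth :: "(int ^ 2) set \<Rightarrow> (real \<Rightarrow> int ^ 2 \<Rightarrow> complex) \<Rightarrow> real \<times> (real ^ 2) \<Rightarrow> complex" where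
  "synth K V p = (\<Sum>k\<in>K. (LINT \<sigma>|lborel. V \<sigma> k * cis (\<sigma> * fst p)) * cis (lat k \<bullet> snd p))"

text \<open>Integrability in sigma and finitely many modes make \<open>synth K V\<close> a genuine
  bounded function. Vanishing off \<open>K\<close> lets \<open>K\<close> be replaced by any larger
  finite set.\<close>

definition nice :: "(int ^ 2) set \<Rightarrow> (real \<Rightarrow> int ^ 2 \<Rightarrow> complex) \<Rightarrow> bool" where
  "nice K V \<longleftrightarrow> finite K \<and> (\<forall>k. integrable lborel (\<lambda>\<sigma>. V \<sigma> k)) \<and> (\<forall>k. k \<notin> K \<longrightarrow> (\<forall>\<sigma>. V \<sigma> k = 0))"

lemma niceD:
  assumes "nice K V"
  shows "finite K" "integrable lborel (\<lambda>\<sigma>. V \<sigma> k)" "k \<notin> K \<Longrightarrow> V \<sigma> k = 0"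
  using assms by (auto simp: nice_def)

lemma nice_measurable: "nice K V \<Longrightarrow> (\<lambda>\<sigma>. V \<sigma> k) \<in> borel_measurable borel"
  using niceD(2)[of K V k] by auto

lemma borel_measurable_synth:
  assumes "nice K V"
  shows "synth K V \<in> borel_measurable borel"
proof -
  have [measurable]: "(\<lambda>\<sigma>. V \<sigma> k) \<in> borel_measurable borel" for k by (rule nice_measurable[OF assms])
  show ?thesis unfolding synth_def borel_prod[symmetric] by measurable
qed

text \<open>Parseval on the torus at each fixed t, then Plancherel in t for each mode: the constant
  is (2 pi)^2 times 2 pi.\<close>

lemma synth_bessel:
  assumes V: "nice K V"
  shows "(\<integral>\<^sup>+p. ennreal ((cmod (synth K V p))\<^sup>2) \<partial>RT2)
    \<le> ennreal ((2 * pi) ^ 3) * (\<Sum>k\<in>K. \<integral>\<^sup>+\<sigma>. ennreal ((cmod (V \<sigma> k))\<^sup>2) \<partial>lborel)"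
proof -
  note [measurable] = nice_measurable[OF V] borel_measurable_synth[OF V]
  define g where "g k t = (LINT \<sigma>|lborel. V \<sigma> k * cis (\<sigma> * t))" for k t
  have [measurable]: "g k \<in> borel_measurable borel" for k unfolding g_def by measurable
  have "(\<integral>\<^sup>+p. ennreal ((cmod (synth K V p))\<^sup>2) \<partial>RT2) =
      (\<integral>\<^sup>+t. (\<integral>\<^sup>+x. ennreal ((cmod (\<Sum>k\<in>K. g k t * cis (lat k \<bullet> x)))\<^sup>2) * indicator cell x \<partial>lborel) \<partial>lborel)"
    by (subst nn_integral_RT2) (measurable, simp add: synth_def g_def)
  also have "\<dots> = (\<integral>\<^sup>+t. ennreal ((2 * pi)\<^sup>2) * (\<Sum>k\<in>K. ennreal ((cmod (g k t))\<^sup>2)) \<partial>lborel)"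
    by (simp only: cell_parseval[OF niceD(1)[OF V]])
  also have "\<dots> = ennreal ((2 * pi)\<^sup>2) * (\<Sum>k\<in>K. \<integral>\<^sup>+t. ennreal ((cmod (g k t))\<^sup>2) \<partial>lborel)"
    by (subst nn_integral_cmult, measurable) (subst nn_integral_sum, measurable)
  also have "\<dots> \<le> ennreal ((2 * pi)\<^sup>2) * (\<Sum>k\<in>K. ennreal (2 * pi) * (\<integral>\<^sup>+\<sigma>. ennreal ((cmod (V \<sigma> k))\<^sup>2) \<partial>lborel))"
    unfolding g_def by (intro mult_left_mono sum_mono plancherel_le niceD(2)[OF V]) auto
  also have "\<dots> = ennreal ((2 * pi) ^ 3) * (\<Sum>k\<in>K. \<integral>\<^sup>+\<sigma>. ennreal ((cmod (V \<sigma> k))\<^sup>2) \<partial>lborel)"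
  proof -
    have "ennreal ((2 * pi)\<^sup>2) * ennreal (2 * pi) = ennreal ((2 * pi) ^ 3)"
      by (subst ennreal_mult'[symmetric]) (auto simp: power2_eq_square power3_eq_cube)
    then show ?thesis by (simp add: sum_distrib_left[symmetric] mult.assoc[symmetric])
  qed
  finally show ?thesis .
qed

section \<open>The bilinear estimate on the Fourier side\<close>

lemma convolution_fourier:
  fixes f g :: "real \<Rightarrow> complex"
  assumes f: "integrable lborel f" and g: "integrable lborel g"
  shows "integrable lborel (\<lambda>\<sigma>. LINT \<tau>|lborel. f \<tau> * g (\<sigma> - \<tau>))"
    and "(LINT \<sigma>|lborel. (LINT \<tau>|lborel. f \<tau> * g (\<sigma> - \<tau>)) * cis (\<sigma> * t)) =
      (LINT \<sigma>|lborel. f \<sigma> * cis (\<sigma> * t)) * (LINT \<sigma>|lborel. g \<sigma> * cis (\<sigma> * t))"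
proof -
  have [measurable]: "f \<in> borel_measurable borel" "g \<in> borel_measurable borel" using f g by auto
  have shift: "(LINT \<sigma>|lborel. h (\<sigma> - \<tau>)) = (LINT \<sigma>|lborel. h \<sigma>)" for h :: "real \<Rightarrow> 'c::{banach, second_countable_topology}" and \<tau>
    by (subst (2) lborel_integral_real_affine[of 1 _ "- \<tau>"]) auto
  have gs: "integrable lborel (\<lambda>\<sigma>. g (\<sigma> - \<tau>))" for \<tau>
    using lborel_integrable_real_affine[OF g, of 1 "- \<tau>"] by simp
  have I: "integrable (lborel \<Otimes>\<^sub>M lborel) (\<lambda>(\<tau>, \<sigma>). f \<tau> * g (\<sigma> - \<tau>) * cis (\<sigma> * t))" for t
  proof (rule lborel_pair.Fubini_integrable)
    have "(LINT \<sigma>|lborel. norm (f \<tau> * g (\<sigma> - \<tau>) * cis (\<sigma> * t))) = norm (f \<tau>) * (LINT \<sigma>|lborel. norm (g \<sigma>))" for \<tau>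
      using shift[of "\<lambda>\<sigma>. norm (g \<sigma>)" \<tau>] by (simp add: norm_mult)
    then show "integrable lborel (\<lambda>\<tau>. LINT \<sigma>|lborel. norm (case (\<tau>, \<sigma>) of (\<tau>, \<sigma>) \<Rightarrow> f \<tau> * g (\<sigma> - \<tau>) * cis (\<sigma> * t)))"
      using f by simp
    have "integrable lborel (\<lambda>\<sigma>. f \<tau> * g (\<sigma> - \<tau>) * cis (\<sigma> * t))" for \<tau>
      by (rule Bochner_Integration.integrable_bound[OF integrable_mult_right[OF gs, of "f \<tau>" \<tau>]])
         (auto simp: norm_mult)
    then show "AE \<tau> in lborel. integrable lborel (\<lambda>\<sigma>. case (\<tau>, \<sigma>) of (\<tau>, \<sigma>) \<Rightarrow> f \<tau> * g (\<sigma> - \<tau>) * cis (\<sigma> * t))"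
      by simp
  qed measurable
  show "integrable lborel (\<lambda>\<sigma>. LINT \<tau>|lborel. f \<tau> * g (\<sigma> - \<tau>))"
    using lborel_pair.integrable_snd[OF I[of 0]] by simp
  have "(LINT \<sigma>|lborel. (LINT \<tau>|lborel. f \<tau> * g (\<sigma> - \<tau>)) * cis (\<sigma> * t)) =
      (LINT \<sigma>|lborel. (LINT \<tau>|lborel. f \<tau> * g (\<sigma> - \<tau>) * cis (\<sigma> * t)))"
    by simp
  also have "\<dots> = (LINT \<tau>|lborel. (LINT \<sigma>|lborel. f \<tau> * g (\<sigma> - \<tau>) * cis (\<sigma> * t)))"
    using lborel_pair.Fubini_integral[OF I[of t]] .
  also have "\<dots> = (LINT \<tau>|lborel. (f \<tau> * cis (\<tau> * t)) * (LINT \<sigma>|lborel. g \<sigma> * cis (\<sigma> * t)))"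
  proof (intro Bochner_Integration.integral_cong refl)
    fix \<tau>
    have "f \<tau> * g (\<sigma> - \<tau>) * cis (\<sigma> * t) = (f \<tau> * cis (\<tau> * t)) * (g (\<sigma> - \<tau>) * cis ((\<sigma> - \<tau>) * t))" for \<sigma>
    proof -
      have "cis (\<sigma> * t) = cis (\<tau> * t) * cis ((\<sigma> - \<tau>) * t)" by (simp add: cis_mult algebra_simps)
      then show ?thesis by simp
    qed
    then have "(LINT \<sigma>|lborel. f \<tau> * g (\<sigma> - \<tau>) * cis (\<sigma> * t)) =
        (f \<tau> * cis (\<tau> * t)) * (LINT \<sigma>|lborel. g (\<sigma> - \<tau>) * cis ((\<sigma> - \<tau>) * t))"
      by (simp only: integral_mult_right_zero)
    then show "(LINT \<sigma>|lborel. f \<tau> * g (\<sigma> - \<tau>) * cis (\<sigma> * t)) =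
        (f \<tau> * cis (\<tau> * t)) * (LINT \<sigma>|lborel. g \<sigma> * cis (\<sigma> * t))"
      using shift[of "\<lambda>\<sigma>. g \<sigma> * cis (\<sigma> * t)" \<tau>] by simp
  qed
  finally show "(LINT \<sigma>|lborel. (LINT \<tau>|lborel. f \<tau> * g (\<sigma> - \<tau>)) * cis (\<sigma> * t)) =
      (LINT \<sigma>|lborel. f \<sigma> * cis (\<sigma> * t)) * (LINT \<sigma>|lborel. g \<sigma> * cis (\<sigma> * t))"
    by simp
qed

text \<open>Convolution on R x Z^2; when \<open>V\<close> vanishes off \<open>K\<close>, the sum
  over \<open>K\<close> is the full lattice sum.\<close>

definition st_conv :: "(int ^ 2) set \<Rightarrow> (real \<Rightarrow> int ^ 2 \<Rightarrow> complex) \<Rightarrow> (real \<Rightarrow> int ^ 2 \<Rightarrow> complex) \<Rightarrow> real \<Rightarrow> int ^ 2 \<Rightarrow> complex" where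
  "st_conv K V W \<sigma> k = (\<Sum>l\<in>K. LINT \<tau>|lborel. V \<tau> l * W (\<sigma> - \<tau>) (k - l))"

lemma nice_st_conv:
  assumes V: "nice K V" and W: "nice L W"
  shows "nice ((\<lambda>(k, l). k + l) ` (K \<times> L)) (st_conv K V W)"
  unfolding nice_def
proof (intro conjI allI impI)
  show "finite ((\<lambda>(k, l). k + l) ` (K \<times> L))" using niceD(1)[OF V] niceD(1)[OF W] by auto
  show "integrable lborel (\<lambda>\<sigma>. st_conv K V W \<sigma> k)" for k
    unfolding st_conv_def
    by (intro Bochner_Integration.integrable_sum convolution_fourier(1) niceD(2)[OF V] niceD(2)[OF W])
  fix k \<sigma> assume k: "k \<notin> (\<lambda>(k, l). k + l) ` (K \<times> L)"
  have "k - l \<notin> L" if "l \<in> K" for l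
  proof
    assume "k - l \<in> L"
    then have "(\<lambda>(k, l). k + l) (l, k - l) \<in> (\<lambda>(k, l). k + l) ` (K \<times> L)" using that by (intro imageI) auto
    then show False using k by simp
  qed
  then show "st_conv K V W \<sigma> k = 0"
    unfolding st_conv_def using niceD(3)[OF W] by simp
qed

text \<open>Inverse transforms turn convolutions into products; no power of 2 pi appears because
  \<open>synth\<close> omits the normalisation.\<close>

lemma synth_mult:
  assumes V: "nice K V" and W: "nice L W"
  shows "synth K V p * synth L W p = synth ((\<lambda>(k, l). k + l) ` (K \<times> L)) (st_conv K V W) p"
proof -
  define M where "M = (\<lambda>(k, l). k + l) ` (K \<times> L)"
  define a where "a k = (LINT \<sigma>|lborel. V \<sigma> k * cis (\<sigma> * fst p))" for k
  define b where "b k = (LINT \<sigma>|lborel. W \<sigma> k * cis (\<sigma> * fst p))" for k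
  have finM: "finite M" using niceD(1)[OF V] niceD(1)[OF W] by (auto simp: M_def)
  have b0: "b k = 0" if "k \<notin> L" for k using niceD(3)[OF W that] by (simp add: b_def)
  have cv: "(LINT \<sigma>|lborel. st_conv K V W \<sigma> k * cis (\<sigma> * fst p)) = (\<Sum>l\<in>K. a l * b (k - l))" for k
  proof -
    have int: "integrable lborel (\<lambda>\<sigma>. (LINT \<tau>|lborel. V \<tau> l * W (\<sigma> - \<tau>) (k - l)) * cis (\<sigma> * fst p))" for l
    proof (rule Bochner_Integration.integrable_bound)
      show i: "integrable lborel (\<lambda>\<sigma>. LINT \<tau>|lborel. V \<tau> l * W (\<sigma> - \<tau>) (k - l))"
        by (intro convolution_fourier(1) niceD(2)[OF V] niceD(2)[OF W])
      show "(\<lambda>\<sigma>. (LINT \<tau>|lborel. V \<tau> l * W (\<sigma> - \<tau>) (k - l)) * cis (\<sigma> * fst p)) \<in> borel_measurable lborel"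
        using borel_measurable_integrable[OF i] by measurable
    qed (simp add: norm_mult)
    have "(LINT \<sigma>|lborel. st_conv K V W \<sigma> k * cis (\<sigma> * fst p)) =
        (\<Sum>l\<in>K. LINT \<sigma>|lborel. (LINT \<tau>|lborel. V \<tau> l * W (\<sigma> - \<tau>) (k - l)) * cis (\<sigma> * fst p))"
      unfolding st_conv_def sum_distrib_right by (rule Bochner_Integration.integral_sum) (rule int)
    also have "\<dots> = (\<Sum>l\<in>K. a l * b (k - l))"
      unfolding a_def b_def by (intro sum.cong refl convolution_fourier(2) niceD(2)[OF V] niceD(2)[OF W])
    finally show ?thesis .
  qed
  \<comment> \<open>For l in \<open>K\<close> the translate of \<open>L\<close> by l lies inside the
    sumset \<open>M\<close>, and the coefficients vanish on the rest of \<open>M\<close>.\<close>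
  have inner: "(\<Sum>k\<in>M. b (k - l) * cis (lat k \<bullet> snd p)) = (\<Sum>k\<in>L. b k * cis (lat (k + l) \<bullet> snd p))" if "l \<in> K" for l
  proof -
    have "(\<Sum>k\<in>M. b (k - l) * cis (lat k \<bullet> snd p)) = (\<Sum>k\<in>(\<lambda>k. k + l) ` L. b (k - l) * cis (lat k \<bullet> snd p))"
    proof (rule sum.mono_neutral_right[OF finM])
      show "(\<lambda>k. k + l) ` L \<subseteq> M"
      proof
        fix k assume "k \<in> (\<lambda>k. k + l) ` L"
        then obtain j where "j \<in> L" "k = (\<lambda>(k, l). k + l) (l, j)" by (auto simp: add.commute)
        then show "k \<in> M" unfolding M_def using that by blast
      qed
      show "\<forall>k\<in>M - (\<lambda>k. k + l) ` L. b (k - l) * cis (lat k \<bullet> snd p) = 0"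
      proof
        fix k assume "k \<in> M - (\<lambda>k. k + l) ` L"
        moreover have "k = (k - l) + l" by simp
        ultimately have "k - l \<notin> L" by blast
        then show "b (k - l) * cis (lat k \<bullet> snd p) = 0" by (simp add: b0)
      qed
    qed
    also have "\<dots> = (\<Sum>k\<in>L. b k * cis (lat (k + l) \<bullet> snd p))"
      by (subst sum.reindex) (auto simp: inj_on_def)
    finally show ?thesis .
  qed
  have "synth M (st_conv K V W) p = (\<Sum>k\<in>M. (\<Sum>l\<in>K. a l * b (k - l)) * cis (lat k \<bullet> snd p))"
    unfolding synth_def cv ..
  also have "\<dots> = (\<Sum>k\<in>M. \<Sum>l\<in>K. a l * (b (k - l) * cis (lat k \<bullet> snd p)))"
    by (simp add: sum_distrib_right mult.assoc)
  also have "\<dots> = (\<Sum>l\<in>K. \<Sum>k\<in>M. a l * (b (k - l) * cis (lat k \<bullet> snd p)))"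
    by (rule sum.swap)
  also have "\<dots> = (\<Sum>l\<in>K. a l * (\<Sum>k\<in>M. b (k - l) * cis (lat k \<bullet> snd p)))"
    by (simp only: sum_distrib_left)
  also have "\<dots> = (\<Sum>l\<in>K. a l * (\<Sum>k\<in>L. b k * cis (lat (k + l) \<bullet> snd p)))"
    by (intro sum.cong refl) (simp only: inner)
  also have "\<dots> = (\<Sum>l\<in>K. \<Sum>k\<in>L. (a l * cis (lat l \<bullet> snd p)) * (b k * cis (lat k \<bullet> snd p)))"
  proof -
    have "cis (lat (k + l) \<bullet> snd p) = cis (lat l \<bullet> snd p) * cis (lat k \<bullet> snd p)" for k l
      by (simp add: cis_mult lat_add inner_add_left add.commute)
    then show ?thesis by (simp add: sum_distrib_left mult_ac)
  qed
  also have "\<dots> = synth K V p * synth L W p"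
    unfolding synth_def a_def[symmetric] b_def[symmetric] by (rule sum_product[symmetric])
  finally show ?thesis by (simp add: M_def)
qed

definition mode_sq :: "real \<Rightarrow> real \<Rightarrow> (real \<Rightarrow> int ^ 2 \<Rightarrow> complex) \<Rightarrow> int ^ 2 \<Rightarrow> ennreal" where
  "mode_sq s b V k = (\<integral>\<^sup>+ \<sigma>. ennreal ((japanese (lat k) powr s *
          japanese (\<sigma> + (norm (lat k))\<^sup>2) powr b * cmod (V \<sigma> k))\<^sup>2) \<partial>lborel)"

lemma weighted_sq_eq: "weighted_sq s b V = (\<integral>\<^sup>+ k. mode_sq s b V k \<partial>count_space UNIV)"
  by (simp add: weighted_sq_def mode_sq_def)

lemma sum_mode_sq_le:
  assumes "finite S"
  shows "(\<Sum>k\<in>S. mode_sq s b V k) \<le> weighted_sq s b V"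
proof -
  have "(\<Sum>k\<in>S. mode_sq s b V k) = (\<integral>\<^sup>+ k. mode_sq s b V k \<partial>count_space S)"
    using assms by (simp add: nn_integral_count_space_finite)
  also have "\<dots> = (\<integral>\<^sup>+ k. mode_sq s b V k * indicator S k \<partial>count_space UNIV)"
    by (rule nn_integral_count_space_indicator) simp
  also have "\<dots> \<le> weighted_sq s b V"
    unfolding weighted_sq_eq by (intro nn_integral_mono) (auto simp: indicator_def)
  finally show ?thesis .
qed

text \<open>In tau the two modulation weights form a convolution with total shift sigma + |l|^2 + |k
  - l|^2, so integrating them leaves the lattice sum of \<open>kernel_sum_bound\<close>.\<close>

lemma interaction_kernel_bound:
  fixes s b :: real
  assumes s: "s > 0" and b: "b > 1 / 4" "b > 1 / 2 - s / 4"
  shows "\<exists>C>0. \<forall>K \<sigma> k. finite K \<longrightarrow>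
    (\<Sum>l\<in>K. \<integral>\<^sup>+\<tau>. ennreal (japanese (lat l) powr (- 2 * s) *
      (japanese (\<tau> + (norm (lat l))\<^sup>2) powr (- 2 * b) * japanese (\<sigma> - \<tau> + (norm (lat (k - l)))\<^sup>2) powr (- 2 * b))) \<partial>lborel)
    \<le> ennreal C"
proof -
  \<comment> \<open>1 - s < 4 b - 1 is the condition b > 1/2 - s/4, and 0 < 4 b - 1 is b > 1/4. The
    limits 2 b and 1 are those of \<open>japanese_convolution\<close> and
    \<open>kernel_sum_bound\<close>.\<close>
  have "max 0 (1 - s) < min (4 * b - 1) (min (2 * b) 1)" using s b by auto
  then obtain \<theta> where \<theta>: "max 0 (1 - s) < \<theta>" "\<theta> < min (4 * b - 1) (min (2 * b) 1)"
    using dense by blast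
  obtain C1 where C1: "C1 > 0" "\<And>K t k. finite K \<Longrightarrow>
    (\<Sum>l\<in>K. japanese (lat l) powr (- 2 * s) *
       japanese (t + (norm (lat l))\<^sup>2 + (norm (lat (k - l)))\<^sup>2) powr - \<theta>) \<le> C1"
    using kernel_sum_bound[of \<theta> s] \<theta> by auto
  obtain C2 where C2: "C2 > 0" "\<And>A. (\<integral>\<^sup>+x. ennreal (japanese x powr (- 2 * b) * japanese (A - x) powr (- 2 * b)) \<partial>lborel)
    \<le> ennreal (C2 * japanese (A :: real) powr - \<theta>)"
    using japanese_convolution[of \<theta> b] \<theta> by auto
  have "(\<Sum>l\<in>K. \<integral>\<^sup>+\<tau>. ennreal (japanese (lat l) powr (- 2 * s) *
      (japanese (\<tau> + (norm (lat l))\<^sup>2) powr (- 2 * b) * japanese (\<sigma> - \<tau> + (norm (lat (k - l)))\<^sup>2) powr (- 2 * b))) \<partial>lborel)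
    \<le> ennreal (C2 * C1)" if K: "finite K" for K \<sigma> k
  proof -
    have "(\<integral>\<^sup>+\<tau>. ennreal (japanese (lat l) powr (- 2 * s) *
      (japanese (\<tau> + (norm (lat l))\<^sup>2) powr (- 2 * b) * japanese (\<sigma> - \<tau> + (norm (lat (k - l)))\<^sup>2) powr (- 2 * b))) \<partial>lborel)
      \<le> ennreal (C2 * (japanese (lat l) powr (- 2 * s) * japanese (\<sigma> + (norm (lat l))\<^sup>2 + (norm (lat (k - l)))\<^sup>2) powr - \<theta>))" for l
    proof -
      define A where "A = \<sigma> + (norm (lat l))\<^sup>2 + (norm (lat (k - l)))\<^sup>2"
      let ?h = "\<lambda>x. ennreal (japanese x powr (- 2 * b) * japanese (A - x) powr (- 2 * b))"
      have "(\<integral>\<^sup>+\<tau>. ennreal (japanese (lat l) powr (- 2 * s) *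
        (japanese (\<tau> + (norm (lat l))\<^sup>2) powr (- 2 * b) * japanese (\<sigma> - \<tau> + (norm (lat (k - l)))\<^sup>2) powr (- 2 * b))) \<partial>lborel)
        = (\<integral>\<^sup>+\<tau>. ennreal (japanese (lat l) powr (- 2 * s)) * ?h ((norm (lat l))\<^sup>2 + 1 * \<tau>) \<partial>lborel)"
        by (intro nn_integral_cong) (simp add: ennreal_mult' A_def algebra_simps)
      also have "\<dots> = ennreal (japanese (lat l) powr (- 2 * s)) * (\<integral>\<^sup>+\<tau>. ?h ((norm (lat l))\<^sup>2 + 1 * \<tau>) \<partial>lborel)"
        by (rule nn_integral_cmult) measurable
      also have "(\<integral>\<^sup>+\<tau>. ?h ((norm (lat l))\<^sup>2 + 1 * \<tau>) \<partial>lborel) = (\<integral>\<^sup>+x. ?h x \<partial>lborel)"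
        by (subst (2) nn_integral_real_affine[of _ 1 "(norm (lat l))\<^sup>2"]) auto
      also have "ennreal (japanese (lat l) powr (- 2 * s)) * (\<integral>\<^sup>+x. ?h x \<partial>lborel) \<le>
          ennreal (japanese (lat l) powr (- 2 * s)) * ennreal (C2 * japanese A powr - \<theta>)"
        by (intro mult_left_mono C2) auto
      also have "\<dots> = ennreal (C2 * (japanese (lat l) powr (- 2 * s) * japanese A powr - \<theta>))"
        using C2(1) by (simp add: ennreal_mult'[symmetric] mult_ac)
      finally show ?thesis unfolding A_def .
    qed
    then have "(\<Sum>l\<in>K. \<integral>\<^sup>+\<tau>. ennreal (japanese (lat l) powr (- 2 * s) *
      (japanese (\<tau> + (norm (lat l))\<^sup>2) powr (- 2 * b) * japanese (\<sigma> - \<tau> + (norm (lat (k - l)))\<^sup>2) powr (- 2 * b))) \<partial>lborel)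
      \<le> (\<Sum>l\<in>K. ennreal (C2 * (japanese (lat l) powr (- 2 * s) * japanese (\<sigma> + (norm (lat l))\<^sup>2 + (norm (lat (k - l)))\<^sup>2) powr - \<theta>)))"
      by (rule sum_mono)
    also have "\<dots> = ennreal (\<Sum>l\<in>K. C2 * (japanese (lat l) powr (- 2 * s) * japanese (\<sigma> + (norm (lat l))\<^sup>2 + (norm (lat (k - l)))\<^sup>2) powr - \<theta>))"
      using C2(1) by (intro sum_ennreal) auto
    also have "\<dots> \<le> ennreal (C2 * C1)"
      unfolding sum_distrib_left[symmetric] using C2(1) C1(2)[OF K] by (intro ennreal_leI mult_left_mono) auto
    finally show ?thesis .
  qed
  moreover have "C2 * C1 > 0" using C1(1) C2(1) by simp
  ultimately show ?thesis by blast
qed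

text \<open>The finite sum and the integral are read as one integral over counting measure times
  Lebesgue measure.\<close>

lemma sum_nn_integral_Cauchy_Schwarz:
  fixes f g :: "'a \<Rightarrow> real \<Rightarrow> ennreal"
  assumes K: "finite K" and [measurable]: "\<And>k. f k \<in> borel_measurable borel" "\<And>k. g k \<in> borel_measurable borel"
  shows "(\<Sum>k\<in>K. \<integral>\<^sup>+x. f k x * g k x \<partial>lborel)\<^sup>2 \<le>
    (\<Sum>k\<in>K. \<integral>\<^sup>+x. (f k x)\<^sup>2 \<partial>lborel) * (\<Sum>k\<in>K. \<integral>\<^sup>+x. (g k x)\<^sup>2 \<partial>lborel)"
proof -
  let ?N = "count_space K \<Otimes>\<^sub>M (lborel :: real measure)"
  have cK: "countable K" using K by (rule countable_finite)
  have fm: "(\<lambda>z. f (fst z) (snd z)) \<in> borel_measurable ?N" "(\<lambda>z. g (fst z) (snd z)) \<in> borel_measurable ?N"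
    by (rule measurable_pair_measure_countable1[OF cK]; simp)+
  note [measurable] = this
  have eq: "(\<Sum>k\<in>K. \<integral>\<^sup>+x. h k x \<partial>lborel) = (\<integral>\<^sup>+z. h (fst z) (snd z) \<partial>?N)"
    if "(\<lambda>z. h (fst z) (snd z)) \<in> borel_measurable ?N" for h :: "'a \<Rightarrow> real \<Rightarrow> ennreal"
    using lborel.nn_integral_fst[OF that] K by (simp add: nn_integral_count_space_finite)
  have "(\<Sum>k\<in>K. \<integral>\<^sup>+x. f k x * g k x \<partial>lborel) = (\<integral>\<^sup>+z. f (fst z) (snd z) * g (fst z) (snd z) \<partial>?N)"
    "(\<Sum>k\<in>K. \<integral>\<^sup>+x. (f k x)\<^sup>2 \<partial>lborel) = (\<integral>\<^sup>+z. (f (fst z) (snd z))\<^sup>2 \<partial>?N)"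
    "(\<Sum>k\<in>K. \<integral>\<^sup>+x. (g k x)\<^sup>2 \<partial>lborel) = (\<integral>\<^sup>+z. (g (fst z) (snd z))\<^sup>2 \<partial>?N)"
    by (rule eq; measurable)+
  then show ?thesis using Cauchy_Schwarz_nn_integral[OF fm] by simp
qed

text \<open>Cauchy-Schwarz in (l, tau), after multiplying and dividing by the weight
  \<open>J\<close>. The factor with 1/J^2 is the kernel bound, uniform in (sigma, k); the other is a
  convolution of the weighted squares \<open>a\<close> and \<open>c\<close>, whose integral is at
  most the product of their total masses.\<close>

lemma bilinear_fourier_side:
  fixes s b :: real
  assumes "s > 0" "b > 1 / 4" "b > 1 / 2 - s / 4"
  shows "\<exists>C>0. \<forall>K V L W. nice K V \<longrightarrow> nice L W \<longrightarrow>
    (\<Sum>k\<in>(\<lambda>(k, l). k + l) ` (K \<times> L). \<integral>\<^sup>+\<sigma>. ennreal ((cmod (st_conv K V W \<sigma> k))\<^sup>2) \<partial>lborel)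
    \<le> ennreal C * (weighted_sq s b V * weighted_sq 0 b W)"
proof -
  obtain C where C: "C > 0" "\<And>K \<sigma> k. finite K \<Longrightarrow>
    (\<Sum>l\<in>K. \<integral>\<^sup>+\<tau>. ennreal (japanese (lat l) powr (- 2 * s) *
      (japanese (\<tau> + (norm (lat l))\<^sup>2) powr (- 2 * b) * japanese (\<sigma> - \<tau> + (norm (lat (k - l)))\<^sup>2) powr (- 2 * b))) \<partial>lborel)
    \<le> ennreal C"
    using interaction_kernel_bound[OF assms] by blast
  have "(\<Sum>k\<in>(\<lambda>(k, l). k + l) ` (K \<times> L). \<integral>\<^sup>+\<sigma>. ennreal ((cmod (st_conv K V W \<sigma> k))\<^sup>2) \<partial>lborel)
    \<le> ennreal C * (weighted_sq s b V * weighted_sq 0 b W)" if V: "nice K V" and W: "nice L W" for K V L W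
  proof -
    note [measurable] = nice_measurable[OF V] nice_measurable[OF W]
    note K = niceD(1)[OF V]
    define M where "M = (\<lambda>(k, l). k + l) ` (K \<times> L)"
    have finM: "finite M" using K niceD(1)[OF W] by (auto simp: M_def)
    define a where "a l \<tau> = (japanese (lat l) powr s * japanese (\<tau> + (norm (lat l))\<^sup>2) powr b * cmod (V \<tau> l))\<^sup>2" for l \<tau>
    define c where "c l \<tau> = (japanese (lat l) powr 0 * japanese (\<tau> + (norm (lat l))\<^sup>2) powr b * cmod (W \<tau> l))\<^sup>2" for l \<tau>
    have [measurable]: "a l \<in> borel_measurable borel" "c l \<in> borel_measurable borel" for l
      unfolding a_def c_def by measurable
    have ac0: "a l \<tau> \<ge> 0" "c l \<tau> \<ge> 0" for l \<tau> by (simp_all add: a_def c_def)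
    have pt: "ennreal ((cmod (st_conv K V W \<sigma> k))\<^sup>2) \<le>
        ennreal C * (\<Sum>l\<in>K. \<integral>\<^sup>+\<tau>. ennreal (a l \<tau>) * ennreal (c (k - l) (\<sigma> - \<tau>)) \<partial>lborel)" for k \<sigma>
    proof -
      define J where "J l \<tau> = japanese (lat l) powr s * (japanese (\<tau> + (norm (lat l))\<^sup>2) powr b *
          japanese (\<sigma> - \<tau> + (norm (lat (k - l)))\<^sup>2) powr b)" for l \<tau>
      have J0: "J l \<tau> > 0" for l \<tau> by (simp add: J_def)
      have [measurable]: "J l \<in> borel_measurable borel" for l unfolding J_def by measurable
      have Jinv: "(inverse (J l \<tau>))\<^sup>2 = japanese (lat l) powr (- 2 * s) *
          (japanese (\<tau> + (norm (lat l))\<^sup>2) powr (- 2 * b) * japanese (\<sigma> - \<tau> + (norm (lat (k - l)))\<^sup>2) powr (- 2 * b))" for l \<tau>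
      proof -
        have "(inverse (x powr r))\<^sup>2 = x powr (- 2 * r)" for x r :: real
          by (simp add: powr_minus[symmetric] power2_eq_square powr_add[symmetric])
        then show ?thesis by (simp add: J_def power_mult_distrib)
      qed
      have Jac: "(J l \<tau> * (cmod (V \<tau> l) * cmod (W (\<sigma> - \<tau>) (k - l))))\<^sup>2 = a l \<tau> * c (k - l) (\<sigma> - \<tau>)" for l \<tau>
        by (simp add: J_def a_def c_def power_mult_distrib mult_ac)
      have "ennreal (cmod (st_conv K V W \<sigma> k)) \<le> ennreal (\<Sum>l\<in>K. cmod (LINT \<tau>|lborel. V \<tau> l * W (\<sigma> - \<tau>) (k - l)))"
        unfolding st_conv_def by (intro ennreal_leI norm_sum)
      also have "\<dots> = (\<Sum>l\<in>K. ennreal (cmod (LINT \<tau>|lborel. V \<tau> l * W (\<sigma> - \<tau>) (k - l))))"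
        by (rule sum_ennreal[symmetric]) simp
      also have "\<dots> \<le> (\<Sum>l\<in>K. \<integral>\<^sup>+\<tau>. ennreal (norm (V \<tau> l * W (\<sigma> - \<tau>) (k - l))) \<partial>lborel)"
        by (intro sum_mono ennreal_norm_integral_le)
      also have "\<dots> = (\<Sum>l\<in>K. \<integral>\<^sup>+\<tau>. ennreal (inverse (J l \<tau>)) *
          ennreal (J l \<tau> * (cmod (V \<tau> l) * cmod (W (\<sigma> - \<tau>) (k - l)))) \<partial>lborel)"
      proof (intro sum.cong nn_integral_cong refl)
        fix l \<tau>
        have "J l \<tau> \<noteq> 0" using J0[of l \<tau>] by linarith
        then have "norm (V \<tau> l * W (\<sigma> - \<tau>) (k - l)) = inverse (J l \<tau>) * (J l \<tau> * (cmod (V \<tau> l) * cmod (W (\<sigma> - \<tau>) (k - l))))"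
          by (simp add: norm_mult)
        then show "ennreal (norm (V \<tau> l * W (\<sigma> - \<tau>) (k - l))) = ennreal (inverse (J l \<tau>)) *
          ennreal (J l \<tau> * (cmod (V \<tau> l) * cmod (W (\<sigma> - \<tau>) (k - l))))"
          using J0[of l \<tau>] by (metis ennreal_mult' inverse_nonnegative_iff_nonnegative less_imp_le)
      qed
      finally have "(ennreal (cmod (st_conv K V W \<sigma> k)))\<^sup>2 \<le> (\<Sum>l\<in>K. \<integral>\<^sup>+\<tau>. ennreal (inverse (J l \<tau>)) *
          ennreal (J l \<tau> * (cmod (V \<tau> l) * cmod (W (\<sigma> - \<tau>) (k - l)))) \<partial>lborel)\<^sup>2"
        by (intro power_mono) auto
      also have "\<dots> \<le> (\<Sum>l\<in>K. \<integral>\<^sup>+\<tau>. (ennreal (inverse (J l \<tau>)))\<^sup>2 \<partial>lborel) *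
          (\<Sum>l\<in>K. \<integral>\<^sup>+\<tau>. (ennreal (J l \<tau> * (cmod (V \<tau> l) * cmod (W (\<sigma> - \<tau>) (k - l)))))\<^sup>2 \<partial>lborel)"
        by (rule sum_nn_integral_Cauchy_Schwarz[OF K]) measurable
      also have "(\<Sum>l\<in>K. \<integral>\<^sup>+\<tau>. (ennreal (inverse (J l \<tau>)))\<^sup>2 \<partial>lborel) \<le> ennreal C"
      proof -
        have "(ennreal (inverse (J l \<tau>)))\<^sup>2 = ennreal ((inverse (J l \<tau>))\<^sup>2)" for l \<tau>
          using J0[of l \<tau>] by (simp add: ennreal_power)
        then show ?thesis unfolding Jinv using C(2)[OF K, of \<sigma> k] by simp
      qed
      also have "(\<Sum>l\<in>K. \<integral>\<^sup>+\<tau>. (ennreal (J l \<tau> * (cmod (V \<tau> l) * cmod (W (\<sigma> - \<tau>) (k - l)))))\<^sup>2 \<partial>lborel) =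
          (\<Sum>l\<in>K. \<integral>\<^sup>+\<tau>. ennreal (a l \<tau>) * ennreal (c (k - l) (\<sigma> - \<tau>)) \<partial>lborel)"
      proof (intro sum.cong nn_integral_cong refl)
        fix l \<tau>
        have "(ennreal (J l \<tau> * (cmod (V \<tau> l) * cmod (W (\<sigma> - \<tau>) (k - l)))))\<^sup>2 = ennreal (a l \<tau> * c (k - l) (\<sigma> - \<tau>))"
          unfolding Jac[symmetric] using J0[of l \<tau>] by (intro ennreal_power) simp
        then show "(ennreal (J l \<tau> * (cmod (V \<tau> l) * cmod (W (\<sigma> - \<tau>) (k - l)))))\<^sup>2 = ennreal (a l \<tau>) * ennreal (c (k - l) (\<sigma> - \<tau>))"
          using ac0 by (simp add: ennreal_mult)
      qed
      finally show ?thesis by (simp add: ennreal_power mult_right_mono)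
    qed
    have Aa: "(\<integral>\<^sup>+\<tau>. ennreal (a l \<tau>) \<partial>lborel) = mode_sq s b V l" for l by (simp add: a_def mode_sq_def)
    have Ac: "(\<integral>\<^sup>+\<tau>. ennreal (c l \<tau>) \<partial>lborel) = mode_sq 0 b W l" for l by (simp add: c_def mode_sq_def)
    have dbl: "(\<integral>\<^sup>+\<sigma>. (\<integral>\<^sup>+\<tau>. ennreal (a l \<tau>) * ennreal (c m (\<sigma> - \<tau>)) \<partial>lborel) \<partial>lborel) = mode_sq s b V l * mode_sq 0 b W m" for l m
    proof -
      have "(\<integral>\<^sup>+\<sigma>. (\<integral>\<^sup>+\<tau>. ennreal (a l \<tau>) * ennreal (c m (\<sigma> - \<tau>)) \<partial>lborel) \<partial>lborel) =
          (\<integral>\<^sup>+\<tau>. (\<integral>\<^sup>+\<sigma>. ennreal (a l \<tau>) * ennreal (c m (\<sigma> - \<tau>)) \<partial>lborel) \<partial>lborel)"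
        by (rule lborel_pair.Fubini') measurable
      also have "\<dots> = (\<integral>\<^sup>+\<tau>. ennreal (a l \<tau>) * mode_sq 0 b W m \<partial>lborel)"
      proof (intro nn_integral_cong)
        fix \<tau>
        have "(\<integral>\<^sup>+\<sigma>. ennreal (a l \<tau>) * ennreal (c m (\<sigma> - \<tau>)) \<partial>lborel) = ennreal (a l \<tau>) * (\<integral>\<^sup>+\<sigma>. ennreal (c m (\<sigma> - \<tau>)) \<partial>lborel)"
          by (rule nn_integral_cmult) measurable
        also have "(\<integral>\<^sup>+\<sigma>. ennreal (c m (\<sigma> - \<tau>)) \<partial>lborel) = (\<integral>\<^sup>+\<sigma>. ennreal (c m \<sigma>) \<partial>lborel)"
          by (subst (2) nn_integral_real_affine[of _ 1 "- \<tau>"]) auto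
        finally show "(\<integral>\<^sup>+\<sigma>. ennreal (a l \<tau>) * ennreal (c m (\<sigma> - \<tau>)) \<partial>lborel) = ennreal (a l \<tau>) * mode_sq 0 b W m"
          unfolding Ac .
      qed
      also have "\<dots> = mode_sq s b V l * mode_sq 0 b W m"
        unfolding Aa[symmetric] by (rule nn_integral_multc) measurable
      finally show ?thesis .
    qed
    have "(\<Sum>k\<in>M. \<integral>\<^sup>+\<sigma>. ennreal ((cmod (st_conv K V W \<sigma> k))\<^sup>2) \<partial>lborel) \<le>
        (\<Sum>k\<in>M. \<integral>\<^sup>+\<sigma>. ennreal C * (\<Sum>l\<in>K. \<integral>\<^sup>+\<tau>. ennreal (a l \<tau>) * ennreal (c (k - l) (\<sigma> - \<tau>)) \<partial>lborel) \<partial>lborel)"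
      by (intro sum_mono nn_integral_mono pt)
    also have "\<dots> = (\<Sum>k\<in>M. ennreal C * (\<Sum>l\<in>K. mode_sq s b V l * mode_sq 0 b W (k - l)))"
    proof (intro sum.cong refl)
      fix k
      have "(\<integral>\<^sup>+\<sigma>. ennreal C * (\<Sum>l\<in>K. \<integral>\<^sup>+\<tau>. ennreal (a l \<tau>) * ennreal (c (k - l) (\<sigma> - \<tau>)) \<partial>lborel) \<partial>lborel) =
          ennreal C * (\<integral>\<^sup>+\<sigma>. (\<Sum>l\<in>K. \<integral>\<^sup>+\<tau>. ennreal (a l \<tau>) * ennreal (c (k - l) (\<sigma> - \<tau>)) \<partial>lborel) \<partial>lborel)"
        by (rule nn_integral_cmult) measurable
      also have "(\<integral>\<^sup>+\<sigma>. (\<Sum>l\<in>K. \<integral>\<^sup>+\<tau>. ennreal (a l \<tau>) * ennreal (c (k - l) (\<sigma> - \<tau>)) \<partial>lborel) \<partial>lborel) =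
          (\<Sum>l\<in>K. mode_sq s b V l * mode_sq 0 b W (k - l))"
        unfolding dbl[symmetric] by (rule nn_integral_sum) measurable
      finally show "(\<integral>\<^sup>+\<sigma>. ennreal C * (\<Sum>l\<in>K. \<integral>\<^sup>+\<tau>. ennreal (a l \<tau>) * ennreal (c (k - l) (\<sigma> - \<tau>)) \<partial>lborel) \<partial>lborel) =
          ennreal C * (\<Sum>l\<in>K. mode_sq s b V l * mode_sq 0 b W (k - l))" .
    qed
    also have "\<dots> = ennreal C * (\<Sum>l\<in>K. mode_sq s b V l * (\<Sum>k\<in>M. mode_sq 0 b W (k - l)))"
      by (simp only: sum_distrib_left[symmetric] sum.swap[of _ K M])
    also have "\<dots> \<le> ennreal C * (\<Sum>l\<in>K. mode_sq s b V l * weighted_sq 0 b W)"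
    proof (intro mult_left_mono sum_mono)
      fix l
      have "(\<Sum>k\<in>M. mode_sq 0 b W (k - l)) = (\<Sum>k\<in>(\<lambda>k. k - l) ` M. mode_sq 0 b W k)"
        by (subst sum.reindex) (auto simp: inj_on_def)
      also have "\<dots> \<le> weighted_sq 0 b W" using finM by (intro sum_mode_sq_le) auto
      finally show "(\<Sum>k\<in>M. mode_sq 0 b W (k - l)) \<le> weighted_sq 0 b W" .
    qed auto
    also have "\<dots> = ennreal C * ((\<Sum>l\<in>K. mode_sq s b V l) * weighted_sq 0 b W)"
      by (simp only: sum_distrib_right)
    also have "\<dots> \<le> ennreal C * (weighted_sq s b V * weighted_sq 0 b W)"
      using K by (intro mult_left_mono mult_right_mono sum_mode_sq_le) auto
    finally show ?thesis unfolding M_def .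
  qed
  then show ?thesis using C(1) by blast
qed

lemma bilinear_nice:
  fixes s b :: real
  assumes "s > 0" "b > 1 / 4" "b > 1 / 2 - s / 4"
  shows "\<exists>C>0. \<forall>K V L W. nice K V \<longrightarrow> nice L W \<longrightarrow>
    (\<integral>\<^sup>+p. ennreal ((cmod (synth K V p * synth L W p))\<^sup>2) \<partial>RT2)
    \<le> ennreal C * (weighted_sq s b V * weighted_sq 0 b W)"
proof -
  obtain C where C: "C > 0" "\<And>K V L W. nice K V \<Longrightarrow> nice L W \<Longrightarrow>
    (\<Sum>k\<in>(\<lambda>(k, l). k + l) ` (K \<times> L). \<integral>\<^sup>+\<sigma>. ennreal ((cmod (st_conv K V W \<sigma> k))\<^sup>2) \<partial>lborel)
    \<le> ennreal C * (weighted_sq s b V * weighted_sq 0 b W)"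
    using bilinear_fourier_side[OF assms] by blast
  have "(\<integral>\<^sup>+p. ennreal ((cmod (synth K V p * synth L W p))\<^sup>2) \<partial>RT2)
    \<le> ennreal ((2 * pi) ^ 3 * C) * (weighted_sq s b V * weighted_sq 0 b W)" if V: "nice K V" and W: "nice L W" for K V L W
  proof -
    have "(\<integral>\<^sup>+p. ennreal ((cmod (synth K V p * synth L W p))\<^sup>2) \<partial>RT2) \<le> ennreal ((2 * pi) ^ 3) *
        (\<Sum>k\<in>(\<lambda>(k, l). k + l) ` (K \<times> L). \<integral>\<^sup>+\<sigma>. ennreal ((cmod (st_conv K V W \<sigma> k))\<^sup>2) \<partial>lborel)"
      unfolding synth_mult[OF V W] by (rule synth_bessel[OF nice_st_conv[OF V W]])
    also have "\<dots> \<le> ennreal ((2 * pi) ^ 3) * (ennreal C * (weighted_sq s b V * weighted_sq 0 b W))"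
      by (intro mult_left_mono C(2) V W) auto
    finally show ?thesis using C(1) by (simp add: ennreal_mult mult.assoc)
  qed
  moreover have "(2 * pi) ^ 3 * C > 0" using C(1) by simp
  ultimately show ?thesis by blast
qed

section \<open>Uniqueness of the Fourier transform\<close>

text \<open>The pi-lambda theorem: closed sets are stable under intersection and generate the Borel
  sets, and their indicators are pointwise limits of continuous functions of the distance. Tests are
  composed with \<open>E\<close> so that continuity matters only on \<open>S\<close>, later a
  compact torus.\<close>

lemma integral_vanishes_on_borel:
  fixes E :: "'a \<Rightarrow> 'e :: euclidean_space" and F :: "'a \<Rightarrow> complex"
  assumes E [measurable]: "E \<in> borel_measurable M" and S: "\<And>p. p \<in> space M \<Longrightarrow> E p \<in> S"
    and F: "integrable M F"
    and zero: "\<And>f. continuous_on S f \<Longrightarrow> (LINT p|M. F p * complex_of_real (f (E p))) = 0"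
    and B: "B \<in> sets borel"
  shows "(LINT p|M. F p * indicator B (E p)) = 0"
proof -
  have [measurable]: "F \<in> borel_measurable M" using F by auto
  have int: "integrable M (\<lambda>p. F p * indicator A (E p))" if [measurable]: "A \<in> sets borel" for A
    by (rule Bochner_Integration.integrable_bound[OF F]) (auto simp: norm_mult indicator_def)
  have B': "B \<in> sigma_sets UNIV (Collect closed)" using B by (simp add: borel_eq_closed)
  have stable: "Int_stable (Collect closed :: 'e set set)" by (auto simp: Int_stable_def)
  have subset_Pow: "(Collect closed :: 'e set set) \<subseteq> Pow UNIV" by simp
  have sb: "A \<in> sets borel" if "A \<in> sigma_sets UNIV (Collect closed)" for A :: "'e set"
    using that by (simp add: borel_eq_closed)
  show ?thesis
    using stable subset_Pow B'
  proof (induction rule: sigma_sets_induct_disjoint)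
    case (basic A)
    then have cl: "closed A" by simp
    then have [measurable]: "A \<in> sets borel" by (rule borel_closed)
    show ?case
    \<comment> \<open>\<open>infdist\<close> to the empty set is 0 by convention, which would make
      every \<open>f n\<close> equal to 1 instead of tending to 0.\<close>
    proof (cases "A = {}")
      case True
      then show ?thesis by simp
    next
      case False
      define f where "f n x = max 0 (1 - real n * infdist x A)" for n :: nat and x
      have f01: "0 \<le> f n x" "f n x \<le> 1" for n x by (auto simp: f_def infdist_nonneg)
      have fm [measurable]: "f n \<in> borel_measurable borel" for n
        unfolding f_def by (intro borel_measurable_continuous_onI continuous_intros)
      have lim: "(\<lambda>n. f n x) \<longlonglongrightarrow> indicator A x" for x
      proof (cases "x \<in> A")
        case True
        then show ?thesis by (simp add: f_def)
      next
        case x: False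
        then have pos: "infdist x A > 0"
          using cl False in_closed_iff_infdist_zero[of A x] infdist_nonneg[of x A] by linarith
        have "f n x = 0" if "n \<ge> nat \<lceil>1 / infdist x A\<rceil>" for n
        proof -
          have "1 / infdist x A \<le> real n" using that by linarith
          then have "1 \<le> real n * infdist x A" using pos by (simp add: field_simps)
          then show ?thesis by (simp add: f_def)
        qed
        then have "\<forall>\<^sub>F n in sequentially. f n x = 0" unfolding eventually_sequentially by blast
        then have "(\<lambda>n. f n x) \<longlonglongrightarrow> 0" by (rule tendsto_eventually)
        then show ?thesis using x by simp
      qed
      have "(\<lambda>n. LINT p|M. F p * complex_of_real (f n (E p))) \<longlonglongrightarrow> (LINT p|M. F p * complex_of_real (indicator A (E p)))"
      proof (rule integral_dominated_convergence)
        show "integrable M (\<lambda>p. norm (F p))" using F by simp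
        show "AE p in M. (\<lambda>n. F p * complex_of_real (f n (E p))) \<longlonglongrightarrow> F p * complex_of_real (indicator A (E p))"
          by (intro AE_I2 tendsto_intros lim)
        show "AE p in M. norm (F p * complex_of_real (f n (E p))) \<le> norm (F p)" for n
          using f01 by (auto simp: norm_mult intro!: mult_left_le)
        show "(\<lambda>p. F p * complex_of_real (indicator A (E p))) \<in> borel_measurable M"
          by measurable
      qed measurable
      moreover have "(LINT p|M. F p * complex_of_real (f n (E p))) = 0" for n
        unfolding f_def by (intro zero continuous_intros)
      ultimately have "(LINT p|M. F p * complex_of_real (indicator A (E p))) = 0"
        using LIMSEQ_unique[OF _ tendsto_const] by simp
      moreover have "complex_of_real (indicator A (E p)) = indicator A (E p)" for p
        by (simp add: indicator_def)
      ultimately show ?thesis by (simp only:)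
    qed
  next
    case empty
    show ?case by simp
  next
    case (compl A)
    have [measurable]: "A \<in> sets borel" using compl(1) by (rule sb)
    have tot: "(LINT p|M. F p) = 0" using zero[of "\<lambda>_. 1"] by simp
    have "(LINT p|M. F p * indicator (UNIV - A) (E p)) = (LINT p|M. F p - F p * indicator A (E p))"
      by (intro Bochner_Integration.integral_cong refl) (auto simp: indicator_def)
    also have "\<dots> = 0" using F int[of A] compl(2) tot by simp
    finally show ?case .
  next
    case (union A)
    have [measurable]: "A i \<in> sets borel" for i using union(2) by (intro sb) auto
    define D where "D i = {p \<in> space M. E p \<in> A i}" for i
    have Dm: "D i \<in> sets M" for i unfolding D_def by measurable
    have conv: "(LINT p|M. F p * indicator X (E p)) = (LINT p:{p \<in> space M. E p \<in> X}|M. F p)" for X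
      unfolding set_lebesgue_integral_def
      by (intro Bochner_Integration.integral_cong refl) (auto simp: indicator_def)
    have UN: "{p \<in> space M. E p \<in> (\<Union>i. A i)} = (\<Union>i. D i)" by (auto simp: D_def)
    have dis: "D i \<inter> D j = {}" if "i \<noteq> j" for i j
      using union(1) that by (auto simp: D_def disjoint_family_on_def)
    have UD: "(\<Union>i. D i) \<in> sets M" using Dm by blast
    have "set_integrable M (\<Union>i. D i) F"
      unfolding set_integrable_def using integrable_mult_indicator[OF UD F] .
    then have "(LINT p:(\<Union>i. D i)|M. F p) = (\<Sum>i. (LINT p:D i|M. F p))"
      using Dm dis by (intro lebesgue_integral_countable_add) auto
    also have "\<dots> = (\<Sum>i. 0)" using union(3) unfolding conv D_def[symmetric] by simp
    finally show ?case unfolding conv UN by simp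
  qed
qed

section \<open>Integrable functions orthogonal to all characters\<close>

text \<open>The time frequency a ranges over all reals, so that trigonometric polynomials of any
  period in time can serve as tests.\<close>

definition annihilating :: "(real \<times> (real ^ 2) \<Rightarrow> complex) \<Rightarrow> bool" where
  "annihilating F \<longleftrightarrow> integrable RT2 F \<and>
    (\<forall>a k. (LINT p|RT2. F p * cis (a * fst p + lat k \<bullet> snd p)) = 0)"

lemma integrable_mult_bounded:
  fixes F :: "'a \<Rightarrow> complex"
  assumes "integrable M F" "g \<in> borel_measurable M" "\<And>p. norm (g p) \<le> 1"
  shows "integrable M (\<lambda>p. F p * g p)"
proof (rule Bochner_Integration.integrable_bound[OF assms(1)])
  show "(\<lambda>p. F p * g p) \<in> borel_measurable M" using assms(1,2) by (auto intro: borel_measurable_times)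
  show "AE p in M. norm (F p * g p) \<le> norm (F p)"
    using assms(3) by (auto simp: norm_mult intro!: mult_left_le)
qed

lemma integrable_mult_character:
  assumes "integrable RT2 F"
  shows "integrable RT2 (\<lambda>p. F p * cis (a * fst p + lat k \<bullet> snd p))"
  by (rule integrable_mult_bounded[OF assms]) auto

lemma annihilating_character:
  assumes "annihilating F"
  shows "annihilating (\<lambda>p. F p * cis (a * fst p + lat k \<bullet> snd p))"
  unfolding annihilating_def
proof (intro conjI allI)
  have F: "integrable RT2 F" using assms by (simp add: annihilating_def)
  show "integrable RT2 (\<lambda>p. F p * cis (a * fst p + lat k \<bullet> snd p))" by (rule integrable_mult_character[OF F])
  fix a' k'
  have eq: "F p * cis (a * fst p + lat k \<bullet> snd p) * cis (a' * fst p + lat k' \<bullet> snd p) =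
      F p * cis ((a + a') * fst p + lat (k + k') \<bullet> snd p)" for p
    unfolding mult.assoc cis_mult by (simp add: lat_add inner_add_left algebra_simps)
  show "(LINT p|RT2. F p * cis (a * fst p + lat k \<bullet> snd p) * cis (a' * fst p + lat k' \<bullet> snd p)) = 0"
    unfolding eq using assms by (simp add: annihilating_def)
qed

lemma annihilating_add:
  assumes "annihilating F" "annihilating G"
  shows "annihilating (\<lambda>p. F p + G p)"
  using assms integrable_mult_character unfolding annihilating_def
  by (simp add: distrib_right)

lemma annihilating_cmult:
  assumes "annihilating F"
  shows "annihilating (\<lambda>p. c * F p)"
  using assms unfolding annihilating_def by (simp add: mult.assoc)

lemma annihilating_zero: "annihilating (\<lambda>p. 0)"
  by (simp add: annihilating_def)

lemma annihilating_sum: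
  assumes "\<And>i. i \<in> I \<Longrightarrow> annihilating (F i)"
  shows "annihilating (\<lambda>p. \<Sum>i\<in>I. F i p)"
  using assms
  by (induction I rule: infinite_finite_induct) (auto simp: annihilating_zero annihilating_add)

lemma annihilating_cos_sin:
  assumes "annihilating F"
  shows "annihilating (\<lambda>p. F p * complex_of_real (cos (a * fst p + lat k \<bullet> snd p)))"
    and "annihilating (\<lambda>p. F p * complex_of_real (sin (a * fst p + lat k \<bullet> snd p)))"
proof -
  have cis': "cis ((- a) * fst p + lat (- k) \<bullet> snd p) = cnj (cis (a * fst p + lat k \<bullet> snd p))" for p
    by (simp add: cis_cnj lat_minus)
  have 1: "F p * complex_of_real (cos (a * fst p + lat k \<bullet> snd p)) =
      (1 / 2) * (F p * cis (a * fst p + lat k \<bullet> snd p)) + (1 / 2) * (F p * cis ((- a) * fst p + lat (- k) \<bullet> snd p))" for p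
    unfolding cis' by (simp add: complex_eq_iff field_simps)
  have 2: "F p * complex_of_real (sin (a * fst p + lat k \<bullet> snd p)) =
      (- \<i> / 2) * (F p * cis (a * fst p + lat k \<bullet> snd p)) + (\<i> / 2) * (F p * cis ((- a) * fst p + lat (- k) \<bullet> snd p))" for p
    unfolding cis' by (simp add: complex_eq_iff field_simps)
  show "annihilating (\<lambda>p. F p * complex_of_real (cos (a * fst p + lat k \<bullet> snd p)))"
    unfolding 1 by (intro annihilating_add annihilating_cmult annihilating_character assms)
  show "annihilating (\<lambda>p. F p * complex_of_real (sin (a * fst p + lat k \<bullet> snd p)))"
    unfolding 2 by (intro annihilating_add annihilating_cmult annihilating_character assms)
qed

section \<open>Wrapping the time axis around a circle\<close>

text \<open>The image lies in a compact torus in C^3, where Stone-Weierstrass is available. The real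
  coordinates of the image are cosines and sines with frequencies allowed in
  \<open>annihilating\<close>; a small c > 0 makes the map injective over the cell on a long time
  interval.\<close>

definition torus_map :: "real \<Rightarrow> real \<times> (real ^ 2) \<Rightarrow> complex \<times> complex \<times> complex" where
  "torus_map c p = (cis (c * fst p), cis (snd p $ 1), cis (snd p $ 2))"

text \<open>\<open>F\<close> stays arbitrary in the induction: for a product f g, the hypothesis for
  g is applied to F times f.\<close>

lemma annihilating_polynomial:
  assumes g: "real_polynomial_function g"
  shows "annihilating F \<Longrightarrow> annihilating (\<lambda>p. F p * complex_of_real (g (torus_map c p)))"
  using g
proof (induction g arbitrary: F rule: real_polynomial_function.induct)
  case (linear f)
  interpret f: bounded_linear f by (rule linear)
  have coord: "annihilating (\<lambda>p. F p * complex_of_real (torus_map c p \<bullet> e))" if e: "e \<in> Basis" for e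
  proof -
    have 1: "lat (axis 1 1) \<bullet> x = x $ 1" "lat (axis 2 1) \<bullet> x = x $ 2" "lat 0 \<bullet> x = 0" for x
      by (simp_all add: lat_def inner_vec_def sum_2 axis_def)
    have A: "annihilating (\<lambda>p. F p * complex_of_real (cos (c * fst p)))" "annihilating (\<lambda>p. F p * complex_of_real (sin (c * fst p)))"
      using annihilating_cos_sin[OF linear(2), of c 0] by (simp_all add: 1)
    have B: "annihilating (\<lambda>p. F p * complex_of_real (cos (snd p $ 1)))" "annihilating (\<lambda>p. F p * complex_of_real (sin (snd p $ 1)))"
      using annihilating_cos_sin[OF linear(2), of 0 "axis 1 1"] by (simp_all add: 1)
    have C: "annihilating (\<lambda>p. F p * complex_of_real (cos (snd p $ 2)))" "annihilating (\<lambda>p. F p * complex_of_real (sin (snd p $ 2)))"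
      using annihilating_cos_sin[OF linear(2), of 0 "axis 2 1"] by (simp_all add: 1)
    have "e \<in> {(1, 0, 0), (\<i>, 0, 0), (0, 1, 0), (0, \<i>, 0), (0, 0, 1), (0, 0, \<i>)}"
      using e by (auto simp: Basis_prod_def Basis_complex_def zero_prod_def)
    then show ?thesis using A B C by (auto simp: torus_map_def inner_complex_def)
  qed
  have "F p * complex_of_real (f (torus_map c p)) =
      (\<Sum>e\<in>Basis. complex_of_real (f e) * (F p * complex_of_real (torus_map c p \<bullet> e)))" for p
  proof -
    have "f (torus_map c p) = f (\<Sum>e\<in>Basis. (torus_map c p \<bullet> e) *\<^sub>R e)" by (simp add: euclidean_representation)
    also have "\<dots> = (\<Sum>e\<in>Basis. (torus_map c p \<bullet> e) * f e)" by (simp add: f.sum f.scaleR)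
    finally show ?thesis by (simp add: sum_distrib_left mult_ac)
  qed
  then show ?case using coord by (simp add: annihilating_sum annihilating_cmult)
next
  case (const r)
  then show ?case using annihilating_cmult[of F "complex_of_real r"] by (simp add: mult.commute)
next
  case (add f g)
  then show ?case using annihilating_add by (simp add: distrib_left)
next
  case (mult f g)
  have "annihilating (\<lambda>p. F p * complex_of_real (f (torus_map c p)) * complex_of_real (g (torus_map c p)))"
    by (intro mult.IH mult.prems)
  then show ?case by (simp add: mult.assoc)
qed

lemma torus_map_in_torus: "torus_map c p \<in> sphere 0 1 \<times> sphere 0 1 \<times> sphere 0 1"
  by (simp add: torus_map_def)

lemma borel_measurable_torus_map [measurable]: "torus_map c \<in> borel_measurable RT2"
  unfolding torus_map_def[abs_def]
  by (intro borel_measurable_RT2 borel_measurable_continuous_onI continuous_intros)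

text \<open>Polynomials approximate f uniformly on the torus, and the error in the integral is at
  most e times the L1 norm of \<open>F\<close>.\<close>

lemma annihilating_continuous:
  fixes f :: "complex \<times> complex \<times> complex \<Rightarrow> real"
  assumes F: "annihilating F" and f: "continuous_on (sphere 0 1 \<times> sphere 0 1 \<times> sphere 0 1) f"
  shows "(LINT p|RT2. F p * complex_of_real (f (torus_map c p))) = 0"
proof -
  let ?S = "sphere (0::complex) 1 \<times> sphere (0::complex) 1 \<times> sphere (0::complex) 1"
  have "f \<in> borel_measurable (restrict_space borel ?S)"
    using f by (rule borel_measurable_continuous_on_restrict)
  moreover have "torus_map c \<in> measurable RT2 (restrict_space borel ?S)"
    by (rule measurable_restrict_space2) (use torus_map_in_torus in auto)
  ultimately have [measurable]: "(\<lambda>p. f (torus_map c p)) \<in> borel_measurable RT2"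
    by (rule measurable_compose[rotated])
  have FI: "integrable RT2 F" using F by (simp add: annihilating_def)
  have [measurable]: "F \<in> borel_measurable RT2" using FI by auto
  have comp: "compact ?S" by (intro compact_Times) auto
  define N where "N = (LINT p|RT2. norm (F p))"
  have N0: "N \<ge> 0" by (simp add: N_def)
  have fI: "integrable RT2 (\<lambda>p. F p * complex_of_real (f (torus_map c p)))"
  proof -
    have "bounded (f ` ?S)" using compact_continuous_image[OF f comp] by (rule compact_imp_bounded)
    then obtain B where B: "\<And>z. z \<in> ?S \<Longrightarrow> norm (f z) \<le> B" by (auto simp: bounded_iff)
    have "integrable RT2 (\<lambda>p. B * norm (F p))" using FI by simp
    then show ?thesis
    proof (rule Bochner_Integration.integrable_bound)
      show "AE p in RT2. norm (F p * complex_of_real (f (torus_map c p))) \<le> norm (B * norm (F p))"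
      proof (rule AE_I2)
        fix p
        have "\<bar>f (torus_map c p)\<bar> \<le> \<bar>B\<bar>" using B[OF torus_map_in_torus[of c p]] by simp
        then show "norm (F p * complex_of_real (f (torus_map c p))) \<le> norm (B * norm (F p))"
          using mult_left_mono[of "\<bar>f (torus_map c p)\<bar>" "\<bar>B\<bar>" "norm (F p)"]
          by (simp add: norm_mult abs_mult mult.commute)
      qed
    qed measurable
  qed
  have small: "norm (LINT p|RT2. F p * complex_of_real (f (torus_map c p))) \<le> e * N" if e: "e > 0" for e
  proof -
    obtain g where g: "real_polynomial_function g" "\<And>z. z \<in> ?S \<Longrightarrow> \<bar>f z - g z\<bar> < e"
      using Stone_Weierstrass_real_polynomial_function[OF comp f e] by blast
    have ann: "annihilating (\<lambda>p. F p * complex_of_real (g (torus_map c p)))"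
      by (rule annihilating_polynomial[OF g(1) F])
    have gI: "integrable RT2 (\<lambda>p. F p * complex_of_real (g (torus_map c p)))" using ann by (simp add: annihilating_def)
    have "(LINT p|RT2. F p * complex_of_real (g (torus_map c p)) * cis (0 * fst p + lat 0 \<bullet> snd p)) = 0"
      using ann unfolding annihilating_def by blast
    then have g0: "(LINT p|RT2. F p * complex_of_real (g (torus_map c p))) = 0" by (simp add: lat_zero)
    have "(LINT p|RT2. F p * complex_of_real (f (torus_map c p))) =
        (LINT p|RT2. F p * complex_of_real (f (torus_map c p)) - F p * complex_of_real (g (torus_map c p)))"
      using fI gI g0 by simp
    also have "norm \<dots> \<le> (LINT p|RT2. norm (F p * complex_of_real (f (torus_map c p)) - F p * complex_of_real (g (torus_map c p))))"
      by (rule integral_norm_bound)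
    also have "\<dots> \<le> (LINT p|RT2. e * norm (F p))"
    proof (rule integral_mono)
      show "integrable RT2 (\<lambda>p. norm (F p * complex_of_real (f (torus_map c p)) - F p * complex_of_real (g (torus_map c p))))"
        using fI gI by simp
      show "integrable RT2 (\<lambda>p. e * norm (F p))" using FI by simp
      fix p
      have "\<bar>f (torus_map c p) - g (torus_map c p)\<bar> \<le> e"
        using g(2)[OF torus_map_in_torus[of c p]] by simp
      then have "norm (F p) * \<bar>f (torus_map c p) - g (torus_map c p)\<bar> \<le> norm (F p) * e"
        by (intro mult_left_mono) auto
      moreover have "norm (F p * complex_of_real (f (torus_map c p)) - F p * complex_of_real (g (torus_map c p))) =
          norm (F p) * \<bar>f (torus_map c p) - g (torus_map c p)\<bar>"
        by (simp only: right_diff_distrib[symmetric] of_real_diff[symmetric] norm_mult norm_of_real)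
      ultimately show "norm (F p * complex_of_real (f (torus_map c p)) - F p * complex_of_real (g (torus_map c p))) \<le> e * norm (F p)"
        by (simp add: mult.commute)
    qed
    finally show ?thesis by (simp add: N_def)
  qed
  have "norm (LINT p|RT2. F p * complex_of_real (f (torus_map c p))) \<le> 0"
  proof (rule field_le_epsilon)
    fix e :: real assume e: "e > 0"
    \<comment> \<open>Dividing by N + 1 rather than N keeps the case N = 0 harmless.\<close>
    then have "norm (LINT p|RT2. F p * complex_of_real (f (torus_map c p))) \<le> e / (N + 1) * N"
      using N0 by (intro small) simp
    also have "\<dots> \<le> e" using e N0 by (simp add: field_simps)
    finally show "norm (LINT p|RT2. F p * complex_of_real (f (torus_map c p))) \<le> 0 + e" by simp
  qed
  then show ?thesis by simp
qed

text \<open>A branch of the argument that inverts \<open>cis\<close> on (-pi, pi). Clamping the real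
  part to [-1, 1] makes the \<open>arccos\<close> term continuous on all of C, off the unit circle
  too.\<close>

definition angle :: "complex \<Rightarrow> real" where
  "angle z = (if Im z \<ge> 0 then arccos (max (- 1) (min 1 (Re z))) else - arccos (max (- 1) (min 1 (Re z))))"

lemma borel_measurable_angle [measurable]: "angle \<in> borel_measurable borel"
proof -
  have "(\<lambda>z::complex. arccos (max (- 1) (min 1 (Re z)))) \<in> borel_measurable borel"
    by (intro borel_measurable_continuous_onI continuous_intros) auto
  then show ?thesis unfolding angle_def[abs_def] by measurable
qed

lemma angle_cis: "angle (cis t) = t" if "- pi < t" "t < pi"
proof (cases "t \<ge> 0")
  case True
  then have "sin t \<ge> 0" using that by (intro sin_ge_zero) auto
  then show ?thesis using True that by (simp add: angle_def arccos_cos)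
next
  case False
  then have "sin (- t) > 0" using that by (intro sin_gt_zero) auto
  moreover have "arccos (cos (- t)) = - t" using False that by (intro arccos_cos) auto
  ultimately show ?thesis by (simp add: angle_def)
qed

lemma angle_neg_cis: "angle (- cis t) + pi = t" if "0 < t" "t < 2 * pi"
proof -
  have "- cis t = cis (t - pi)" by (simp add: complex_eq_iff cos_diff sin_diff)
  then show ?thesis using angle_cis[of "t - pi"] that by simp
qed

text \<open>An angle in (0, 2 pi) is read off as \<open>angle\<close> of the opposite point plus pi.
  At the point 1 this formula would give 2 pi, whence the explicit value 0, matching the half-open
  cell. The inverse is discontinuous and merely Borel, which is why vanishing on all Borel sets of
  the torus is established beforehand.\<close>

definition torus_inverse :: "real \<Rightarrow> complex \<times> complex \<times> complex \<Rightarrow> real \<times> (real ^ 2)" where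
  "torus_inverse c z = (angle (fst z) / c,
     (\<chi> j. if j = 1 then (if fst (snd z) = 1 then 0 else angle (- fst (snd z)) + pi)
           else (if snd (snd z) = 1 then 0 else angle (- snd (snd z)) + pi)))"

lemma borel_measurable_torus_inverse [measurable]: "torus_inverse c \<in> borel_measurable borel"
proof -
  have f: "(\<lambda>z::complex \<times> complex \<times> complex. fst z) \<in> borel_measurable borel"
    "(\<lambda>z::complex \<times> complex \<times> complex. fst (snd z)) \<in> borel_measurable borel"
    "(\<lambda>z::complex \<times> complex \<times> complex. snd (snd z)) \<in> borel_measurable borel"
    by (intro borel_measurable_continuous_onI continuous_intros)+
  note [measurable] = f
  have g: "(\<lambda>z::complex. if z = 1 then 0 else angle (- z) + pi) \<in> borel_measurable borel" by measurable
  note [measurable] = measurable_compose[OF f(2) g] measurable_compose[OF f(3) g]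
  have "(\<lambda>z. (angle (fst z) / c,
     (\<chi> j. if j = 1 then (if fst (snd z) = 1 then 0 else angle (- fst (snd z)) + pi)
           else (if snd (snd z) = 1 then 0 else angle (- snd (snd z)) + pi)) :: real ^ 2)) \<in> borel_measurable borel"
    unfolding borel_prod[symmetric, where 'a = real and 'b = "real ^ 2"]
  proof (intro measurable_Pair)
    show "(\<lambda>z::complex \<times> complex \<times> complex. (\<chi> j. if j = 1 then (if fst (snd z) = 1 then 0 else angle (- fst (snd z)) + pi)
           else (if snd (snd z) = 1 then 0 else angle (- snd (snd z)) + pi)) :: real ^ 2) \<in> borel_measurable borel"
    proof (subst borel_measurable_euclidean_space, rule ballI)
      fix i :: "real ^ 2" assume "i \<in> Basis"
      then obtain j where i: "i = axis j 1" by (auto simp: Basis_vec_def)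
      show "(\<lambda>z::complex \<times> complex \<times> complex. (\<chi> j. if j = 1 then (if fst (snd z) = 1 then 0 else angle (- fst (snd z)) + pi)
           else (if snd (snd z) = 1 then 0 else angle (- snd (snd z)) + pi)) \<bullet> i) \<in> borel_measurable borel"
        by (cases "j = 1") (simp_all add: i inner_axis, measurable)
    qed
  qed measurable
  then show ?thesis unfolding torus_inverse_def[abs_def] .
qed

lemma torus_inverse_torus_map:
  assumes c: "c > 0" and t: "\<bar>c * t\<bar> < pi" and x: "x \<in> cell"
  shows "torus_inverse c (torus_map c (t, x)) = (t, x)"
proof -
  have coord: "(if cis (x $ j) = 1 then 0 else angle (- cis (x $ j)) + pi) = x $ j" for j
  proof -
    have xj: "0 \<le> x $ j" "x $ j < 2 * pi" using x by (auto simp: cell_def)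
    show ?thesis
    proof (cases "x $ j = 0")
      case False
      then have "cis (x $ j) \<noteq> 1"
      proof -
        have "cos (x $ j) \<noteq> 1"
        proof
          assume "cos (x $ j) = 1"
          then obtain n :: int where n: "x $ j = of_int n * 2 * pi" by (auto simp: cos_one_2pi_int)
          moreover have "x $ j > 0" using xj False by simp
          ultimately have "0 < n" by (simp add: zero_less_mult_iff)
          then have "1 * (2 * pi) \<le> of_int n * (2 * pi)" by (intro mult_right_mono) auto
          then show False using n xj by simp
        qed
        then show ?thesis by (simp add: complex_eq_iff)
      qed
      then show ?thesis using angle_neg_cis[of "x $ j"] False xj by simp
    qed simp
  qed
  have "angle (cis (c * t)) = c * t" using t by (intro angle_cis) auto
  moreover have "(\<chi> j. if j = 1 then x $ 1 else x $ 2) = x" by (simp add: vec_eq_iff forall_2)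
  moreover have "torus_inverse c (torus_map c (t, x)) = (angle (cis (c * t)) / c,
      \<chi> j. if j = 1 then (if cis (x $ 1) = 1 then 0 else angle (- cis (x $ 1)) + pi)
        else (if cis (x $ 2) = 1 then 0 else angle (- cis (x $ 2)) + pi))"
    by (simp only: torus_inverse_def torus_map_def fst_conv snd_conv)
  ultimately show ?thesis unfolding coord using c by simp
qed

lemma space_RT2: "space RT2 = UNIV \<times> cell"
  by (simp add: RT2_eq space_restrict_space)

text \<open>With c = 1 / (n + 1), \<open>torus_inverse\<close> undoes \<open>torus_map\<close> for
  |t| < pi (n + 1). Each point is eventually in this range, so the indicator of A is a pointwise
  limit of indicators of Borel sets of the torus composed with the wrapping.\<close>

lemma annihilating_borel_set:
  assumes F: "annihilating F" and A [measurable]: "A \<in> sets borel"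
  shows "(LINT p|RT2. F p * indicator A p) = 0"
proof -
  have FI: "integrable RT2 F" using F by (simp add: annihilating_def)
  have [measurable]: "F \<in> borel_measurable RT2" using FI by auto
  define c where "c n = 1 / real (Suc n)" for n
  define B where "B n = torus_inverse (c n) -` A \<inter> space borel" for n
  have B: "B n \<in> sets borel" for n
    unfolding B_def by (rule measurable_sets[OF borel_measurable_torus_inverse A])
  have Am: "(\<lambda>p. indicator A p :: complex) \<in> borel_measurable RT2"
    by (rule borel_measurable_RT2) measurable
  have zero: "(LINT p|RT2. F p * indicator (B n) (torus_map (c n) p)) = 0" for n
    by (rule integral_vanishes_on_borel[OF borel_measurable_torus_map torus_map_in_torus FI _ B])
       (rule annihilating_continuous[OF F])
  have "(\<lambda>n. LINT p|RT2. F p * indicator (B n) (torus_map (c n) p)) \<longlonglongrightarrow> (LINT p|RT2. F p * indicator A p)"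
  proof (rule integral_dominated_convergence)
    show "integrable RT2 (\<lambda>p. norm (F p))" using FI by simp
    show "AE p in RT2. norm (F p * indicator (B n) (torus_map (c n) p)) \<le> norm (F p)" for n
      by (auto simp: norm_mult indicator_def)
    show "(\<lambda>p. F p * indicator A p) \<in> borel_measurable RT2" using Am by measurable
    show "(\<lambda>p. F p * indicator (B n) (torus_map (c n) p)) \<in> borel_measurable RT2" for n
      using B[of n] by measurable
    show "AE p in RT2. (\<lambda>n. F p * indicator (B n) (torus_map (c n) p)) \<longlonglongrightarrow> F p * indicator A p"
    proof (rule AE_I2)
      fix p assume p: "p \<in> space RT2"
      then obtain t x where tx: "p = (t, x)" "x \<in> cell" by (auto simp: space_RT2)
      have "indicator (B n) (torus_map (c n) p) = (indicator A p :: complex)" if "n \<ge> nat \<lceil>\<bar>t\<bar>\<rceil>" for n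
      proof -
        have "\<bar>t\<bar> \<le> real n" using that by linarith
        then have "\<bar>t\<bar> < real (Suc n)" by simp
        then have "\<bar>c n * t\<bar> < 1" by (simp add: c_def field_simps)
        then have "\<bar>c n * t\<bar> < pi" using pi_gt3 by linarith
        then have "torus_inverse (c n) (torus_map (c n) p) = p"
          unfolding tx(1) by (intro torus_inverse_torus_map) (auto simp: c_def tx)
        then show ?thesis by (simp add: B_def indicator_def)
      qed
      then have "\<forall>\<^sub>F n in sequentially. F p * indicator (B n) (torus_map (c n) p) = F p * indicator A p"
        unfolding eventually_sequentially by metis
      then show "(\<lambda>n. F p * indicator (B n) (torus_map (c n) p)) \<longlonglongrightarrow> F p * indicator A p"
        by (rule tendsto_eventually)
    qed
  qed
  then show ?thesis unfolding zero using LIMSEQ_unique tendsto_const by blast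
qed

text \<open>Integrate \<open>F\<close> over the set where its real part is positive: a nonnegative
  integrand with integral 0 vanishes almost everywhere.\<close>

lemma annihilating_Re_le_0:
  assumes F: "annihilating F"
  shows "AE p in RT2. Re (F p) \<le> 0"
proof -
  have FI: "integrable RT2 F" using F by (simp add: annihilating_def)
  have [measurable]: "F \<in> borel_measurable RT2" using FI by auto
  define A where "A = {p \<in> space RT2. Re (F p) > 0}"
  have Am [measurable]: "A \<in> sets RT2" unfolding A_def by measurable
  then obtain A' where A': "A' \<in> sets lebesgue" "A = A' \<inter> (UNIV \<times> cell)"
    unfolding RT2_eq by (auto simp: sets_restrict_space)
  \<comment> \<open>The set is only Lebesgue measurable; up to a null set it is cut out by a Borel
    set \<open>S\<close>, for which the integral is known to vanish.\<close>
  obtain S N N' where S: "A' = S \<union> N" "N \<subseteq> N'" "N' \<in> null_sets lborel" "S \<in> sets lborel"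
    using A'(1) by (rule sets_completionE)
  have "AE p in lebesgue. p \<notin> N'"
    using S(3) by (intro AE_completion AE_not_in)
  then have "AE p in RT2. p \<notin> N'"
    unfolding RT2_eq using RT2_domain_borel by (subst AE_restrict_space_iff) auto
  then have ae: "AE p in RT2. F p * indicator A p = F p * indicator S p"
    using AE_space by eventually_elim (use S(1,2) A'(2) in \<open>auto simp: indicator_def space_RT2\<close>)
  have Sm: "(\<lambda>p. indicator S p :: complex) \<in> borel_measurable RT2"
    using S(4) by (intro borel_measurable_RT2) auto
  have "(LINT p|RT2. F p * indicator A p) = (LINT p|RT2. F p * indicator S p)"
    using ae Sm by (intro integral_cong_AE) auto
  also have "\<dots> = 0" using S(4) by (intro annihilating_borel_set[OF F]) auto
  finally have z: "Re (LINT p|RT2. F p * indicator A p) = 0" by simp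
  have I: "integrable RT2 (\<lambda>p. F p * indicator A p)"
    by (rule integrable_mult_bounded[OF FI]) (auto simp: indicator_def)
  have 0: "(LINT p|RT2. Re (F p * indicator A p)) = 0" unfolding integral_Re[OF I] by (rule z)
  have nn: "AE p in RT2. 0 \<le> Re (F p * indicator A p)"
    by (rule AE_I2) (auto simp: A_def indicator_def)
  have "AE p in RT2. Re (F p * indicator A p) = 0"
    using integral_nonneg_eq_0_iff_AE[OF integrable_Re[OF I] nn] 0 by simp
  then show ?thesis
    using AE_space
  proof eventually_elim
    case (elim p)
    show "Re (F p) \<le> 0"
    proof (cases "p \<in> A")
      case True
      then show ?thesis using elim(1) by simp
    next
      case False
      then show ?thesis using elim(2) by (auto simp: A_def)
    qed
  qed
qed

lemma annihilating_AE_0: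
  assumes F: "annihilating F"
  shows "AE p in RT2. F p = 0"
proof -
  have "AE p in RT2. Re (c * F p) \<le> 0" for c
    by (rule annihilating_Re_le_0[OF annihilating_cmult[OF F]])
  from this[of 1] this[of "-1"] this[of \<i>] this[of "- \<i>"] show ?thesis
    by eventually_elim (simp add: complex_eq_iff)
qed

section \<open>Reduction of integrals to the time line\<close>

lemma integrable_RT2_iff:
  fixes f :: "real \<times> (real ^ 2) \<Rightarrow> complex"
  assumes [measurable]: "f \<in> borel_measurable borel"
  shows "integrable RT2 f \<longleftrightarrow> integrable (lborel \<Otimes>\<^sub>M lborel) (\<lambda>p. indicator cell (snd p) * f p)"
    and "(LINT p|RT2. f p) = (LINT p|(lborel \<Otimes>\<^sub>M lborel). indicator cell (snd p) * f p)"
proof -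
  have m: "(\<lambda>p. indicator (UNIV \<times> cell) p *\<^sub>R f p) \<in> borel_measurable lborel"
    using RT2_domain_borel by measurable
  have eq: "(\<lambda>p. indicator (UNIV \<times> cell) p *\<^sub>R f p) = (\<lambda>p. indicator cell (snd p) * f p)"
    by (auto simp: fun_eq_iff indicator_def)
  show "integrable RT2 f \<longleftrightarrow> integrable (lborel \<Otimes>\<^sub>M lborel) (\<lambda>p. indicator cell (snd p) * f p)"
    unfolding RT2_eq lborel_prod eq[symmetric] using RT2_domain_borel
    by (subst integrable_restrict_space) (auto simp: integrable_completion[OF m])
  show "(LINT p|RT2. f p) = (LINT p|(lborel \<Otimes>\<^sub>M lborel). indicator cell (snd p) * f p)"
    unfolding RT2_eq lborel_prod eq[symmetric] using RT2_domain_borel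
    by (subst integral_restrict_space) (auto simp: integral_completion[OF m])
qed

lemma integral_RT2:
  fixes f :: "real \<times> (real ^ 2) \<Rightarrow> complex"
  assumes f [measurable]: "f \<in> borel_measurable borel" and i: "integrable RT2 f"
  shows "(LINT p|RT2. f p) = (LINT t|lborel. (LINT x|lborel. indicator cell x * f (t, x)))"
proof -
  have "integrable (lborel \<Otimes>\<^sub>M lborel) (\<lambda>p. indicator cell (snd p) * f p)"
    using i integrable_RT2_iff(1)[OF f] by simp
  from lborel_pair.integral_fst'[OF this] show ?thesis
    unfolding integrable_RT2_iff(2)[OF f] by simp
qed

lemma emeasure_cell: "emeasure lborel cell = ennreal ((2 * pi)\<^sup>2)"
  using cell_parseval[of "{0}" "\<lambda>_. 1"] by (simp add: lat_zero)

lemma integrable_RT2_of_time: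
  fixes g :: "real \<Rightarrow> complex" and f :: "real \<times> (real ^ 2) \<Rightarrow> complex"
  assumes g: "integrable lborel g" and f [measurable]: "f \<in> borel_measurable borel"
    and le: "\<And>p. norm (f p) \<le> norm (g (fst p))"
  shows "integrable RT2 f"
proof (rule integrableI_bounded)
  have [measurable]: "g \<in> borel_measurable borel" using g by auto
  show "f \<in> borel_measurable RT2" by (rule borel_measurable_RT2[OF f])
  have "(\<integral>\<^sup>+p. ennreal (norm (f p)) \<partial>RT2) =
      (\<integral>\<^sup>+t. (\<integral>\<^sup>+x. ennreal (norm (f (t, x))) * indicator cell x \<partial>lborel) \<partial>lborel)"
    by (rule nn_integral_RT2) measurable
  also have "\<dots> \<le> (\<integral>\<^sup>+t. (\<integral>\<^sup>+x. ennreal (norm (g t)) * indicator cell x \<partial>lborel) \<partial>lborel)"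
    using le by (intro nn_integral_mono mult_right_mono ennreal_leI) (metis fst_conv, simp)
  also have "\<dots> = (\<integral>\<^sup>+t. ennreal (norm (g t)) * ennreal ((2 * pi)\<^sup>2) \<partial>lborel)"
    by (simp add: nn_integral_cmult emeasure_cell)
  also have "\<dots> = (\<integral>\<^sup>+t. ennreal (norm (g t)) \<partial>lborel) * ennreal ((2 * pi)\<^sup>2)"
    by (rule nn_integral_multc) measurable
  also have "\<dots> < \<infinity>"
    using g by (simp add: integrable_iff_bounded ennreal_mult_less_top)
  finally show "(\<integral>\<^sup>+p. ennreal (norm (f p)) \<partial>RT2) < \<infinity>" .
qed

section \<open>Gaussian test functions and uniqueness for distributional transforms\<close>

lemma poly_exp_bound:
  fixes q :: "complex poly"
  shows "\<exists>C\<ge>0. \<exists>N::nat. \<forall>t::real. cmod (poly q (of_real t)) \<le> C * exp (real N * \<bar>t\<bar>)"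
proof (induction q)
  case 0
  show ?case by (intro exI[of _ 0]) auto
next
  case (pCons a q)
  then obtain C N where C: "C \<ge> 0" "\<And>t::real. cmod (poly q (of_real t)) \<le> C * exp (real N * \<bar>t\<bar>)" by blast
  have "cmod (poly (pCons a q) (of_real t)) \<le> (cmod a + C) * exp (real (Suc N) * \<bar>t\<bar>)" for t :: real
  proof -
    have e: "\<bar>t\<bar> \<le> exp \<bar>t\<bar>" using exp_ge_add_one_self[of "\<bar>t\<bar>"] by linarith
    have "cmod (poly (pCons a q) (of_real t)) \<le> cmod a + \<bar>t\<bar> * cmod (poly q (of_real t))"
      by (simp add: norm_triangle_le norm_mult)
    also have "\<dots> \<le> cmod a * exp (real (Suc N) * \<bar>t\<bar>) + exp \<bar>t\<bar> * (C * exp (real N * \<bar>t\<bar>))"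
      using C e by (intro add_mono mult_mono mult_right_le_one_le) (auto intro!: mult_left_le_imp_le simp: mult_le_cancel_left1)
    also have "exp \<bar>t\<bar> * (C * exp (real N * \<bar>t\<bar>)) = C * exp (real (Suc N) * \<bar>t\<bar>)"
      by (simp add: exp_add[symmetric] algebra_simps)
    finally show ?thesis by (simp add: algebra_simps)
  qed
  moreover have "cmod a + C \<ge> 0" using C(1) by simp
  ultimately show ?case by blast
qed

text \<open>A complex z covers in one formula the Gaussian (z = 0), its modulations (z imaginary)
  and, up to a constant factor, its translates (z real).\<close>

definition exp_gauss :: "complex \<Rightarrow> real \<Rightarrow> complex" where
  "exp_gauss z t = exp (- (of_real t)\<^sup>2 / 2 + z * of_real t)"

lemma schwartz_exp_gauss: "schwartz (exp_gauss z)"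
proof -
  \<comment> \<open>Differentiating p(t) times the function gives p'(t) + (z - t) p(t) times the
    function, so every derivative is again a polynomial multiple.\<close>
  define P where "P = rec_nat (1 :: complex poly) (\<lambda>_ p. pderiv p + [:z, - 1:] * p)"
  have P0: "P 0 = 1" and PS: "P (Suc n) = pderiv (P n) + [:z, - 1:] * P n" for n
    by (simp_all add: P_def)
  define D where "D n t = poly (P n) (of_real t) * exp_gauss z t" for n t
  have bound: "bounded (range (\<lambda>t. poly q (of_real t) * exp_gauss z t))" for q
  proof -
    obtain C N where C: "C \<ge> 0" "\<And>t::real. cmod (poly q (of_real t)) \<le> C * exp (real N * \<bar>t\<bar>)"
      using poly_exp_bound[of q] by blast
    define M where "M = real N + \<bar>Re z\<bar>"
    have "cmod (poly q (of_real t) * exp_gauss z t) \<le> C * exp (M\<^sup>2 / 2)" for t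
    proof -
      have "Re z * t \<le> \<bar>Re z\<bar> * \<bar>t\<bar>" by (metis abs_ge_self abs_mult)
      moreover have "0 \<le> (\<bar>t\<bar> - M)\<^sup>2" by simp
      \<comment> \<open>Completing the square: M |t| - t^2/2 <= M^2/2.\<close>
      ultimately have le: "real N * \<bar>t\<bar> + (- t\<^sup>2 / 2 + Re z * t) \<le> M\<^sup>2 / 2"
        by (simp add: M_def power2_eq_square algebra_simps)
      have "cmod (exp_gauss z t) = exp (- t\<^sup>2 / 2 + Re z * t)"
        by (simp add: exp_gauss_def power2_eq_square)
      then have "cmod (poly q (of_real t) * exp_gauss z t) \<le> (C * exp (real N * \<bar>t\<bar>)) * exp (- t\<^sup>2 / 2 + Re z * t)"
        using C by (simp add: norm_mult mult_right_mono)
      also have "\<dots> = C * exp (real N * \<bar>t\<bar> + (- t\<^sup>2 / 2 + Re z * t))"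
        by (simp only: exp_add mult.assoc)
      also have "\<dots> \<le> C * exp (M\<^sup>2 / 2)" using le C by (intro mult_left_mono) auto
      finally show ?thesis .
    qed
    then show ?thesis by (auto simp: bounded_iff)
  qed
  have "D 0 = exp_gauss z" by (simp add: D_def P0 fun_eq_iff)
  moreover have "(D n has_vector_derivative D (Suc n) t) (at t)" for n t
  proof -
    have "((\<lambda>w. poly (P n) w * exp (- w\<^sup>2 / 2 + z * w)) has_field_derivative
        (poly (pderiv (P n)) (of_real t) * exp (- (of_real t)\<^sup>2 / 2 + z * of_real t) +
         exp (- (of_real t)\<^sup>2 / 2 + z * of_real t) * (- of_real t + z) * poly (P n) (of_real t))) (at (of_real t))"
      by (auto intro!: derivative_eq_intros)
    then have "((\<lambda>t. poly (P n) (of_real t) * exp (- (of_real t)\<^sup>2 / 2 + z * of_real t)) has_vector_derivative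
        (poly (pderiv (P n)) (of_real t) * exp (- (of_real t)\<^sup>2 / 2 + z * of_real t) +
         exp (- (of_real t)\<^sup>2 / 2 + z * of_real t) * (- of_real t + z) * poly (P n) (of_real t))) (at t)"
      by (rule has_vector_derivative_real_field)
    moreover have "(poly (pderiv (P n)) (of_real t) * exp (- (of_real t)\<^sup>2 / 2 + z * of_real t) +
         exp (- (of_real t)\<^sup>2 / 2 + z * of_real t) * (- of_real t + z) * poly (P n) (of_real t)) = D (Suc n) t"
      by (simp add: D_def PS exp_gauss_def algebra_simps)
    ultimately show ?thesis by (simp add: D_def[abs_def] exp_gauss_def)
  qed
  moreover have "bounded (range (\<lambda>t. complex_of_real (t ^ m) * D n t))" for n m
  proof -
    have eq: "complex_of_real (t ^ m) * D n t = poly (monom 1 m * P n) (of_real t) * exp_gauss z t" for t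
      by (simp add: D_def poly_monom)
    show ?thesis unfolding eq by (rule bound)
  qed
  ultimately show ?thesis unfolding schwartz_def by blast
qed

lemma schwartz_cmult:
  assumes "schwartz \<phi>"
  shows "schwartz (\<lambda>t. c * \<phi> t)"
proof -
  obtain D where D: "D 0 = \<phi>" "\<And>n t. (D n has_vector_derivative D (Suc n) t) (at t)"
    "\<And>n m. bounded (range (\<lambda>t. complex_of_real (t ^ m) * D n t))"
    using assms unfolding schwartz_def by blast
  have "bounded (range (\<lambda>t. complex_of_real (t ^ m) * (c * D n t)))" for n m
  proof -
    obtain B where B: "\<And>t. cmod (complex_of_real (t ^ m) * D n t) \<le> B"
      using D(3)[where n = n and m = m] unfolding bounded_iff by blast
    have "cmod (complex_of_real (t ^ m) * (c * D n t)) \<le> cmod c * B" for t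
      using mult_left_mono[OF B[of t] norm_ge_zero[of c]] by (simp add: norm_mult mult_ac)
    then show ?thesis unfolding bounded_iff by blast
  qed
  moreover have "((\<lambda>t. c * D n t) has_vector_derivative c * D (Suc n) t) (at t)" for n t
    using has_vector_derivative_mult_right[OF D(2)] .
  ultimately show ?thesis
    unfolding schwartz_def using D(1) by (intro exI[of _ "\<lambda>n t. c * D n t"]) auto
qed

text \<open>Normalised so that its transform is exp(-t^2/2) times a character. Testing against all
  these bumps therefore pairs u with all characters under one fixed Gaussian weight in time.\<close>

definition gauss_bump :: "real \<Rightarrow> real \<Rightarrow> complex" where
  "gauss_bump a \<sigma> = of_real (exp (- (\<sigma> - a)\<^sup>2 / 2) / sqrt (2 * pi))"

lemma schwartz_gauss_bump: "schwartz (gauss_bump a)"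
proof -
  have "gauss_bump a \<sigma> = of_real (exp (- a\<^sup>2 / 2) / sqrt (2 * pi)) * exp_gauss (of_real a) \<sigma>" for \<sigma>
  proof -
    have "exp (- (\<sigma> - a)\<^sup>2 / 2) = exp (- a\<^sup>2 / 2) * exp (- \<sigma>\<^sup>2 / 2 + a * \<sigma>)"
      by (simp add: exp_add[symmetric] power2_eq_square algebra_simps add_divide_distrib diff_divide_distrib)
    moreover have "exp_gauss (of_real a) \<sigma> = of_real (exp (- \<sigma>\<^sup>2 / 2 + a * \<sigma>))"
      by (simp add: exp_gauss_def exp_of_real[symmetric])
    ultimately show ?thesis by (simp add: gauss_bump_def)
  qed
  then have eq: "gauss_bump a = (\<lambda>\<sigma>. of_real (exp (- a\<^sup>2 / 2) / sqrt (2 * pi)) * exp_gauss (of_real a) \<sigma>)"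
    by (rule ext)
  show ?thesis unfolding eq by (rule schwartz_cmult[OF schwartz_exp_gauss])
qed

lemma fourier_gauss_bump: "fourier (gauss_bump a) t = of_real (exp (- t\<^sup>2 / 2)) * cis (- a * t)"
proof -
  have "fourier (gauss_bump a) t = (LINT \<sigma>|lborel. gauss_bump a \<sigma> * cis (- \<sigma> * t))"
    by (simp add: fourier_def)
  also have "\<dots> = \<bar>1\<bar> *\<^sub>R (LINT x|lborel. gauss_bump a (a + 1 * x) * cis (- (a + 1 * x) * t))"
    by (rule lborel_integral_real_affine) simp
  also have "\<dots> = (LINT x|lborel. (of_real (1 / sqrt (2 * pi)) * cis (- a * t)) * (of_real (exp (- (1 * x)\<^sup>2 / 2)) * cis (- t * x)))"
  proof -
    have "cis (- (a + x) * t) = cis (- a * t) * cis (- t * x)" for x by (simp add: cis_mult algebra_simps)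
    then show ?thesis by (simp add: gauss_bump_def mult_ac)
  qed
  also have "\<dots> = (of_real (1 / sqrt (2 * pi)) * cis (- a * t)) * of_real (sqrt (2 * pi) / 1 * exp (- (- t / 1)\<^sup>2 / 2))"
    unfolding integral_mult_right_zero by (subst fourier_gaussian) simp_all
  also have "\<dots> = of_real (exp (- t\<^sup>2 / 2)) * cis (- a * t)" by simp
  finally show ?thesis .
qed

text \<open>Regard h as a function on \<open>RT2\<close> that is constant in x. Its pairing with a
  character splits into the vanishing time integral and an integral over the cell, so the result on
  \<open>RT2\<close> applies.\<close>

lemma fourier_unique_real:
  assumes h: "integrable lborel h" and zero: "\<And>a. (LINT t|lborel. h t * cis (a * t)) = 0"
  shows "AE t in lborel. h t = 0"
proof -
  have [measurable]: "h \<in> borel_measurable borel" using h by auto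
  have hm: "(\<lambda>p::real \<times> (real^2). h (fst p) * cis (a * fst p + lat k \<bullet> snd p)) \<in> borel_measurable borel" for a k
    unfolding borel_prod[symmetric] by measurable
  have hm0: "(\<lambda>p::real \<times> (real^2). h (fst p)) \<in> borel_measurable borel"
    unfolding borel_prod[symmetric] by measurable
  have "annihilating (\<lambda>p. h (fst p))"
    unfolding annihilating_def
  proof (intro conjI allI)
    show "integrable RT2 (\<lambda>p. h (fst p))" by (rule integrable_RT2_of_time[OF h hm0]) simp
    fix a k
    have "integrable RT2 (\<lambda>p. h (fst p) * cis (a * fst p + lat k \<bullet> snd p))"
      by (rule integrable_RT2_of_time[OF h hm]) (simp add: norm_mult)
    then have "(LINT p|RT2. h (fst p) * cis (a * fst p + lat k \<bullet> snd p)) =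
        (LINT t|lborel. (LINT x|lborel. indicator cell x * (h t * cis (a * t + lat k \<bullet> x))))"
      by (subst integral_RT2[OF hm]) simp_all
    also have "\<dots> = (LINT t|lborel. (h t * cis (a * t)) * (LINT x|lborel. indicator cell x * cis (lat k \<bullet> x)))"
    proof -
      have eq: "indicator cell x * (h t * cis (a * t + lat k \<bullet> x)) = (h t * cis (a * t)) * (indicator cell x * cis (lat k \<bullet> x))" for t x
        by (simp add: cis_mult[symmetric])
      show ?thesis by (simp only: eq integral_mult_right_zero)
    qed
    also have "\<dots> = 0" unfolding integral_mult_left_zero zero by simp
    finally show "(LINT p|RT2. h (fst p) * cis (a * fst p + lat k \<bullet> snd p)) = 0" .
  qed
  then have "AE p in RT2. h (fst p) = 0" by (rule annihilating_AE_0)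
  then have "(\<integral>\<^sup>+p. ennreal (norm (h (fst p))) \<partial>RT2) = 0"
    by (subst nn_integral_cong_AE[of _ "\<lambda>_. 0"]) auto
  moreover have "(\<integral>\<^sup>+p. ennreal (norm (h (fst p))) \<partial>RT2) =
      (\<integral>\<^sup>+t. ennreal (norm (h t)) \<partial>lborel) * ennreal ((2 * pi)\<^sup>2)"
    using hm0 by (subst nn_integral_RT2) (auto simp: nn_integral_cmult emeasure_cell nn_integral_multc)
  ultimately have "(\<integral>\<^sup>+t. ennreal (norm (h t)) \<partial>lborel) = 0" by simp
  then show ?thesis by (subst (asm) nn_integral_0_iff_AE) auto
qed

lemma has_st_fourierD:
  assumes "has_st_fourier u v" "schwartz \<phi>"
  shows "integrable lborel (\<lambda>\<sigma>. v \<sigma> k * \<phi> \<sigma>)"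
    and "(LINT p|RT2. u p * (fourier \<phi> (fst p) * cis (- (lat k \<bullet> snd p)))) = (LINT \<sigma>|lborel. v \<sigma> k * \<phi> \<sigma>)"
  using assms unfolding has_st_fourier_def by simp_all

text \<open>The difference of two transforms need not be integrable, but becomes so after
  multiplication by a Gaussian. Characters times this Gaussian are still Schwartz, so all Fourier
  integrals of the product vanish.\<close>

lemma has_st_fourier_unique:
  assumes "has_st_fourier u v" "has_st_fourier u w"
  shows "AE \<sigma> in lborel. v \<sigma> k = w \<sigma> k"
proof -
  define h where "h \<sigma> = (v \<sigma> k - w \<sigma> k) * exp_gauss 0 \<sigma>" for \<sigma>
  have I: "integrable lborel (\<lambda>\<sigma>. v \<sigma> k * \<phi> \<sigma>)" "integrable lborel (\<lambda>\<sigma>. w \<sigma> k * \<phi> \<sigma>)"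
    "(LINT \<sigma>|lborel. v \<sigma> k * \<phi> \<sigma>) = (LINT \<sigma>|lborel. w \<sigma> k * \<phi> \<sigma>)" if "schwartz \<phi>" for \<phi>
    using has_st_fourierD[OF assms(1) that, of k] has_st_fourierD[OF assms(2) that, of k] by simp_all
  have h: "integrable lborel h"
    unfolding h_def left_diff_distrib by (intro Bochner_Integration.integrable_diff I schwartz_exp_gauss)
  have "(LINT \<sigma>|lborel. h \<sigma> * cis (a * \<sigma>)) = 0" for a
  proof -
    have eg: "exp_gauss 0 \<sigma> * cis (a * \<sigma>) = exp_gauss (\<i> * of_real a) \<sigma>" for \<sigma>
      by (simp add: exp_gauss_def cis_conv_exp exp_add[symmetric] mult.assoc)
    have "(LINT \<sigma>|lborel. h \<sigma> * cis (a * \<sigma>)) =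
        (LINT \<sigma>|lborel. v \<sigma> k * exp_gauss (\<i> * of_real a) \<sigma> - w \<sigma> k * exp_gauss (\<i> * of_real a) \<sigma>)"
      unfolding h_def mult.assoc eg left_diff_distrib ..
    also have "\<dots> = 0"
      using I[OF schwartz_exp_gauss[of "\<i> * of_real a"]] by simp
    finally show ?thesis .
  qed
  from fourier_unique_real[OF h this] show ?thesis
    by eventually_elim (simp add: h_def exp_gauss_def)
qed

lemma weighted_sq_cong:
  assumes "\<And>k. AE \<sigma> in lborel. v \<sigma> k = w \<sigma> k"
  shows "weighted_sq s b v = weighted_sq s b w"
  unfolding weighted_sq_def
proof (rule nn_integral_cong)
  fix k
  show "(\<integral>\<^sup>+ \<sigma>. ennreal ((japanese (lat k) powr s * japanese (\<sigma> + (norm (lat k))\<^sup>2) powr b * cmod (v \<sigma> k))\<^sup>2) \<partial>lborel) =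
      (\<integral>\<^sup>+ \<sigma>. ennreal ((japanese (lat k) powr s * japanese (\<sigma> + (norm (lat k))\<^sup>2) powr b * cmod (w \<sigma> k))\<^sup>2) \<partial>lborel)"
    by (rule nn_integral_cong_AE, use assms[of k] in eventually_elim) simp
qed

text \<open>Replaces the arbitrary choice in \<open>Xnorm\<close> by any transform at hand.\<close>

lemma Xnorm_eq:
  assumes "has_st_fourier u v"
  shows "Xnorm s b u = sqrt (enn2real (weighted_sq s b v))"
proof -
  have "has_st_fourier u (SOME v. has_st_fourier u v)" using assms by (rule someI[of "has_st_fourier u"])
  then have "weighted_sq s b (SOME v. has_st_fourier u v) = weighted_sq s b v"
    by (intro weighted_sq_cong has_st_fourier_unique[OF _ assms])
  then show ?thesis unfolding Xnorm_def by (rule arg_cong)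
qed

text \<open>The transform of \<open>synth K V\<close> is (2 pi)^3 V, here in the tested form in
  which it will be compared with the transform of u.\<close>

lemma synth_gauss_bump:
  assumes V: "nice K V"
  shows "integrable RT2 (\<lambda>p. synth K V p * (of_real (exp (- (fst p)\<^sup>2 / 2)) * cis (- a * fst p - lat k \<bullet> snd p)))"
    and "(LINT p|RT2. synth K V p * (of_real (exp (- (fst p)\<^sup>2 / 2)) * cis (- a * fst p - lat k \<bullet> snd p))) =
      of_real ((2 * pi) ^ 3) * (LINT \<sigma>|lborel. V \<sigma> k * gauss_bump a \<sigma>)"
proof -
  note [measurable] = borel_measurable_synth[OF V] nice_measurable[OF V]
  define g where "g l t = (LINT \<sigma>|lborel. V \<sigma> l * cis (\<sigma> * t))" for l t
  have gm [measurable]: "g l \<in> borel_measurable borel" for l unfolding g_def by measurable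
  define B where "B = (\<Sum>l\<in>K. LINT \<sigma>|lborel. norm (V \<sigma> l))"
  have B0: "B \<ge> 0" by (simp add: B_def sum_nonneg)
  have sB: "norm (synth K V p) \<le> B" for p
  proof -
    have "norm (synth K V p) \<le> (\<Sum>l\<in>K. norm ((LINT \<sigma>|lborel. V \<sigma> l * cis (\<sigma> * fst p)) * cis (lat l \<bullet> snd p)))"
      unfolding synth_def by (rule norm_sum)
    also have "\<dots> \<le> B"
      unfolding B_def
    proof (intro sum_mono)
      fix l
      have "norm (LINT \<sigma>|lborel. V \<sigma> l * cis (\<sigma> * fst p)) \<le> (LINT \<sigma>|lborel. norm (V \<sigma> l * cis (\<sigma> * fst p)))"
        by (rule integral_norm_bound)
      then show "norm ((LINT \<sigma>|lborel. V \<sigma> l * cis (\<sigma> * fst p)) * cis (lat l \<bullet> snd p)) \<le> (LINT \<sigma>|lborel. norm (V \<sigma> l))"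
        by (simp add: norm_mult)
    qed
    finally show ?thesis .
  qed
  define F where "F p = synth K V p * (of_real (exp (- (fst p)\<^sup>2 / 2)) * cis (- a * fst p - lat k \<bullet> snd p))" for p
  have Fm: "F \<in> borel_measurable borel"
    using borel_measurable_synth[OF V] unfolding F_def borel_prod[symmetric] by measurable
  have gI: "integrable lborel (\<lambda>t. complex_of_real (exp (- (1 * t)\<^sup>2 / 2)) * cis (- a * t))"
    by (rule integrable_gaussian_complex) auto
  have BI: "integrable lborel (\<lambda>t. complex_of_real B * complex_of_real (exp (- (1 * t)\<^sup>2 / 2)))"
    using integrable_gaussian_complex[of 1 "\<lambda>_. 0"] by simp
  have FI: "integrable RT2 F"
  proof (rule integrable_RT2_of_time[OF BI Fm])
    fix p :: "real \<times> (real^2)"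
    show "norm (F p) \<le> norm (complex_of_real B * complex_of_real (exp (- (1 * fst p)\<^sup>2 / 2)))"
      using sB[of p] B0 by (simp add: F_def norm_mult mult_right_mono)
  qed
  then show "integrable RT2 (\<lambda>p. synth K V p * (of_real (exp (- (fst p)\<^sup>2 / 2)) * cis (- a * fst p - lat k \<bullet> snd p)))"
    by (simp add: F_def[abs_def])
  have inner: "(LINT x|lborel. indicator cell x * F (t, x)) =
      (2 * of_real pi)\<^sup>2 * (g k t * (of_real (exp (- (1 * t)\<^sup>2 / 2)) * cis (- a * t)))" for t
  proof -
    define e where "e = complex_of_real (exp (- (1 * t)\<^sup>2 / 2)) * cis (- a * t)"
    have "indicator cell x * F (t, x) = (\<Sum>l\<in>K. (g l t * e) * (indicator cell x * cis (lat (l - k) \<bullet> x)))" for x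
    proof -
      have "cis (- a * t - lat k \<bullet> x) = cis (- a * t) * cis (- (lat k \<bullet> x))" by (simp add: cis_mult)
      moreover have "cis (lat (l - k) \<bullet> x) = cis (lat l \<bullet> x) * cis (- (lat k \<bullet> x))" for l
        by (simp add: cis_mult lat_diff inner_diff_left)
      ultimately show ?thesis
        by (simp add: F_def synth_def g_def e_def sum_distrib_left sum_distrib_right mult_ac)
    qed
    then have "(LINT x|lborel. indicator cell x * F (t, x)) =
        (LINT x|lborel. (\<Sum>l\<in>K. (g l t * e) * (indicator cell x * cis (lat (l - k) \<bullet> x))))" by simp
    also have "\<dots> = (\<Sum>l\<in>K. (LINT x|lborel. (g l t * e) * (indicator cell x * cis (lat (l - k) \<bullet> x))))"
    proof (rule Bochner_Integration.integral_sum)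
      fix l
      have "integrable lborel (\<lambda>x. indicator cell x * cis (lat (l - k) \<bullet> x))"
        by (rule integrable_cell_bounded[of _ 1]) auto
      then show "integrable lborel (\<lambda>x. (g l t * e) * (indicator cell x * cis (lat (l - k) \<bullet> x)))"
        by (rule integrable_mult_right)
    qed
    also have "\<dots> = (\<Sum>l\<in>K. if l = k then (g k t * e) * (2 * of_real pi)\<^sup>2 else 0)"
      unfolding integral_mult_right_zero integral_cell_character by (intro sum.cong refl) auto
    also have "\<dots> = (g k t * e) * (2 * of_real pi)\<^sup>2"
    proof (cases "k \<in> K")
      case True
      then show ?thesis using niceD(1)[OF V] by simp
    next
      case False
      then have "g k t = 0" using niceD(3)[OF V] by (simp add: g_def)
      then show ?thesis by (simp add: sum.neutral)
    qed
    finally show ?thesis by (simp add: e_def mult.commute)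
  qed
  have "(LINT p|RT2. F p) = (LINT t|lborel. (2 * of_real pi)\<^sup>2 * (g k t * (of_real (exp (- (1 * t)\<^sup>2 / 2)) * cis (- a * t))))"
    unfolding integral_RT2[OF Fm FI] inner ..
  also have "\<dots> = (2 * of_real pi)\<^sup>2 * (LINT t|lborel. (LINT \<sigma>|lborel. V \<sigma> k * cis (\<sigma> * t)) * (of_real (exp (- (1 * t)\<^sup>2 / 2)) * cis (- a * t)))"
    unfolding g_def by (rule integral_mult_right_zero)
  also have "(LINT t|lborel. (LINT \<sigma>|lborel. V \<sigma> k * cis (\<sigma> * t)) * (of_real (exp (- (1 * t)\<^sup>2 / 2)) * cis (- a * t))) =
      (LINT \<sigma>|lborel. V \<sigma> k * (LINT t|lborel. of_real (exp (- (1 * t)\<^sup>2 / 2)) * cis (- a * t) * cis (\<sigma> * t)))"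
    by (rule fourier_multiplication_formula[OF lborel.sigma_finite_measure_axioms niceD(2)[OF V] gI]) auto
  also have "\<dots> = (LINT \<sigma>|lborel. V \<sigma> k * (of_real (2 * pi) * gauss_bump a \<sigma>))"
  proof -
    have eq: "of_real (exp (- (1 * t)\<^sup>2 / 2)) * cis (- a * t) * cis (\<sigma> * t) =
        of_real (exp (- (1 * t)\<^sup>2 / 2)) * cis ((\<sigma> - a) * t)" for \<sigma> t
      unfolding mult.assoc cis_mult by (simp add: algebra_simps)
    have "of_real (sqrt (2 * pi) / 1 * exp (- ((\<sigma> - a) / 1)\<^sup>2 / 2)) = of_real (2 * pi) * gauss_bump a \<sigma>" for \<sigma>
    proof -
      have "2 * pi / sqrt (2 * pi) = sqrt (2 * pi)" by (rule real_div_sqrt) simp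
      then have "sqrt (2 * pi) * E = 2 * pi * (E / sqrt (2 * pi))" for E
        by (metis times_divide_eq_left times_divide_eq_right)
      then show ?thesis unfolding gauss_bump_def of_real_mult[symmetric] div_by_1 by (rule arg_cong)
    qed
    then show ?thesis unfolding eq fourier_gaussian[OF zero_less_one] by simp
  qed
  also have "\<dots> = of_real (2 * pi) * (LINT \<sigma>|lborel. V \<sigma> k * gauss_bump a \<sigma>)"
  proof -
    have eq: "V \<sigma> k * (of_real (2 * pi) * gauss_bump a \<sigma>) = of_real (2 * pi) * (V \<sigma> k * gauss_bump a \<sigma>)" for \<sigma>
      by (rule mult.left_commute)
    show ?thesis unfolding eq by (rule integral_mult_right_zero)
  qed
  finally show "(LINT p|RT2. synth K V p * (of_real (exp (- (fst p)\<^sup>2 / 2)) * cis (- a * fst p - lat k \<bullet> snd p))) =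
      of_real ((2 * pi) ^ 3) * (LINT \<sigma>|lborel. V \<sigma> k * gauss_bump a \<sigma>)"
    unfolding F_def by (simp add: power3_eq_cube power2_eq_square mult.assoc)
qed

section \<open>Approximation by truncated transforms\<close>

text \<open>The input of Fatou's lemma: almost everywhere convergence of syntheses with one norm
  bound along the whole sequence.\<close>

definition approximable :: "real \<Rightarrow> real \<Rightarrow> (real \<times> (real ^ 2) \<Rightarrow> complex) \<Rightarrow> ennreal \<Rightarrow> bool" where
  "approximable s b u B \<longleftrightarrow> (\<exists>K V. (\<forall>n. nice (K n) (V n) \<and> weighted_sq s b (V n) \<le> B) \<and>
     (AE p in RT2. (\<lambda>n::nat. synth (K n) (V n) p) \<longlonglongrightarrow> u p))"

lemma synth_support_mono:
  assumes V: "nice K V" and L: "K \<subseteq> L" "finite L"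
  shows "nice L V" "synth L V = synth K V"
proof -
  show "nice L V" using V L by (auto simp: nice_def)
  show "synth L V = synth K V"
  proof
    fix p
    show "synth L V p = synth K V p"
      unfolding synth_def
      by (rule sum.mono_neutral_right[OF L(2,1)]) (use niceD(3)[OF V] in auto)
  qed
qed

lemma synth_diff:
  assumes V: "nice K V" and W: "nice K W"
  shows "nice K (\<lambda>\<sigma> k. V \<sigma> k - W \<sigma> k)"
    and "synth K (\<lambda>\<sigma> k. V \<sigma> k - W \<sigma> k) p = synth K V p - synth K W p"
proof -
  show "nice K (\<lambda>\<sigma> k. V \<sigma> k - W \<sigma> k)" using V W by (auto simp: nice_def)
  have int: "integrable lborel (\<lambda>\<sigma>. X \<sigma> k * cis (\<sigma> * fst p))" if "nice K X" for X k
    by (rule integrable_mult_bounded[OF niceD(2)[OF that]]) auto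
  have "(LINT \<sigma>|lborel. (V \<sigma> k - W \<sigma> k) * cis (\<sigma> * fst p)) =
      (LINT \<sigma>|lborel. V \<sigma> k * cis (\<sigma> * fst p)) - (LINT \<sigma>|lborel. W \<sigma> k * cis (\<sigma> * fst p))" for k
    unfolding left_diff_distrib by (rule Bochner_Integration.integral_diff[OF int[OF V] int[OF W]])
  then show "synth K (\<lambda>\<sigma> k. V \<sigma> k - W \<sigma> k) p = synth K V p - synth K W p"
    by (simp add: synth_def left_diff_distrib sum_subtractf)
qed

lemma mode_sq_0_0: "mode_sq 0 0 V k = (\<integral>\<^sup>+\<sigma>. ennreal ((cmod (V \<sigma> k))\<^sup>2) \<partial>lborel)"
  by (simp add: mode_sq_def)

lemma synth_bessel_weighted:
  assumes V: "nice K V"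
  shows "(\<integral>\<^sup>+p. ennreal ((cmod (synth K V p))\<^sup>2) \<partial>RT2) \<le> ennreal ((2 * pi) ^ 3) * weighted_sq 0 0 V"
proof -
  have "(\<integral>\<^sup>+p. ennreal ((cmod (synth K V p))\<^sup>2) \<partial>RT2) \<le> ennreal ((2 * pi) ^ 3) * (\<Sum>k\<in>K. mode_sq 0 0 V k)"
    unfolding mode_sq_0_0 by (rule synth_bessel[OF V])
  also have "\<dots> \<le> ennreal ((2 * pi) ^ 3) * weighted_sq 0 0 V"
    by (intro mult_left_mono sum_mode_sq_le niceD(1)[OF V]) auto
  finally show ?thesis .
qed

lemma weighted_sq_mono:
  assumes "\<And>\<sigma> k. cmod (v \<sigma> k) \<le> cmod (w \<sigma> k)"
  shows "weighted_sq s b v \<le> weighted_sq s b w"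
  unfolding weighted_sq_def
  by (intro nn_integral_mono ennreal_leI power_mono mult_left_mono assms) auto

lemma weighted_sq_0_0_le:
  assumes "s \<ge> 0" "b \<ge> 0"
  shows "weighted_sq 0 0 v \<le> weighted_sq s b v"
  unfolding weighted_sq_def
proof (intro nn_integral_mono ennreal_leI power_mono mult_right_mono)
  fix \<sigma> k
  have "1 \<le> japanese (lat k) powr s" "1 \<le> japanese (\<sigma> + (norm (lat k))\<^sup>2) powr b"
    using assms by (auto intro!: ge_one_powr_ge_zero japanese_ge_1)
  then have "1 * 1 \<le> japanese (lat k) powr s * japanese (\<sigma> + (norm (lat k))\<^sup>2) powr b"
    by (intro mult_mono) auto
  then show "japanese (lat k) powr 0 * japanese (\<sigma> + (norm (lat k))\<^sup>2) powr 0 \<le>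
      japanese (lat k) powr s * japanese (\<sigma> + (norm (lat k))\<^sup>2) powr b" by simp
qed auto

lemma measurable_mode_pair:
  assumes "\<And>k :: int ^ 2. (\<lambda>\<sigma>. f k \<sigma>) \<in> borel_measurable borel"
  shows "(\<lambda>z. f (fst z) (snd z)) \<in> borel_measurable (count_space UNIV \<Otimes>\<^sub>M (lborel :: real measure))"
  by (rule measurable_pair_measure_countable1) (use assms in auto)

lemma nn_integral_mode_pair:
  fixes f :: "int ^ 2 \<Rightarrow> real \<Rightarrow> ennreal"
  assumes "\<And>k. f k \<in> borel_measurable borel"
  shows "(\<integral>\<^sup>+k. (\<integral>\<^sup>+\<sigma>. f k \<sigma> \<partial>lborel) \<partial>count_space UNIV) =
    (\<integral>\<^sup>+z. f (fst z) (snd z) \<partial>(count_space UNIV \<Otimes>\<^sub>M lborel))"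
  using lborel.nn_integral_fst[OF measurable_mode_pair[of f, OF assms]] by simp

section \<open>Truncation of transforms\<close>

definition lattice_box :: "nat \<Rightarrow> (int ^ 2) set" where
  "lattice_box n = {k. \<bar>k $ 1\<bar> \<le> int n \<and> \<bar>k $ 2\<bar> \<le> int n}"

lemma finite_lattice_box: "finite (lattice_box n)"
proof -
  have "(\<lambda>k. (k $ 1, k $ 2)) ` lattice_box n \<subseteq> {- int n..int n} \<times> {- int n..int n}"
    by (auto simp: lattice_box_def)
  then have "finite ((\<lambda>k. (k $ 1, k $ 2)) ` lattice_box n)" by (rule finite_subset) simp
  moreover have "inj_on (\<lambda>k::int^2. (k $ 1, k $ 2)) (lattice_box n)"
    by (auto simp: inj_on_def vec_eq_iff forall_2)
  ultimately show ?thesis by (rule finite_imageD)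
qed

lemma lattice_box_mono: "m \<le> n \<Longrightarrow> lattice_box m \<subseteq> lattice_box n"
  by (auto simp: lattice_box_def)

lemma eventually_in_lattice_box: "\<forall>\<^sub>F n in sequentially. k \<in> lattice_box n"
  unfolding eventually_sequentially
proof (intro exI allI impI)
  fix n assume "nat (\<bar>k $ 1\<bar> + \<bar>k $ 2\<bar>) \<le> n"
  then show "k \<in> lattice_box n" by (auto simp: lattice_box_def)
qed

text \<open>Cutting the values as well as k and sigma gives a bounded function of bounded support,
  hence an integrable one for every measurable transform.\<close>

definition trunc :: "nat \<Rightarrow> (real \<Rightarrow> int ^ 2 \<Rightarrow> complex) \<Rightarrow> real \<Rightarrow> int ^ 2 \<Rightarrow> complex" where
  "trunc n v \<sigma> k = (if k \<in> lattice_box n \<and> \<bar>\<sigma>\<bar> \<le> real n \<and> cmod (v \<sigma> k) \<le> real n then v \<sigma> k else 0)"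

lemma norm_trunc_le: "cmod (trunc n v \<sigma> k) \<le> cmod (v \<sigma> k)"
  by (simp add: trunc_def)

lemma eventually_trunc: "\<forall>\<^sub>F n in sequentially. trunc n v \<sigma> k = v \<sigma> k"
proof -
  have "\<forall>\<^sub>F n in sequentially. \<bar>\<sigma>\<bar> + cmod (v \<sigma> k) \<le> real n"
    using filterlim_real_sequentially by (simp add: filterlim_at_top)
  with eventually_in_lattice_box[of k] show ?thesis
  proof eventually_elim
    case (elim n)
    then have "\<bar>\<sigma>\<bar> \<le> real n" "cmod (v \<sigma> k) \<le> real n"
      using norm_ge_zero[of "v \<sigma> k"] abs_ge_zero[of \<sigma>] by linarith+
    then show ?case using elim(1) by (simp add: trunc_def)
  qed
qed

lemma trunc_measurable:
  assumes [measurable]: "(\<lambda>\<sigma>. v \<sigma> k) \<in> borel_measurable borel"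
  shows "(\<lambda>\<sigma>. trunc n v \<sigma> k) \<in> borel_measurable borel"
  unfolding trunc_def by measurable

lemma nice_trunc:
  assumes m: "\<And>k. (\<lambda>\<sigma>. v \<sigma> k) \<in> borel_measurable borel"
  shows "nice (lattice_box n) (trunc n v)"
  unfolding nice_def
proof (intro conjI allI impI)
  show "finite (lattice_box n)" by (rule finite_lattice_box)
  show "integrable lborel (\<lambda>\<sigma>. trunc n v \<sigma> k)" for k
  proof (rule Bochner_Integration.integrable_bound)
    show "integrable lborel (\<lambda>\<sigma>. real n * indicator {- real n..real n} \<sigma> :: real)"
      by (intro integrable_mult_right) (auto intro!: integrable_real_indicator)
    show "(\<lambda>\<sigma>. trunc n v \<sigma> k) \<in> borel_measurable lborel"
      using trunc_measurable[OF m] by simp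
  qed (auto simp: trunc_def indicator_def)
qed (simp add: trunc_def)

lemma weighted_sq_trunc_tendsto:
  assumes m: "\<And>k. (\<lambda>\<sigma>. v \<sigma> k) \<in> borel_measurable borel" and fin: "weighted_sq 0 0 v < \<infinity>"
  shows "(\<lambda>n. weighted_sq 0 0 (\<lambda>\<sigma> k. v \<sigma> k - trunc n v \<sigma> k)) \<longlonglongrightarrow> 0"
proof -
  let ?N = "count_space (UNIV :: (int ^ 2) set) \<Otimes>\<^sub>M (lborel :: real measure)"
  have pair: "weighted_sq 0 0 w = (\<integral>\<^sup>+z. ennreal ((cmod (w (snd z) (fst z)))\<^sup>2) \<partial>?N)"
    if [measurable]: "\<And>k. (\<lambda>\<sigma>. w \<sigma> k) \<in> borel_measurable borel" for w
    unfolding weighted_sq_eq mode_sq_0_0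
    by (rule nn_integral_mode_pair[of "\<lambda>k \<sigma>. ennreal ((cmod (w \<sigma> k))\<^sup>2)"]) measurable
  note [measurable] = m trunc_measurable[OF m]
  have dm [measurable]: "(\<lambda>\<sigma>. v \<sigma> k - trunc n v \<sigma> k) \<in> borel_measurable borel" for k n by measurable
  have "(\<lambda>n. \<integral>\<^sup>+z. ennreal ((cmod (v (snd z) (fst z) - trunc n v (snd z) (fst z)))\<^sup>2) \<partial>?N) \<longlonglongrightarrow> (\<integral>\<^sup>+z. 0 \<partial>?N)"
  proof (rule nn_integral_dominated_convergence)
    show "(\<lambda>z. ennreal ((cmod (v (snd z) (fst z) - trunc n v (snd z) (fst z)))\<^sup>2)) \<in> borel_measurable ?N" for n
      by (rule measurable_mode_pair[of "\<lambda>k \<sigma>. ennreal ((cmod (v \<sigma> k - trunc n v \<sigma> k))\<^sup>2)"]) measurable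
    show "(\<lambda>z. ennreal ((cmod (v (snd z) (fst z)))\<^sup>2)) \<in> borel_measurable ?N"
      by (rule measurable_mode_pair[of "\<lambda>k \<sigma>. ennreal ((cmod (v \<sigma> k))\<^sup>2)"]) measurable
    show "AE z in ?N. ennreal ((cmod (v (snd z) (fst z) - trunc n v (snd z) (fst z)))\<^sup>2) \<le> ennreal ((cmod (v (snd z) (fst z)))\<^sup>2)" for n
      by (auto simp: trunc_def)
    show "(\<integral>\<^sup>+z. ennreal ((cmod (v (snd z) (fst z)))\<^sup>2) \<partial>?N) < \<infinity>"
      using fin unfolding pair[OF m] .
    show "AE z in ?N. (\<lambda>n. ennreal ((cmod (v (snd z) (fst z) - trunc n v (snd z) (fst z)))\<^sup>2)) \<longlonglongrightarrow> 0"
    proof (rule AE_I2)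
      fix z
      have "\<forall>\<^sub>F n in sequentially. ennreal ((cmod (v (snd z) (fst z) - trunc n v (snd z) (fst z)))\<^sup>2) = 0"
        using eventually_trunc[of v "snd z" "fst z"] by eventually_elim simp
      then show "(\<lambda>n. ennreal ((cmod (v (snd z) (fst z) - trunc n v (snd z) (fst z)))\<^sup>2)) \<longlonglongrightarrow> 0"
        by (rule tendsto_eventually)
    qed
  qed auto
  then show ?thesis unfolding pair[OF dm] by simp
qed

section \<open>Limits of the truncated syntheses\<close>

text \<open>The Riesz-Fischer argument: with geometric decay the telescoping series converges
  absolutely almost everywhere and in L1. The convergence of pairings with bounded functions is what
  later identifies the limit.\<close>

lemma L1_fast_cauchy:
  fixes F :: "nat \<Rightarrow> 'a \<Rightarrow> complex"
  assumes F: "\<And>j. integrable M (F j)" and C: "C \<ge> 0"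
    and fast: "\<And>j. (\<integral>\<^sup>+x. ennreal (norm (F (Suc j) x - F j x)) \<partial>M) \<le> ennreal (C * (1 / 2) ^ j)"
  obtains G where "integrable M G" "AE x in M. (\<lambda>j. F j x) \<longlonglongrightarrow> G x"
    "\<And>\<eta>. \<eta> \<in> borel_measurable M \<Longrightarrow> (\<And>x. norm (\<eta> x) \<le> 1) \<Longrightarrow>
      (\<lambda>j. LINT x|M. F j x * \<eta> x) \<longlonglongrightarrow> (LINT x|M. G x * \<eta> x)"
proof -
  define f where "f j x = F (Suc j) x - F j x" for j x
  have fI: "integrable M (f j)" for j unfolding f_def using F by simp
  have [measurable]: "f j \<in> borel_measurable M" for j using fI by auto
  have geo: "summable (\<lambda>j. C * (1 / 2) ^ j :: real)" by (intro summable_mult summable_geometric) simp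
  have le: "(LINT x|M. norm (f j x)) \<le> C * (1 / 2) ^ j" for j
  proof -
    have "ennreal (LINT x|M. norm (f j x)) = (\<integral>\<^sup>+x. ennreal (norm (f j x)) \<partial>M)"
      using fI by (intro nn_integral_eq_integral[symmetric]) auto
    also have "\<dots> \<le> ennreal (C * (1 / 2) ^ j)" unfolding f_def by (rule fast)
    finally show ?thesis using C by (simp add: ennreal_le_iff)
  qed
  have sumI: "summable (\<lambda>j. LINT x|M. norm (f j x))"
    by (rule summable_comparison_test'[OF geo, of 0]) (use le in simp)
  have ae: "AE x in M. summable (\<lambda>j. norm (f j x))"
  proof -
    have "(\<integral>\<^sup>+x. (\<Sum>j. ennreal (norm (f j x))) \<partial>M) = (\<Sum>j. \<integral>\<^sup>+x. ennreal (norm (f j x)) \<partial>M)"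
      by (rule nn_integral_suminf) measurable
    also have "\<dots> \<le> (\<Sum>j. ennreal (C * (1 / 2) ^ j))"
      unfolding f_def by (intro suminf_le fast summableI)
    also have "\<dots> < \<infinity>"
      using geo C by (subst suminf_ennreal2) auto
    finally have "(\<integral>\<^sup>+x. (\<Sum>j. ennreal (norm (f j x))) \<partial>M) \<noteq> \<infinity>" by simp
    then have "AE x in M. (\<Sum>j. ennreal (norm (f j x))) \<noteq> \<infinity>"
      by (intro nn_integral_noteq_infinite) measurable
    then show ?thesis by eventually_elim (auto intro: summable_suminf_not_top)
  qed
  define G where "G x = F 0 x + (\<Sum>j. f j x)" for x
  have tele: "F n x = F 0 x + (\<Sum>j<n. f j x)" for n x
    unfolding f_def by (subst sum_lessThan_telescope) simp
  show ?thesis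
  proof (rule that)
    show GI: "integrable M G"
      unfolding G_def[abs_def] by (intro Bochner_Integration.integrable_add F integrable_suminf fI ae sumI)
    show "AE x in M. (\<lambda>j. F j x) \<longlonglongrightarrow> G x"
      using ae
    proof eventually_elim
      case (elim x)
      have "(\<lambda>n. \<Sum>j<n. f j x) \<longlonglongrightarrow> (\<Sum>j. f j x)"
        by (rule summable_LIMSEQ[OF summable_norm_cancel[OF elim]])
      then have "(\<lambda>n. F 0 x + (\<Sum>j<n. f j x)) \<longlonglongrightarrow> G x" unfolding G_def by (intro tendsto_intros)
      then show ?case by (simp only: tele[symmetric])
    qed
    fix \<eta> :: "'a \<Rightarrow> complex" assume \<eta> [measurable]: "\<eta> \<in> borel_measurable M" and \<eta>1: "\<And>x. norm (\<eta> x) \<le> 1"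
    have fc: "integrable M (\<lambda>x. f j x * \<eta> x)" for j by (rule integrable_mult_bounded[OF fI \<eta> \<eta>1])
    have nle: "norm (f j x * \<eta> x) \<le> norm (f j x)" for j x
      using \<eta>1[of x] by (simp add: norm_mult mult_left_le)
    have ae': "AE x in M. summable (\<lambda>j. norm (f j x * \<eta> x))"
      using ae
    proof eventually_elim
      case (elim x)
      show ?case by (rule summable_comparison_test'[OF elim, of 0]) (use nle in simp)
    qed
    have sumI': "summable (\<lambda>j. LINT x|M. norm (f j x * \<eta> x))"
    proof (rule summable_comparison_test'[OF sumI, of 0])
      fix j
      have "(LINT x|M. norm (f j x * \<eta> x)) \<le> (LINT x|M. norm (f j x))"
        using fc fI nle by (intro integral_mono) auto
      then show "norm (LINT x|M. norm (f j x * \<eta> x)) \<le> (LINT x|M. norm (f j x))" by simp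
    qed
    have "(\<lambda>j. LINT x|M. f j x * \<eta> x) sums (LINT x|M. (\<Sum>j. f j x * \<eta> x))"
      by (rule sums_integral[OF fc ae' sumI'])
    then have "(\<lambda>n. (LINT x|M. F 0 x * \<eta> x) + (\<Sum>j<n. LINT x|M. f j x * \<eta> x)) \<longlonglongrightarrow>
        (LINT x|M. F 0 x * \<eta> x) + (LINT x|M. (\<Sum>j. f j x * \<eta> x))"
      unfolding sums_def by (intro tendsto_intros)
    moreover have "(LINT x|M. F 0 x * \<eta> x) + (\<Sum>j<n. LINT x|M. f j x * \<eta> x) = (LINT x|M. F n x * \<eta> x)" for n
    proof -
      have "(LINT x|M. F n x * \<eta> x) = (LINT x|M. F 0 x * \<eta> x + (\<Sum>j<n. f j x * \<eta> x))"
        by (intro Bochner_Integration.integral_cong refl) (subst tele, simp add: distrib_right sum_distrib_right)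
      also have "\<dots> = (LINT x|M. F 0 x * \<eta> x) + (LINT x|M. (\<Sum>j<n. f j x * \<eta> x))"
        by (intro Bochner_Integration.integral_add Bochner_Integration.integrable_sum fc integrable_mult_bounded[OF F \<eta> \<eta>1])
      also have "(LINT x|M. (\<Sum>j<n. f j x * \<eta> x)) = (\<Sum>j<n. LINT x|M. f j x * \<eta> x)"
        by (rule Bochner_Integration.integral_sum) (rule fc)
      finally show ?thesis by simp
    qed
    moreover have "(LINT x|M. F 0 x * \<eta> x) + (LINT x|M. (\<Sum>j. f j x * \<eta> x)) = (LINT x|M. G x * \<eta> x)"
    proof -
      have "(LINT x|M. F 0 x * \<eta> x) + (LINT x|M. (\<Sum>j. f j x * \<eta> x)) = (LINT x|M. F 0 x * \<eta> x + (\<Sum>j. f j x * \<eta> x))"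
        by (intro Bochner_Integration.integral_add[symmetric] integrable_mult_bounded[OF F \<eta> \<eta>1] integrable_suminf fc ae' sumI')
      also have "\<dots> = (LINT x|M. G x * \<eta> x)"
      proof (rule integral_cong_AE)
        show "AE x in M. F 0 x * \<eta> x + (\<Sum>j. f j x * \<eta> x) = G x * \<eta> x"
          using ae by eventually_elim (simp add: G_def distrib_right suminf_mult2 summable_norm_cancel)
        show "(\<lambda>x. G x * \<eta> x) \<in> borel_measurable M" using borel_measurable_integrable[OF GI] by measurable
        show "(\<lambda>x. F 0 x * \<eta> x + (\<Sum>j. f j x * \<eta> x)) \<in> borel_measurable M"
          using borel_measurable_integrable[OF F[of 0]] by measurable
      qed
      finally show ?thesis .
    qed
    ultimately show "(\<lambda>j. LINT x|M. F j x * \<eta> x) \<longlonglongrightarrow> (LINT x|M. G x * \<eta> x)" by simp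
  qed
qed

text \<open>Differences of syntheses are small in L2 only. This weight makes them small in L1 and,
  being nowhere 0, can be divided out again.\<close>

definition time_gauss :: "real \<times> (real ^ 2) \<Rightarrow> real" where
  "time_gauss p = exp (- (fst p)\<^sup>2 / 2)"

lemma borel_measurable_time_gauss [measurable]: "time_gauss \<in> borel_measurable RT2"
  unfolding time_gauss_def by measurable

text \<open>The phase in \<open>annihilating\<close> has the opposite sign to the one in the
  transform, hence -k and -a.\<close>

lemma has_st_fourier_gauss:
  assumes u: "has_st_fourier u v"
  shows "integrable RT2 (\<lambda>p. u p * of_real (time_gauss p))"
    and "(LINT p|RT2. u p * of_real (time_gauss p) * cis (a * fst p + lat k \<bullet> snd p)) =
      (LINT \<sigma>|lborel. v \<sigma> (- k) * gauss_bump (- a) \<sigma>)"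
proof -
  have "exp_gauss 0 t = of_real (exp (- t\<^sup>2 / 2))" for t
    by (simp add: exp_gauss_def exp_of_real[symmetric])
  then have eg: "exp_gauss 0 (fst p) = of_real (time_gauss p)" for p :: "real \<times> (real ^ 2)"
    by (simp add: time_gauss_def)
  have "integrable RT2 (\<lambda>p. u p * exp_gauss 0 (fst p))"
    using u schwartz_exp_gauss[of 0] by (simp add: has_st_fourier_def)
  then show "integrable RT2 (\<lambda>p. u p * of_real (time_gauss p))" by (simp only: eg)
  have "fourier (gauss_bump (- a)) (fst p) * cis (- (lat (- k) \<bullet> snd p)) =
      of_real (time_gauss p) * cis (a * fst p + lat k \<bullet> snd p)" for p :: "real \<times> (real ^ 2)"
    unfolding fourier_gauss_bump lat_minus by (simp add: time_gauss_def mult.assoc cis_mult)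
  then show "(LINT p|RT2. u p * of_real (time_gauss p) * cis (a * fst p + lat k \<bullet> snd p)) =
      (LINT \<sigma>|lborel. v \<sigma> (- k) * gauss_bump (- a) \<sigma>)"
    using has_st_fourierD(2)[OF u schwartz_gauss_bump[of "- a"], of "- k"] by (simp add: mult.assoc)
qed

lemma synth_time_gauss:
  assumes V: "nice K V"
  shows "integrable RT2 (\<lambda>p. synth K V p * of_real (time_gauss p))"
    and "(LINT p|RT2. synth K V p * of_real (time_gauss p) * cis (a * fst p + lat k \<bullet> snd p)) =
      of_real ((2 * pi) ^ 3) * (LINT \<sigma>|lborel. V \<sigma> (- k) * gauss_bump (- a) \<sigma>)"
proof -
  show "integrable RT2 (\<lambda>p. synth K V p * of_real (time_gauss p))"
    using synth_gauss_bump(1)[OF V, of 0 0] by (simp add: lat_zero time_gauss_def)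
  show "(LINT p|RT2. synth K V p * of_real (time_gauss p) * cis (a * fst p + lat k \<bullet> snd p)) =
      of_real ((2 * pi) ^ 3) * (LINT \<sigma>|lborel. V \<sigma> (- k) * gauss_bump (- a) \<sigma>)"
    using synth_gauss_bump(2)[OF V, of "- a" "- k"] by (simp add: lat_minus time_gauss_def mult.assoc)
qed

lemma nn_integral_time_gauss_finite: "(\<integral>\<^sup>+p. ennreal ((time_gauss p)\<^sup>2) \<partial>RT2) < \<infinity>"
proof -
  have gI: "integrable lborel (\<lambda>t. complex_of_real (exp (- (1 * t)\<^sup>2 / 2)))"
    using integrable_gaussian_complex[of 1 "\<lambda>_. 0"] by simp
  have "integrable RT2 (\<lambda>p. complex_of_real ((time_gauss p)\<^sup>2))"
  proof (rule integrable_RT2_of_time[OF gI])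
    show "(\<lambda>p. complex_of_real ((time_gauss p)\<^sup>2)) \<in> borel_measurable borel"
      unfolding time_gauss_def by (intro borel_measurable_continuous_onI continuous_intros) auto
    fix p
    have "(time_gauss p)\<^sup>2 \<le> time_gauss p"
      unfolding power2_eq_square by (rule mult_left_le) (auto simp: time_gauss_def)
    then show "norm (complex_of_real ((time_gauss p)\<^sup>2)) \<le> norm (complex_of_real (exp (- (1 * fst p)\<^sup>2 / 2)))"
      by (simp add: time_gauss_def norm_power)
  qed
  then have "(\<integral>\<^sup>+p. ennreal (norm (complex_of_real ((time_gauss p)\<^sup>2))) \<partial>RT2) < \<infinity>"
    by (simp add: integrable_iff_bounded)
  then show ?thesis by (simp add: norm_power)
qed

text \<open>For m <= n, the difference of the two truncated transforms is at each point either 0 or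
  equal to v - \<open>trunc m v\<close>, so Bessel's inequality bounds it by the tail.\<close>

lemma trunc_differences_small:
  assumes m: "\<And>k. (\<lambda>\<sigma>. v \<sigma> k) \<in> borel_measurable borel" and mn: "m \<le> n"
  shows "(\<integral>\<^sup>+p. ennreal ((cmod (synth (lattice_box n) (trunc n v) p - synth (lattice_box m) (trunc m v) p))\<^sup>2) \<partial>RT2)
    \<le> ennreal ((2 * pi) ^ 3) * weighted_sq 0 0 (\<lambda>\<sigma> k. v \<sigma> k - trunc m v \<sigma> k)"
proof -
  note nm = synth_support_mono[OF nice_trunc[OF m] lattice_box_mono[OF mn] finite_lattice_box]
  note nn = nice_trunc[where n = n, OF m]
  have "(\<integral>\<^sup>+p. ennreal ((cmod (synth (lattice_box n) (trunc n v) p - synth (lattice_box m) (trunc m v) p))\<^sup>2) \<partial>RT2)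
      = (\<integral>\<^sup>+p. ennreal ((cmod (synth (lattice_box n) (\<lambda>\<sigma> k. trunc n v \<sigma> k - trunc m v \<sigma> k) p))\<^sup>2) \<partial>RT2)"
    unfolding synth_diff(2)[OF nn nm(1)] nm(2) ..
  also have "\<dots> \<le> ennreal ((2 * pi) ^ 3) * weighted_sq 0 0 (\<lambda>\<sigma> k. trunc n v \<sigma> k - trunc m v \<sigma> k)"
    by (rule synth_bessel_weighted[OF synth_diff(1)[OF nn nm(1)]])
  also have "\<dots> \<le> ennreal ((2 * pi) ^ 3) * weighted_sq 0 0 (\<lambda>\<sigma> k. v \<sigma> k - trunc m v \<sigma> k)"
  proof (intro mult_left_mono weighted_sq_mono)
    fix \<sigma> k
    show "cmod (trunc n v \<sigma> k - trunc m v \<sigma> k) \<le> cmod (v \<sigma> k - trunc m v \<sigma> k)"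
      using lattice_box_mono[OF mn] mn by (auto simp: trunc_def)
  qed auto
  finally show ?thesis .
qed

text \<open>
  The truncations converge in \<open>L\<^sup>1\<close> against a Gaussian weight in time, and the limit has the same
  transform as \<open>u\<close>.
\<close>

lemma approximable_of_has_st_fourier:
  assumes u: "has_st_fourier u v" and sb: "s \<ge> 0" "b \<ge> 0" and fin: "weighted_sq s b v < \<infinity>"
  shows "approximable s b u (weighted_sq s b v)"
proof -
  \<comment> \<open>The normalisation omitted from \<open>synth\<close>. Since c <= 1, the rescaled
    transform has no larger weighted norm than v.\<close>
  define c where "c = 1 / (2 * pi) ^ 3"
  have c: "0 < c" "c \<le> 1"
  proof -
    have "1 \<le> (2 * pi) ^ 3" using pi_gt3 by (intro one_le_power) auto
    then show "0 < c" "c \<le> 1" by (auto simp: c_def)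
  qed
  define w where "w \<sigma> k = of_real c * v \<sigma> k" for \<sigma> k
  have vm: "(\<lambda>\<sigma>. v \<sigma> k) \<in> borel_measurable borel" for k using u by (simp add: has_st_fourier_def)
  then have wm: "(\<lambda>\<sigma>. w \<sigma> k) \<in> borel_measurable borel" for k unfolding w_def by measurable
  have wv: "cmod (w \<sigma> k) \<le> cmod (v \<sigma> k)" for \<sigma> k
    using c by (simp add: w_def norm_mult mult_left_le_one_le)
  have w0: "weighted_sq 0 0 w < \<infinity>"
    using weighted_sq_mono[of w v 0 0, OF wv] weighted_sq_0_0_le[OF sb, of v] fin by (meson order.strict_trans1 order_trans)
  define T where "T n = weighted_sq 0 0 (\<lambda>\<sigma> k. w \<sigma> k - trunc n w \<sigma> k)" for n
  have T0: "T \<longlonglongrightarrow> 0" unfolding T_def using wm w0 by (rule weighted_sq_trunc_tendsto)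
  have "\<exists>N. \<forall>n\<ge>N. T n \<le> ennreal ((1 / 4) ^ j)" for j
  proof -
    have "\<forall>\<^sub>F n in sequentially. T n < ennreal ((1 / 4) ^ j)"
      using T0 by (rule order_tendstoD) simp
    then show ?thesis unfolding eventually_sequentially by (meson less_imp_le)
  qed
  then obtain N where N: "\<And>j n. n \<ge> N j \<Longrightarrow> T n \<le> ennreal ((1 / 4) ^ j)" by metis
  \<comment> \<open>The partial sums make \<open>q\<close> monotone and at least \<open>N j\<close>;
    the added j makes it tend to infinity.\<close>
  define q where "q j = (\<Sum>i\<le>j. N i) + j" for j
  have qN: "N j \<le> q j" for j unfolding q_def by (rule trans_le_add1, rule member_le_sum) auto
  have qS: "q j \<le> q (Suc j)" and qj: "j \<le> q j" for j by (simp_all add: q_def)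
  define U where "U j = synth (lattice_box (q j)) (trunc (q j) w)" for j
  have nice: "nice (lattice_box n) (trunc n w)" for n by (rule nice_trunc[OF wm])
  have Um [measurable]: "U j \<in> borel_measurable RT2" for j
    unfolding U_def by (intro borel_measurable_RT2 borel_measurable_synth nice)
  define F where "F j p = U j p * complex_of_real (time_gauss p)" for j p
  have FI: "integrable RT2 (F j)" for j
    unfolding F_def[abs_def] U_def by (rule synth_time_gauss(1)[OF nice])
  define \<Gamma> where "\<Gamma> = enn2real (\<integral>\<^sup>+p. ennreal ((time_gauss p)\<^sup>2) \<partial>RT2)"
  have \<Gamma>: "(\<integral>\<^sup>+p. ennreal ((time_gauss p)\<^sup>2) \<partial>RT2) = ennreal \<Gamma>" "\<Gamma> \<ge> 0"
    using nn_integral_time_gauss_finite by (auto simp: \<Gamma>_def)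
  define C where "C = ((2 * pi) ^ 3 + \<Gamma>) / 2"
  have C: "C \<ge> 0" using \<Gamma> by (simp add: C_def)
  have fast: "(\<integral>\<^sup>+p. ennreal (norm (F (Suc j) p - F j p)) \<partial>RT2) \<le> ennreal (C * (1 / 2) ^ j)" for j
  proof -
    have "(\<integral>\<^sup>+p. ennreal (norm (F (Suc j) p - F j p)) \<partial>RT2) \<le>
        (\<integral>\<^sup>+p. ennreal (2 ^ j / 2) * ennreal ((cmod (U (Suc j) p - U j p))\<^sup>2) +
          ennreal ((1 / 2) ^ j / 2) * ennreal ((time_gauss p)\<^sup>2) \<partial>RT2)"
    proof (rule nn_integral_mono)
      fix p
      define x where "x = cmod (U (Suc j) p - U j p)"
      define y where "y = time_gauss p"
      have y0: "y \<ge> 0" by (simp add: y_def time_gauss_def)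
      \<comment> \<open>Young's inequality weighted by 2^j: the integrals of the squared differences
        are of order 4^(-j), so both resulting terms are of order 2^(-j).\<close>
      have "0 \<le> (2 ^ j * x - y)\<^sup>2" by simp
      then have "2 * (2 ^ j * x) * y \<le> (2 ^ j * x)\<^sup>2 + y\<^sup>2" by (simp add: power2_diff)
      then have "(1 / 2) ^ j / 2 * (2 * (2 ^ j * x) * y) \<le> (1 / 2) ^ j / 2 * ((2 ^ j * x)\<^sup>2 + y\<^sup>2)"
        by (rule mult_left_mono) simp
      moreover have "(1 / 2) ^ j / 2 * (2 * (2 ^ j * x) * y) = x * y"
        by (simp add: power_one_over)
      moreover have "(1 / 2) ^ j / 2 * ((2 ^ j * x)\<^sup>2 + y\<^sup>2) = 2 ^ j / 2 * x\<^sup>2 + (1 / 2) ^ j / 2 * y\<^sup>2"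
        by (simp add: power_one_over power_mult_distrib power2_eq_square field_simps)
      ultimately have "x * y \<le> 2 ^ j / 2 * x\<^sup>2 + (1 / 2) ^ j / 2 * y\<^sup>2" by metis
      moreover have "norm (F (Suc j) p - F j p) = x * y"
        unfolding F_def x_def y_def left_diff_distrib[symmetric] norm_mult by (simp add: time_gauss_def)
      ultimately have "ennreal (norm (F (Suc j) p - F j p)) \<le> ennreal (2 ^ j / 2 * x\<^sup>2 + (1 / 2) ^ j / 2 * y\<^sup>2)"
        by (simp only: ennreal_leI)
      also have "\<dots> = ennreal (2 ^ j / 2) * ennreal (x\<^sup>2) + ennreal ((1 / 2) ^ j / 2) * ennreal (y\<^sup>2)"
      proof -
        have "ennreal (2 ^ j / 2 * x\<^sup>2) = ennreal (2 ^ j / 2) * ennreal (x\<^sup>2)"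
          "ennreal ((1 / 2) ^ j / 2 * y\<^sup>2) = ennreal ((1 / 2) ^ j / 2) * ennreal (y\<^sup>2)"
          by (rule ennreal_mult', simp)+
        moreover have "ennreal (2 ^ j / 2 * x\<^sup>2 + (1 / 2) ^ j / 2 * y\<^sup>2) =
            ennreal (2 ^ j / 2 * x\<^sup>2) + ennreal ((1 / 2) ^ j / 2 * y\<^sup>2)"
          by (rule ennreal_plus) auto
        ultimately show ?thesis by (simp only:)
      qed
      finally show "ennreal (norm (F (Suc j) p - F j p)) \<le> ennreal (2 ^ j / 2) * ennreal ((cmod (U (Suc j) p - U j p))\<^sup>2) +
          ennreal ((1 / 2) ^ j / 2) * ennreal ((time_gauss p)\<^sup>2)"
        by (simp only: x_def y_def)
    qed
    also have "\<dots> = ennreal (2 ^ j / 2) * (\<integral>\<^sup>+p. ennreal ((cmod (U (Suc j) p - U j p))\<^sup>2) \<partial>RT2) +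
        ennreal ((1 / 2) ^ j / 2) * ennreal \<Gamma>"
      unfolding \<Gamma>(1)[symmetric] by (subst nn_integral_add) (auto simp: nn_integral_cmult)
    also have "(\<integral>\<^sup>+p. ennreal ((cmod (U (Suc j) p - U j p))\<^sup>2) \<partial>RT2) \<le> ennreal ((2 * pi) ^ 3) * ennreal ((1 / 4) ^ j)"
    proof -
      have "(\<integral>\<^sup>+p. ennreal ((cmod (U (Suc j) p - U j p))\<^sup>2) \<partial>RT2) \<le> ennreal ((2 * pi) ^ 3) * T (q j)"
        unfolding U_def T_def by (rule trunc_differences_small[OF wm qS])
      also have "\<dots> \<le> ennreal ((2 * pi) ^ 3) * ennreal ((1 / 4) ^ j)"
        by (intro mult_left_mono N qN) auto
      finally show ?thesis .
    qed
    also have "ennreal (2 ^ j / 2) * (ennreal ((2 * pi) ^ 3) * ennreal ((1 / 4) ^ j)) + ennreal ((1 / 2) ^ j / 2) * ennreal \<Gamma> =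
        ennreal (2 ^ j / 2 * ((2 * pi) ^ 3 * (1 / 4) ^ j) + (1 / 2) ^ j / 2 * \<Gamma>)"
      using \<Gamma>(2) by (simp add: ennreal_mult'[symmetric] ennreal_plus[symmetric] del: ennreal_plus)
    also have "2 ^ j / 2 * ((2 * pi) ^ 3 * (1 / 4) ^ j) + (1 / 2) ^ j / 2 * \<Gamma> = C * (1 / 2) ^ j"
    proof -
      have "2 ^ j * (1 / 4) ^ j = (1 / 2 :: real) ^ j" by (simp add: power_mult_distrib[symmetric])
      then have "2 ^ j / 2 * ((2 * pi) ^ 3 * (1 / 4) ^ j) = (2 * pi) ^ 3 / 2 * (1 / 2) ^ j" by simp
      then show ?thesis by (simp add: C_def field_simps)
    qed
    finally show ?thesis by (simp add: mult_left_mono add_mono)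
  qed
  obtain G where G: "integrable RT2 G" "AE p in RT2. (\<lambda>j. F j p) \<longlonglongrightarrow> G p"
    "\<And>\<eta>. \<eta> \<in> borel_measurable RT2 \<Longrightarrow> (\<And>p. norm (\<eta> p) \<le> 1) \<Longrightarrow>
      (\<lambda>j. LINT p|RT2. F j p * \<eta> p) \<longlonglongrightarrow> (LINT p|RT2. G p * \<eta> p)"
    using L1_fast_cauchy[OF FI C fast] by blast
  note ug = has_st_fourier_gauss[OF u]
  have "annihilating (\<lambda>p. u p * of_real (time_gauss p) - G p)"
    unfolding annihilating_def
  proof (intro conjI allI)
    show "integrable RT2 (\<lambda>p. u p * of_real (time_gauss p) - G p)" using ug(1) G(1) by simp
    fix a k
    let ?e = "\<lambda>p::real \<times> (real^2). cis (a * fst p + lat k \<bullet> snd p)"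
    have em: "?e \<in> borel_measurable RT2" by measurable
    have "(\<lambda>j. LINT p|RT2. F j p * ?e p) \<longlonglongrightarrow> (LINT p|RT2. G p * ?e p)"
      by (rule G(3)[OF em]) simp
    moreover have "(\<lambda>j. LINT p|RT2. F j p * ?e p) \<longlonglongrightarrow> (LINT p|RT2. u p * of_real (time_gauss p) * ?e p)"
    proof -
      have "(\<lambda>j. LINT \<sigma>|lborel. trunc (q j) w \<sigma> (- k) * gauss_bump (- a) \<sigma>) \<longlonglongrightarrow> (LINT \<sigma>|lborel. w \<sigma> (- k) * gauss_bump (- a) \<sigma>)"
      proof (rule integral_dominated_convergence)
        have I: "integrable lborel (\<lambda>\<sigma>. w \<sigma> (- k) * gauss_bump (- a) \<sigma>)"
          unfolding w_def mult.assoc using has_st_fourierD(1)[OF u schwartz_gauss_bump] by simp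
        then show "integrable lborel (\<lambda>\<sigma>. norm (w \<sigma> (- k) * gauss_bump (- a) \<sigma>))" by simp
        show "(\<lambda>\<sigma>. w \<sigma> (- k) * gauss_bump (- a) \<sigma>) \<in> borel_measurable lborel" using I by auto
        have [measurable]: "gauss_bump (- a) \<in> borel_measurable borel"
          by (rule schwartz_measurable[OF schwartz_gauss_bump])
        show "(\<lambda>\<sigma>. trunc (q j) w \<sigma> (- k) * gauss_bump (- a) \<sigma>) \<in> borel_measurable lborel" for j
          using trunc_measurable[OF wm] by measurable
        show "AE \<sigma> in lborel. norm (trunc (q j) w \<sigma> (- k) * gauss_bump (- a) \<sigma>) \<le> norm (w \<sigma> (- k) * gauss_bump (- a) \<sigma>)" for j
          by (auto simp: norm_mult intro!: mult_right_mono norm_trunc_le)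
        show "AE \<sigma> in lborel. (\<lambda>j. trunc (q j) w \<sigma> (- k) * gauss_bump (- a) \<sigma>) \<longlonglongrightarrow> w \<sigma> (- k) * gauss_bump (- a) \<sigma>"
        proof (rule AE_I2)
          fix \<sigma>
          have q_top: "filterlim q at_top sequentially"
            using qj by (intro filterlim_at_top_mono[OF filterlim_ident]) auto
          have "\<forall>\<^sub>F j in sequentially. trunc (q j) w \<sigma> (- k) = w \<sigma> (- k)"
            using eventually_compose_filterlim[OF eventually_trunc q_top] .
          then have "\<forall>\<^sub>F j in sequentially. trunc (q j) w \<sigma> (- k) * gauss_bump (- a) \<sigma> = w \<sigma> (- k) * gauss_bump (- a) \<sigma>"
            by eventually_elim simp
          then show "(\<lambda>j. trunc (q j) w \<sigma> (- k) * gauss_bump (- a) \<sigma>) \<longlonglongrightarrow> w \<sigma> (- k) * gauss_bump (- a) \<sigma>"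
            by (rule tendsto_eventually)
        qed
      qed
      then have lim: "(\<lambda>j. of_real ((2 * pi) ^ 3) * (LINT \<sigma>|lborel. trunc (q j) w \<sigma> (- k) * gauss_bump (- a) \<sigma>)) \<longlonglongrightarrow>
          of_real ((2 * pi) ^ 3) * (LINT \<sigma>|lborel. w \<sigma> (- k) * gauss_bump (- a) \<sigma>)"
        by (intro tendsto_intros)
      have wc: "(LINT \<sigma>|lborel. w \<sigma> (- k) * gauss_bump (- a) \<sigma>) = of_real c * (LINT \<sigma>|lborel. v \<sigma> (- k) * gauss_bump (- a) \<sigma>)"
        unfolding w_def mult.assoc by (rule integral_mult_right_zero)
      have "complex_of_real ((2 * pi) ^ 3) * of_real c = 1"
        unfolding of_real_mult[symmetric] by (simp add: c_def)
      then have "of_real ((2 * pi) ^ 3) * (LINT \<sigma>|lborel. w \<sigma> (- k) * gauss_bump (- a) \<sigma>) =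
          (LINT p|RT2. u p * of_real (time_gauss p) * ?e p)"
        unfolding wc ug(2) mult.assoc[symmetric] by simp
      moreover have "(LINT p|RT2. F j p * ?e p) =
          of_real ((2 * pi) ^ 3) * (LINT \<sigma>|lborel. trunc (q j) w \<sigma> (- k) * gauss_bump (- a) \<sigma>)" for j
        unfolding F_def U_def by (rule synth_time_gauss(2)[OF nice])
      ultimately show ?thesis using lim by simp
    qed
    ultimately have eq: "(LINT p|RT2. G p * ?e p) = (LINT p|RT2. u p * of_real (time_gauss p) * ?e p)"
      by (rule LIMSEQ_unique)
    have "(LINT p|RT2. (u p * of_real (time_gauss p) - G p) * ?e p) =
        (LINT p|RT2. u p * of_real (time_gauss p) * ?e p) - (LINT p|RT2. G p * ?e p)"
      unfolding left_diff_distrib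
      by (intro Bochner_Integration.integral_diff integrable_mult_character ug(1) G(1))
    then show "(LINT p|RT2. (u p * of_real (time_gauss p) - G p) * ?e p) = 0" using eq by simp
  qed
  then have "AE p in RT2. u p * of_real (time_gauss p) - G p = 0" by (rule annihilating_AE_0)
  with G(2) have lim: "AE p in RT2. (\<lambda>j. U j p) \<longlonglongrightarrow> u p"
  proof eventually_elim
    case (elim p)
    have g: "complex_of_real (time_gauss p) \<noteq> 0" by (simp add: time_gauss_def)
    have "(\<lambda>j. F j p / of_real (time_gauss p)) \<longlonglongrightarrow> G p / of_real (time_gauss p)"
      using elim(1) g by (intro tendsto_intros)
    moreover have "F j p / of_real (time_gauss p) = U j p" for j using g by (simp add: F_def)
    moreover have "G p = u p * of_real (time_gauss p)" using elim(2) by simp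
    ultimately show ?case using g by simp
  qed
  have "weighted_sq s b (trunc n w) \<le> weighted_sq s b v" for n
    by (rule weighted_sq_mono) (rule order_trans[OF norm_trunc_le wv])
  then show ?thesis
    unfolding approximable_def using nice lim
    by (intro exI[of _ "\<lambda>j. lattice_box (q j)"] exI[of _ "\<lambda>j. trunc (q j) w"]) (auto simp: U_def)
qed

section \<open>Duality\<close>

lemma approximable_L2:
  assumes u: "approximable s b u B" and m: "u \<in> borel_measurable RT2" and sb: "s \<ge> 0" "b \<ge> 0"
  shows "(\<integral>\<^sup>+p. ennreal ((cmod (u p))\<^sup>2) \<partial>RT2) \<le> ennreal ((2 * pi) ^ 3) * B"
proof -
  obtain K V where KV: "\<And>n. nice (K n) (V n)" "\<And>n. weighted_sq s b (V n) \<le> B"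
    and lim: "AE p in RT2. (\<lambda>n::nat. synth (K n) (V n) p) \<longlonglongrightarrow> u p"
    using u unfolding approximable_def by blast
  show ?thesis
  proof (rule nn_integral_le_of_tendsto)
    have [measurable]: "synth (K n) (V n) \<in> borel_measurable RT2" for n
      by (intro borel_measurable_RT2 borel_measurable_synth KV)
    show "(\<lambda>p. ennreal ((cmod (synth (K n) (V n) p))\<^sup>2)) \<in> borel_measurable RT2" for n by measurable
    show "(\<integral>\<^sup>+p. ennreal ((cmod (synth (K n) (V n) p))\<^sup>2) \<partial>RT2) \<le> ennreal ((2 * pi) ^ 3) * B" for n
    proof -
      have "weighted_sq 0 0 (V n) \<le> B" using weighted_sq_0_0_le[OF sb] KV(2) by (rule order_trans)
      then show ?thesis using synth_bessel_weighted[OF KV(1)] by (meson mult_left_mono order_trans zero_le)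
    qed
    show "AE p in RT2. (\<lambda>n. ennreal ((cmod (synth (K n) (V n) p))\<^sup>2)) \<longlonglongrightarrow> ennreal ((cmod (u p))\<^sup>2)"
      using lim by eventually_elim (intro tendsto_intros tendsto_ennrealI)
  qed
qed

text \<open>The products of the two approximating syntheses converge almost everywhere to u g, and
  Fatou preserves the bound.\<close>

lemma bilinear_approximable:
  fixes s b :: real
  assumes "s > 0" "b > 1 / 4" "b > 1 / 2 - s / 4"
  shows "\<exists>C>0. \<forall>u g A B. approximable s b u A \<longrightarrow> approximable 0 b g B \<longrightarrow>
    (\<integral>\<^sup>+p. ennreal ((cmod (u p * g p))\<^sup>2) \<partial>RT2) \<le> ennreal C * (A * B)"
proof -
  obtain C where C: "C > 0" "\<And>K V L W. nice K V \<Longrightarrow> nice L W \<Longrightarrow>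
    (\<integral>\<^sup>+p. ennreal ((cmod (synth K V p * synth L W p))\<^sup>2) \<partial>RT2)
    \<le> ennreal C * (weighted_sq s b V * weighted_sq 0 b W)"
    using bilinear_nice[OF assms] by blast
  have "(\<integral>\<^sup>+p. ennreal ((cmod (u p * g p))\<^sup>2) \<partial>RT2) \<le> ennreal C * (A * B)"
    if u: "approximable s b u A" and g: "approximable 0 b g B" for u g A B
  proof -
    obtain K V where KV: "\<And>n. nice (K n) (V n)" "\<And>n. weighted_sq s b (V n) \<le> A"
      and lim1: "AE p in RT2. (\<lambda>n::nat. synth (K n) (V n) p) \<longlonglongrightarrow> u p"
      using u unfolding approximable_def by blast
    obtain L W where LW: "\<And>n. nice (L n) (W n)" "\<And>n. weighted_sq 0 b (W n) \<le> B"
      and lim2: "AE p in RT2. (\<lambda>n::nat. synth (L n) (W n) p) \<longlonglongrightarrow> g p"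
      using g unfolding approximable_def by blast
    show ?thesis
    proof (rule nn_integral_le_of_tendsto)
      have [measurable]: "synth (K n) (V n) \<in> borel_measurable RT2" "synth (L n) (W n) \<in> borel_measurable RT2" for n
        by (intro borel_measurable_RT2 borel_measurable_synth KV LW)+
      show "(\<lambda>p. ennreal ((cmod (synth (K n) (V n) p * synth (L n) (W n) p))\<^sup>2)) \<in> borel_measurable RT2" for n by measurable
      show "(\<integral>\<^sup>+p. ennreal ((cmod (synth (K n) (V n) p * synth (L n) (W n) p))\<^sup>2) \<partial>RT2) \<le> ennreal C * (A * B)" for n
      proof -
        have "weighted_sq s b (V n) * weighted_sq 0 b (W n) \<le> A * B" using KV(2) LW(2) by (intro mult_mono) auto
        then show ?thesis using C(2)[OF KV(1) LW(1)] by (meson mult_left_mono order_trans zero_le)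
      qed
      show "AE p in RT2. (\<lambda>n. ennreal ((cmod (synth (K n) (V n) p * synth (L n) (W n) p))\<^sup>2)) \<longlonglongrightarrow> ennreal ((cmod (u p * g p))\<^sup>2)"
        using lim1 lim2 by eventually_elim (intro tendsto_intros tendsto_ennrealI)
    qed
  qed
  then show ?thesis using C(1) by blast
qed

lemma approximable_synth:
  assumes "nice K V"
  shows "approximable s b (synth K V) (weighted_sq s b V)"
  unfolding approximable_def using assms
  by (intro exI[of _ "\<lambda>_. K"] exI[of _ "\<lambda>_. V"]) auto

text \<open>
  Duality: testing \<open>w\<close> against the synthesis of the truncated \<open>\<langle>\<sigma> + |k|\<^sup>2\<rangle>\<^sup>-\<^sup>2\<^sup>b\<close> times its own transform
  gives the square of the truncated norm on the left, and only its first power on the right.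
\<close>

lemma weighted_sq_le_by_duality:
  assumes w: "integrable RT2 w" and b: "b \<ge> 0"
    and dual: "\<And>K V. nice K V \<Longrightarrow>
      (\<integral>\<^sup>+p. ennreal (cmod (w p * synth K V p)) \<partial>RT2)\<^sup>2 \<le> D * weighted_sq 0 b V"
  shows "weighted_sq 0 (- b) (st_fourier_integral w) \<le> D"
proof -
  define h where "h = st_fourier_integral w"
  define J where "J \<sigma> k = japanese (\<sigma> + (norm (lat k))\<^sup>2)" for \<sigma> and k :: "int ^ 2"
  have J0: "J \<sigma> k > 0" and J1: "J \<sigma> k \<ge> 1" for \<sigma> k by (simp_all add: J_def japanese_ge_1)
  have [measurable]: "(\<lambda>\<sigma>. J \<sigma> k) \<in> borel_measurable borel" for k unfolding J_def by measurable
  have hm [measurable]: "(\<lambda>\<sigma>. h \<sigma> k) \<in> borel_measurable borel" for k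
    using has_st_fourier_st_fourier_integral[OF w] by (simp add: has_st_fourier_def h_def)
  \<comment> \<open>The transform of an integrable function is bounded; this makes the truncated
    test transforms integrable and every \<open>S n\<close> finite.\<close>
  define B where "B = (LINT p|RT2. norm (w p))"
  have hB: "cmod (h \<sigma> k) \<le> B" for \<sigma> k
  proof -
    have "cmod (h \<sigma> k) \<le> (LINT p|RT2. norm (w p * cis (- \<sigma> * fst p - lat k \<bullet> snd p)))"
      unfolding h_def st_fourier_integral_def by (rule integral_norm_bound)
    then show ?thesis by (simp add: B_def norm_mult)
  qed
  have B0: "B \<ge> 0" by (simp add: B_def)
  define \<rho> where "\<rho> n \<sigma> k = (if k \<in> lattice_box n \<and> \<bar>\<sigma>\<bar> \<le> real n then J \<sigma> k powr (- 2 * b) else 0)" for n \<sigma> k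
  have \<rho>m [measurable]: "(\<lambda>\<sigma>. \<rho> n \<sigma> k) \<in> borel_measurable borel" for n k unfolding \<rho>_def by measurable
  have \<rho>0: "\<rho> n \<sigma> k \<ge> 0" for n \<sigma> k by (simp add: \<rho>_def)
  have \<rho>1: "\<rho> n \<sigma> k \<le> indicator {- real n..real n} \<sigma>" for n \<sigma> k
  proof -
    have "J \<sigma> k powr (- 2 * b) \<le> J \<sigma> k powr 0" using J1[of \<sigma> k] b by (intro powr_mono) auto
    then show ?thesis using J0[of \<sigma> k] by (auto simp: \<rho>_def indicator_def)
  qed
  define S where "S n = (\<integral>\<^sup>+k. (\<integral>\<^sup>+\<sigma>. ennreal (\<rho> n \<sigma> k * (cmod (h \<sigma> k))\<^sup>2) \<partial>lborel) \<partial>count_space UNIV)" for n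
  have SD: "S n \<le> D" for n
  proof -
    define V where "V \<sigma> k = of_real (\<rho> n \<sigma> k) * h \<sigma> k" for \<sigma> k
    have bd: "integrable lborel (\<lambda>\<sigma>. c * indicator {- real n..real n} \<sigma> :: real)" for c
      by (intro integrable_mult_right) (auto intro!: integrable_real_indicator)
    have V: "nice (lattice_box n) V"
      unfolding nice_def
    proof (intro conjI allI impI)
      show "finite (lattice_box n)" by (rule finite_lattice_box)
      show "integrable lborel (\<lambda>\<sigma>. V \<sigma> k)" for k
      proof (rule Bochner_Integration.integrable_bound[OF bd[of B]])
        show "(\<lambda>\<sigma>. V \<sigma> k) \<in> borel_measurable lborel" unfolding V_def by measurable
        show "AE \<sigma> in lborel. norm (V \<sigma> k) \<le> norm (B * indicator {- real n..real n} \<sigma> :: real)"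
        proof (rule AE_I2)
          fix \<sigma>
          have "\<rho> n \<sigma> k * cmod (h \<sigma> k) \<le> indicator {- real n..real n} \<sigma> * B"
            by (intro mult_mono \<rho>1 hB) auto
          then show "norm (V \<sigma> k) \<le> norm (B * indicator {- real n..real n} \<sigma> :: real)"
            using \<rho>0[of n \<sigma> k] B0 by (simp add: V_def norm_mult mult.commute)
        qed
      qed
      show "V \<sigma> k = 0" if "k \<notin> lattice_box n" for \<sigma> k using that by (simp add: V_def \<rho>_def)
    qed
    \<comment> \<open>The cutoff weight \<open>\<rho>\<close> is reproduced: on its support J^(2b)
      times its square is the weight itself.\<close>
    have wV: "weighted_sq 0 b V = S n"
      unfolding weighted_sq_def S_def
    proof (intro nn_integral_cong arg_cong[where f = ennreal])
      fix k \<sigma>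
      have "(J \<sigma> k powr b * \<rho> n \<sigma> k)\<^sup>2 = \<rho> n \<sigma> k"
        by (simp add: \<rho>_def power2_eq_square powr_add[symmetric])
      then have "(J \<sigma> k powr b * (\<rho> n \<sigma> k * cmod (h \<sigma> k)))\<^sup>2 = \<rho> n \<sigma> k * (cmod (h \<sigma> k))\<^sup>2"
        by (metis mult.assoc power_mult_distrib)
      then show "(japanese (lat k) powr 0 * japanese (\<sigma> + (norm (lat k))\<^sup>2) powr b * cmod (V \<sigma> k))\<^sup>2 = \<rho> n \<sigma> k * (cmod (h \<sigma> k))\<^sup>2"
        using \<rho>0[of n \<sigma> k] by (simp add: V_def J_def norm_mult)
    qed
    have eI: "integrable lborel (\<lambda>\<sigma>. \<rho> n \<sigma> k * (cmod (h \<sigma> k))\<^sup>2)" for k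
    proof (rule Bochner_Integration.integrable_bound[OF bd[of "B\<^sup>2"]])
      show "AE \<sigma> in lborel. norm (\<rho> n \<sigma> k * (cmod (h \<sigma> k))\<^sup>2) \<le> norm (B\<^sup>2 * indicator {- real n..real n} \<sigma> :: real)"
      proof (rule AE_I2)
        fix \<sigma>
        have "\<rho> n \<sigma> k * (cmod (h \<sigma> k))\<^sup>2 \<le> indicator {- real n..real n} \<sigma> * B\<^sup>2"
          by (intro mult_mono \<rho>1 power_mono hB) auto
        then show "norm (\<rho> n \<sigma> k * (cmod (h \<sigma> k))\<^sup>2) \<le> norm (B\<^sup>2 * indicator {- real n..real n} \<sigma> :: real)"
          using \<rho>0[of n \<sigma> k] by (simp add: mult.commute)
      qed
    qed measurable
    define E where "E k = (LINT \<sigma>|lborel. \<rho> n \<sigma> k * (cmod (h \<sigma> k))\<^sup>2)" for k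
    have E0: "E k \<ge> 0" for k unfolding E_def using \<rho>0 by (intro Bochner_Integration.integral_nonneg) auto
    have SE: "S n = ennreal (\<Sum>k\<in>lattice_box n. E k)"
    proof -
      have "S n = (\<Sum>k\<in>lattice_box n. \<integral>\<^sup>+\<sigma>. ennreal (\<rho> n \<sigma> k * (cmod (h \<sigma> k))\<^sup>2) \<partial>lborel)"
        unfolding S_def by (rule nn_integral_count_space'[OF finite_lattice_box]) (auto simp: \<rho>_def)
      also have "\<dots> = (\<Sum>k\<in>lattice_box n. ennreal (E k))"
        unfolding E_def using \<rho>0 by (intro sum.cong refl nn_integral_eq_integral eI) auto
      also have "\<dots> = ennreal (\<Sum>k\<in>lattice_box n. E k)" using E0 by (intro sum_ennreal) auto
      finally show ?thesis .
    qed
    have Ek: "complex_of_real (E k) =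
        (LINT p|RT2. w p * cnj ((LINT \<sigma>|lborel. V \<sigma> k * cis (\<sigma> * fst p)) * cis (lat k \<bullet> snd p)))" for k
    proof -
      have "complex_of_real (E k) = (LINT \<sigma>|lborel. complex_of_real (\<rho> n \<sigma> k * (cmod (h \<sigma> k))\<^sup>2))"
        unfolding E_def by (rule integral_complex_of_real[symmetric])
      also have "\<dots> = (LINT \<sigma>|lborel. cnj (V \<sigma> k) * (LINT p|RT2. (w p * cis (- (lat k \<bullet> snd p))) * cis (\<sigma> * (- fst p))))"
      proof (intro Bochner_Integration.integral_cong refl)
        fix \<sigma>
        have eq: "(w p * cis (- (lat k \<bullet> snd p))) * cis (\<sigma> * (- fst p)) = w p * cis (- \<sigma> * fst p - lat k \<bullet> snd p)" for p
          unfolding mult.assoc cis_mult by (simp add: algebra_simps)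
        have "(LINT p|RT2. (w p * cis (- (lat k \<bullet> snd p))) * cis (\<sigma> * (- fst p))) = h \<sigma> k"
          unfolding eq h_def st_fourier_integral_def ..
        moreover have "complex_of_real ((cmod (h \<sigma> k))\<^sup>2) = cnj (h \<sigma> k) * h \<sigma> k"
          unfolding complex_norm_square by (rule mult.commute)
        ultimately show "complex_of_real (\<rho> n \<sigma> k * (cmod (h \<sigma> k))\<^sup>2) =
            cnj (V \<sigma> k) * (LINT p|RT2. (w p * cis (- (lat k \<bullet> snd p))) * cis (\<sigma> * (- fst p)))"
          unfolding of_real_mult by (simp add: V_def mult.assoc)
      qed
      also have "\<dots> = (LINT p|RT2. (LINT \<sigma>|lborel. cnj (V \<sigma> k) * cis (\<sigma> * (- fst p))) * (w p * cis (- (lat k \<bullet> snd p))))"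
      proof (rule fourier_multiplication_formula[OF sigma_finite_RT2, symmetric])
        show "integrable lborel (\<lambda>\<sigma>. cnj (V \<sigma> k))" using niceD(2)[OF V] by (simp add: integrable_cnj)
        show "integrable RT2 (\<lambda>p. w p * cis (- (lat k \<bullet> snd p)))"
          by (rule integrable_mult_bounded[OF w]) auto
      qed measurable
      also have "\<dots> = (LINT p|RT2. w p * cnj ((LINT \<sigma>|lborel. V \<sigma> k * cis (\<sigma> * fst p)) * cis (lat k \<bullet> snd p)))"
      proof (intro Bochner_Integration.integral_cong refl)
        fix p :: "real \<times> (real^2)"
        have "(LINT \<sigma>|lborel. cnj (V \<sigma> k) * cis (\<sigma> * (- fst p))) = cnj (LINT \<sigma>|lborel. V \<sigma> k * cis (\<sigma> * fst p))"
          unfolding Bochner_Integration.integral_cnj[symmetric] by (simp add: cis_cnj)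
        then show "(LINT \<sigma>|lborel. cnj (V \<sigma> k) * cis (\<sigma> * (- fst p))) * (w p * cis (- (lat k \<bullet> snd p))) =
            w p * cnj ((LINT \<sigma>|lborel. V \<sigma> k * cis (\<sigma> * fst p)) * cis (lat k \<bullet> snd p))"
          by (simp add: cis_cnj mult_ac)
      qed
      finally show ?thesis .
    qed
    have "S n \<le> (\<integral>\<^sup>+p. ennreal (cmod (w p * synth (lattice_box n) V p)) \<partial>RT2)"
    proof -
      define g where "g k p = (LINT \<sigma>|lborel. V \<sigma> k * cis (\<sigma> * fst p)) * cis (lat k \<bullet> snd p)" for k and p :: "real \<times> (real^2)"
      have gI: "integrable RT2 (\<lambda>p. w p * cnj (g k p))" for k
      proof (rule Bochner_Integration.integrable_bound)
        define c where "c = (LINT \<sigma>|lborel. norm (V \<sigma> k))"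
        have c0: "c \<ge> 0" by (simp add: c_def)
        have gc: "norm (g k p) \<le> c" for p
        proof -
          have "norm (g k p) = norm (LINT \<sigma>|lborel. V \<sigma> k * cis (\<sigma> * fst p))"
            by (simp add: g_def norm_mult)
          also have "\<dots> \<le> (LINT \<sigma>|lborel. norm (V \<sigma> k * cis (\<sigma> * fst p)))"
            by (rule integral_norm_bound)
          finally show ?thesis by (simp add: c_def norm_mult)
        qed
        show "integrable RT2 (\<lambda>p. c * norm (w p))" using w by simp
        show "AE p in RT2. norm (w p * cnj (g k p)) \<le> norm (c * norm (w p))"
        proof (rule AE_I2)
          fix p
          have "norm (w p) * norm (g k p) \<le> norm (w p) * c" by (intro mult_left_mono gc) auto
          then show "norm (w p * cnj (g k p)) \<le> norm (c * norm (w p))"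
            using c0 by (simp add: norm_mult mult.commute)
        qed
        note [measurable] = nice_measurable[OF V] borel_measurable_integrable[OF w]
        have [measurable]: "(\<lambda>t. LINT \<sigma>|lborel. V \<sigma> k * cis (\<sigma> * t)) \<in> borel_measurable borel" by measurable
        show "(\<lambda>p. w p * cnj (g k p)) \<in> borel_measurable RT2" unfolding g_def by measurable
      qed
      have "complex_of_real (\<Sum>k\<in>lattice_box n. E k) = (\<Sum>k\<in>lattice_box n. LINT p|RT2. w p * cnj (g k p))"
        unfolding of_real_sum Ek g_def ..
      also have "\<dots> = (LINT p|RT2. (\<Sum>k\<in>lattice_box n. w p * cnj (g k p)))"
        by (rule Bochner_Integration.integral_sum[symmetric]) (rule gI)
      also have "\<dots> = (LINT p|RT2. w p * cnj (synth (lattice_box n) V p))"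
        unfolding synth_def g_def cnj_sum sum_distrib_left ..
      finally have eq: "complex_of_real (\<Sum>k\<in>lattice_box n. E k) = (LINT p|RT2. w p * cnj (synth (lattice_box n) V p))" .
      have "S n = ennreal (norm (complex_of_real (\<Sum>k\<in>lattice_box n. E k)))"
        unfolding SE norm_of_real using E0 by (simp add: sum_nonneg)
      also have "\<dots> \<le> (\<integral>\<^sup>+p. ennreal (norm (w p * cnj (synth (lattice_box n) V p))) \<partial>RT2)"
        unfolding eq by (rule ennreal_norm_integral_le)
      finally show ?thesis by (simp add: norm_mult)
    qed
    then have "(S n)\<^sup>2 \<le> (\<integral>\<^sup>+p. ennreal (cmod (w p * synth (lattice_box n) V p)) \<partial>RT2)\<^sup>2"
      by (intro power_mono) auto
    also have "\<dots> \<le> D * S n" using dual[OF V] unfolding wV .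
    \<comment> \<open>One factor \<open>S n\<close> can be cancelled, since it is finite, unless it
      is 0.\<close>
    finally have SS: "S n * S n \<le> S n * D" by (simp add: power2_eq_square mult.commute)
    show "S n \<le> D"
    proof (cases "S n = 0")
      case False
      have "S n < top" unfolding SE by simp
      then show ?thesis using SS False by (subst (asm) ennreal_mult_le_mult_iff) auto
    qed simp
  qed
  let ?N = "count_space (UNIV :: (int ^ 2) set) \<Otimes>\<^sub>M (lborel :: real measure)"
  have "weighted_sq 0 (- b) h = (\<integral>\<^sup>+k. (\<integral>\<^sup>+\<sigma>. ennreal (J \<sigma> k powr (- 2 * b) * (cmod (h \<sigma> k))\<^sup>2) \<partial>lborel) \<partial>count_space UNIV)"
    unfolding weighted_sq_def
  proof (intro nn_integral_cong arg_cong[where f = ennreal])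
    fix k \<sigma>
    have "(J \<sigma> k powr (- b))\<^sup>2 = J \<sigma> k powr (- 2 * b)"
      by (simp add: power2_eq_square powr_add[symmetric])
    then show "(japanese (lat k) powr 0 * japanese (\<sigma> + (norm (lat k))\<^sup>2) powr (- b) * cmod (h \<sigma> k))\<^sup>2 = J \<sigma> k powr (- 2 * b) * (cmod (h \<sigma> k))\<^sup>2"
      by (simp add: J_def power_mult_distrib)
  qed
  also have "\<dots> = (\<integral>\<^sup>+z. ennreal (J (snd z) (fst z) powr (- 2 * b) * (cmod (h (snd z) (fst z)))\<^sup>2) \<partial>?N)"
    by (rule nn_integral_mode_pair[of "\<lambda>k \<sigma>. ennreal (J \<sigma> k powr (- 2 * b) * (cmod (h \<sigma> k))\<^sup>2)"]) measurable
  \<comment> \<open>Fatou removes the cutoff, which each point eventually passes.\<close>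
  also have "\<dots> \<le> D"
  proof (rule nn_integral_le_of_tendsto)
    show "(\<lambda>z. ennreal (\<rho> n (snd z) (fst z) * (cmod (h (snd z) (fst z)))\<^sup>2)) \<in> borel_measurable ?N" for n
      by (rule measurable_mode_pair[of "\<lambda>k \<sigma>. ennreal (\<rho> n \<sigma> k * (cmod (h \<sigma> k))\<^sup>2)"]) measurable
    have "S n = (\<integral>\<^sup>+z. ennreal (\<rho> n (snd z) (fst z) * (cmod (h (snd z) (fst z)))\<^sup>2) \<partial>?N)" for n
      unfolding S_def
      by (rule nn_integral_mode_pair[of "\<lambda>k \<sigma>. ennreal (\<rho> n \<sigma> k * (cmod (h \<sigma> k))\<^sup>2)"]) measurable
    then show "(\<integral>\<^sup>+z. ennreal (\<rho> n (snd z) (fst z) * (cmod (h (snd z) (fst z)))\<^sup>2) \<partial>?N) \<le> D" for n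
      using SD[of n] by simp
    show "AE z in ?N. (\<lambda>n. ennreal (\<rho> n (snd z) (fst z) * (cmod (h (snd z) (fst z)))\<^sup>2)) \<longlonglongrightarrow>
        ennreal (J (snd z) (fst z) powr (- 2 * b) * (cmod (h (snd z) (fst z)))\<^sup>2)"
    proof (rule AE_I2)
      fix z :: "(int ^ 2) \<times> real"
      have "\<forall>\<^sub>F n in sequentially. \<bar>snd z\<bar> \<le> real n"
        using filterlim_real_sequentially by (simp add: filterlim_at_top)
      with eventually_in_lattice_box[of "fst z"]
      have "\<forall>\<^sub>F n in sequentially. ennreal (\<rho> n (snd z) (fst z) * (cmod (h (snd z) (fst z)))\<^sup>2) =
          ennreal (J (snd z) (fst z) powr (- 2 * b) * (cmod (h (snd z) (fst z)))\<^sup>2)"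
        by eventually_elim (simp add: \<rho>_def)
      then show "(\<lambda>n. ennreal (\<rho> n (snd z) (fst z) * (cmod (h (snd z) (fst z)))\<^sup>2)) \<longlonglongrightarrow>
        ennreal (J (snd z) (fst z) powr (- 2 * b) * (cmod (h (snd z) (fst z)))\<^sup>2)"
        by (rule tendsto_eventually)
    qed
  qed
  finally show ?thesis unfolding h_def .
qed

lemma XspaceD:
  assumes "u \<in> Xspace s b"
  obtains v where "has_st_fourier u v" "weighted_sq s b v < \<infinity>" "periodic u" "u \<in> borel_measurable RT2"
    "Xnorm s b u = sqrt (enn2real (weighted_sq s b v))"
  using assms Xnorm_eq unfolding Xspace_def has_st_fourier_def by blast

section \<open>The trilinear estimate\<close>

text \<open>Stated through |w| alone, so that the conjugate and the order of the factors are dealt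
  with once and for all. Here f is paired with h, and g with the dual test function.\<close>

lemma trilinear_estimate:
  fixes s b :: real
  assumes sb: "s > 0" "b > 1 / 4" "b > 1 / 2 - s / 4"
  shows "\<exists>C>0. \<forall>f g h w. f \<in> Xspace s b \<longrightarrow> g \<in> Xspace s b \<longrightarrow> h \<in> Xspace 0 b \<longrightarrow>
    periodic w \<longrightarrow> w \<in> borel_measurable RT2 \<longrightarrow> (\<forall>p. cmod (w p) = cmod (f p) * cmod (g p) * cmod (h p)) \<longrightarrow>
    w \<in> Xspace 0 (- b) \<and> Xnorm 0 (- b) w \<le> C * Xnorm s b f * Xnorm s b g * Xnorm 0 b h"
proof -
  obtain C where C: "C > 0" "\<And>u g A B. approximable s b u A \<Longrightarrow> approximable 0 b g B \<Longrightarrow>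
    (\<integral>\<^sup>+p. ennreal ((cmod (u p * g p))\<^sup>2) \<partial>RT2) \<le> ennreal C * (A * B)"
    using bilinear_approximable[OF sb] by blast
  have b0: "b \<ge> 0" "s \<ge> 0" using sb by auto
  have "w \<in> Xspace 0 (- b) \<and> Xnorm 0 (- b) w \<le> C * Xnorm s b f * Xnorm s b g * Xnorm 0 b h"
    if f: "f \<in> Xspace s b" and g: "g \<in> Xspace s b" and h: "h \<in> Xspace 0 b"
      and per: "periodic w" and wm: "w \<in> borel_measurable RT2"
      and nw: "\<And>p. cmod (w p) = cmod (f p) * cmod (g p) * cmod (h p)" for f g h w
  proof -
    obtain f' where f': "has_st_fourier f f'" "weighted_sq s b f' < \<infinity>" "f \<in> borel_measurable RT2"
      "Xnorm s b f = sqrt (enn2real (weighted_sq s b f'))" using f by (rule XspaceD)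
    obtain g' where g': "has_st_fourier g g'" "weighted_sq s b g' < \<infinity>" "g \<in> borel_measurable RT2"
      "Xnorm s b g = sqrt (enn2real (weighted_sq s b g'))" using g by (rule XspaceD)
    obtain h' where h': "has_st_fourier h h'" "weighted_sq 0 b h' < \<infinity>" "h \<in> borel_measurable RT2"
      "Xnorm 0 b h = sqrt (enn2real (weighted_sq 0 b h'))" using h by (rule XspaceD)
    define A1 where "A1 = enn2real (weighted_sq s b f')"
    define A2 where "A2 = enn2real (weighted_sq s b g')"
    define A3 where "A3 = enn2real (weighted_sq 0 b h')"
    have A: "weighted_sq s b f' = ennreal A1" "weighted_sq s b g' = ennreal A2" "weighted_sq 0 b h' = ennreal A3"
      using f'(2) g'(2) h'(2) by (simp_all add: A1_def A2_def A3_def)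
    have A0: "A1 \<ge> 0" "A2 \<ge> 0" "A3 \<ge> 0" by (simp_all add: A1_def A2_def A3_def)
    note [measurable] = f'(3) g'(3) h'(3) wm
    have af: "approximable s b f (ennreal A1)"
      using approximable_of_has_st_fourier[OF f'(1) b0(2) b0(1) f'(2)] unfolding A .
    have ag: "approximable s b g (ennreal A2)"
      using approximable_of_has_st_fourier[OF g'(1) b0(2) b0(1) g'(2)] unfolding A .
    have ah: "approximable 0 b h (ennreal A3)"
      using approximable_of_has_st_fourier[OF h'(1) order_refl b0(1) h'(2)] unfolding A .
    have fh: "(\<integral>\<^sup>+p. ennreal ((cmod (f p * h p))\<^sup>2) \<partial>RT2) \<le> ennreal (C * (A1 * A3))"
      using C(2)[OF af ah] C(1) A0 by (simp add: ennreal_mult)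
    have CS: "(\<integral>\<^sup>+p. ennreal (cmod (w p * z p)) \<partial>RT2)\<^sup>2 \<le>
        ennreal (C * (A1 * A3)) * (\<integral>\<^sup>+p. ennreal ((cmod (g p * z p))\<^sup>2) \<partial>RT2)"
      if [measurable]: "z \<in> borel_measurable RT2" for z
    proof -
      have eq: "(\<integral>\<^sup>+p. ennreal (cmod (w p * z p)) \<partial>RT2) = (\<integral>\<^sup>+p. ennreal (cmod (f p * h p)) * ennreal (cmod (g p * z p)) \<partial>RT2)"
        by (intro nn_integral_cong) (simp add: norm_mult nw ennreal_mult'[symmetric] mult_ac)
      have "(\<integral>\<^sup>+p. ennreal (cmod (w p * z p)) \<partial>RT2)\<^sup>2 \<le>
          (\<integral>\<^sup>+p. (ennreal (cmod (f p * h p)))\<^sup>2 \<partial>RT2) * (\<integral>\<^sup>+p. (ennreal (cmod (g p * z p)))\<^sup>2 \<partial>RT2)"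
        unfolding eq by (rule Cauchy_Schwarz_nn_integral) measurable
      also have "\<dots> = (\<integral>\<^sup>+p. ennreal ((cmod (f p * h p))\<^sup>2) \<partial>RT2) * (\<integral>\<^sup>+p. ennreal ((cmod (g p * z p))\<^sup>2) \<partial>RT2)"
        by (simp add: ennreal_power)
      also have "\<dots> \<le> ennreal (C * (A1 * A3)) * (\<integral>\<^sup>+p. ennreal ((cmod (g p * z p))\<^sup>2) \<partial>RT2)"
        using fh by (rule mult_right_mono) simp
      finally show ?thesis .
    qed
    \<comment> \<open>Cauchy-Schwarz with test function 1, as f h and g are square integrable.
      Integrability of w allows its transform to be taken as a Fourier integral.\<close>
    have wI: "integrable RT2 w"
    proof (rule integrableI_bounded)
      have "(\<integral>\<^sup>+p. ennreal ((cmod (g p))\<^sup>2) \<partial>RT2) \<le> ennreal ((2 * pi) ^ 3) * ennreal A2"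
        by (rule approximable_L2[OF ag g'(3) b0(2,1)])
      also have "\<dots> < \<infinity>" by (simp add: ennreal_mult_less_top)
      finally have "ennreal (C * (A1 * A3)) * (\<integral>\<^sup>+p. ennreal ((cmod (g p))\<^sup>2) \<partial>RT2) < \<infinity>"
        by (simp add: ennreal_mult_less_top)
      moreover have "(\<integral>\<^sup>+p. ennreal (cmod (w p)) \<partial>RT2)\<^sup>2 \<le> ennreal (C * (A1 * A3)) * (\<integral>\<^sup>+p. ennreal ((cmod (g p))\<^sup>2) \<partial>RT2)"
        using CS[of "\<lambda>_. 1"] by simp
      ultimately have "(\<integral>\<^sup>+p. ennreal (cmod (w p)) \<partial>RT2)\<^sup>2 < \<infinity>" by (rule order.strict_trans1[rotated])
      then show "(\<integral>\<^sup>+p. ennreal (norm (w p)) \<partial>RT2) < \<infinity>"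
        by (simp add: power2_eq_square ennreal_mult_less_top) (metis ennreal_zero_less_top)
    qed (rule wm)
    \<comment> \<open>The bilinear estimate enters once for each pair, hence \<open>C\<close>
      squared here and \<open>C\<close> after the square root.\<close>
    define D where "D = C\<^sup>2 * (A1 * A2 * A3)"
    have D0: "D \<ge> 0" using A0 by (simp add: D_def)
    have le: "weighted_sq 0 (- b) (st_fourier_integral w) \<le> ennreal D"
    proof (rule weighted_sq_le_by_duality[OF wI b0(1)])
      fix K V assume V: "nice K V"
      have sm: "synth K V \<in> borel_measurable RT2"
        by (intro borel_measurable_RT2 borel_measurable_synth V)
      have "(\<integral>\<^sup>+p. ennreal (cmod (w p * synth K V p)) \<partial>RT2)\<^sup>2 \<le>
          ennreal (C * (A1 * A3)) * (\<integral>\<^sup>+p. ennreal ((cmod (g p * synth K V p))\<^sup>2) \<partial>RT2)"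
        by (rule CS[OF sm])
      also have "\<dots> \<le> ennreal (C * (A1 * A3)) * (ennreal C * (ennreal A2 * weighted_sq 0 b V))"
        by (intro mult_left_mono C(2) ag approximable_synth V) auto
      also have "\<dots> = ennreal D * weighted_sq 0 b V"
      proof -
        have "ennreal (C * (A1 * A3)) * ennreal C * ennreal A2 = ennreal D"
          using C(1) A0 by (simp add: D_def ennreal_mult'[symmetric] power2_eq_square mult_ac)
        then show ?thesis by (simp only: mult.assoc[symmetric])
      qed
      finally show "(\<integral>\<^sup>+p. ennreal (cmod (w p * synth K V p)) \<partial>RT2)\<^sup>2 \<le> ennreal D * weighted_sq 0 b V" .
    qed
    have wF: "has_st_fourier w (st_fourier_integral w)" by (rule has_st_fourier_st_fourier_integral[OF wI])
    have "w \<in> Xspace 0 (- b)"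
      unfolding Xspace_def using per wF order.strict_trans1[OF le] by auto
    moreover have "Xnorm 0 (- b) w \<le> C * Xnorm s b f * Xnorm s b g * Xnorm 0 b h"
    proof -
      have "enn2real (weighted_sq 0 (- b) (st_fourier_integral w)) \<le> D"
        using le D0 by (metis enn2real_leI)
      then have "Xnorm 0 (- b) w \<le> sqrt D"
        unfolding Xnorm_eq[OF wF] by (rule real_sqrt_le_mono)
      also have "sqrt D = C * sqrt A1 * sqrt A2 * sqrt A3"
        using C(1) by (simp add: D_def real_sqrt_mult)
      finally show ?thesis by (simp only: f'(4) g'(4) h'(4) A1_def A2_def A3_def)
    qed
    ultimately show ?thesis ..
  qed
  then show ?thesis using C(1) by blast
qed

theorem lemma2p5:
  fixes s b :: real and \<sigma> :: "nat \<Rightarrow> nat"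
  assumes "s > 0"
    and "b > max (1/4) (1/2 - s/4)"
    and "\<sigma> permutes {1, 2, 3}"
  shows "\<exists>C>0. \<forall>u :: nat \<Rightarrow> real \<times> (real ^ 2) \<Rightarrow> complex.
    u (\<sigma> 1) \<in> Xspace s b \<longrightarrow> u (\<sigma> 2) \<in> Xspace s b \<longrightarrow> u (\<sigma> 3) \<in> Xspace 0 b \<longrightarrow>
      (\<lambda>p. u 1 p * cnj (u 2 p) * u 3 p) \<in> Xspace 0 (- b) \<and>
      Xnorm 0 (- b) (\<lambda>p. u 1 p * cnj (u 2 p) * u 3 p)
        \<le> C * Xnorm s b (u (\<sigma> 1)) * Xnorm s b (u (\<sigma> 2)) * Xnorm 0 b (u (\<sigma> 3))"
proof -
  obtain C where C: "C > 0" "\<And>f g h w. f \<in> Xspace s b \<Longrightarrow> g \<in> Xspace s b \<Longrightarrow> h \<in> Xspace 0 b \<Longrightarrow>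
      periodic w \<Longrightarrow> w \<in> borel_measurable RT2 \<Longrightarrow> (\<And>p. cmod (w p) = cmod (f p) * cmod (g p) * cmod (h p)) \<Longrightarrow>
      w \<in> Xspace 0 (- b) \<and> Xnorm 0 (- b) w \<le> C * Xnorm s b f * Xnorm s b g * Xnorm 0 b h"
    using trilinear_estimate[of s b] assms(1,2) by auto
  have "(\<lambda>p. u 1 p * cnj (u 2 p) * u 3 p) \<in> Xspace 0 (- b) \<and>
      Xnorm 0 (- b) (\<lambda>p. u 1 p * cnj (u 2 p) * u 3 p)
        \<le> C * Xnorm s b (u (\<sigma> 1)) * Xnorm s b (u (\<sigma> 2)) * Xnorm 0 b (u (\<sigma> 3))"
    if u: "u (\<sigma> 1) \<in> Xspace s b" "u (\<sigma> 2) \<in> Xspace s b" "u (\<sigma> 3) \<in> Xspace 0 b"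
    for u :: "nat \<Rightarrow> real \<times> (real ^ 2) \<Rightarrow> complex"
  proof (rule C(2)[OF u])
    have img: "\<sigma> ` {1, 2, 3} = {1, 2, 3}" by (rule permutes_image[OF assms(3)])
    have P: "periodic (u i) \<and> u i \<in> borel_measurable RT2" if "i \<in> {1, 2, 3}" for i
    proof -
      have "i \<in> {\<sigma> 1, \<sigma> 2, \<sigma> 3}" using that img by auto
      then show ?thesis using u by (auto elim: XspaceD)
    qed
    then have per: "periodic (u 1)" "periodic (u 2)" "periodic (u 3)"
      and [measurable]: "u 1 \<in> borel_measurable RT2" "u 2 \<in> borel_measurable RT2" "u 3 \<in> borel_measurable RT2"
      by auto
    show "periodic (\<lambda>p. u 1 p * cnj (u 2 p) * u 3 p)" using per by (simp add: periodic_def)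
    show "(\<lambda>p. u 1 p * cnj (u 2 p) * u 3 p) \<in> borel_measurable RT2" by measurable
    fix p
    \<comment> \<open>The permutation merely reorders a product of moduli.\<close>
    have "(\<Prod>i\<in>{1, 2, 3}. cmod (u i p)) = (\<Prod>i\<in>{1, 2, 3}. cmod (u (\<sigma> i) p))"
      using prod.permute[OF assms(3), of "\<lambda>i. cmod (u i p)"] by (simp only: o_def)
    then show "cmod (u 1 p * cnj (u 2 p) * u 3 p) = cmod (u (\<sigma> 1) p) * cmod (u (\<sigma> 2) p) * cmod (u (\<sigma> 3) p)"
      by (simp add: norm_mult mult.assoc)
  qed
  then show ?thesis using C(1) by blast
qed

end
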